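(* Let $C(m)=C(\bar m)$, $\bar m=\int z\,dm(z)$, where $C\in\mathcal{C}^2(\mathbb{R})$, $C(0)=0$, and for some constants $k_1,k_2,K,L>0$ and all $z\in\mathbb{R}$, $$k_1<1-C'(z)<k_2\quad\text{and}\quad\big(\cdot-C(\cdot)\big)^{(-1)}(z)\le Ke^{Lz^2}.$$ Then the terminal value problem for $f=f(y,m,t)$ on $\mathbb{R}\times\mathcal{P}_2\times[0,T]$, $$\begin{cases}f_t+\frac12a^2\left(\iint f_{mm}(y,m,z_1,z_2,t)dm(z_1)dm(z_2)+\int f_{mz}(y,m,z,t)dm(z)\right)+a\int f_{ym}(y,m,z,t)dm(z)+\frac12f_{yy}=0,\\[1mm]a(y,m,t)=\dfrac{f_y(y,m,t)+c(y,t)}{1-\int f_m(y,m,z,t)dm(z)},\qquad f(y,m,T)=C(m),\end{cases}$$ reduces, for $f=f(y,\bar m,t)$, to $$\begin{cases}f_t+\dfrac12\left(\dfrac{f_y+c}{1-f_{\bar m}}\right)^2f_{\bar m\bar m}+\dfrac{f_y+c}{1-f_{\bar m}}f_{y\bar m}+\dfrac12f_{yy}=0\quad\text{in }\mathbb{R}\times\mathbb{R}\times[0,T),\\[2mm]f(y,\bar m,T)=C(\bar m),\end{cases}$$ which has a unique smooth solution, given for $(y,\bar m,t)\in\mathbb{R}\times\mathbb{R}\times[0,T]$ by $$f(y,\bar m,t)=\bar m-\big(g(y,\cdot,t)\big)^{(-1)}(\bar m)-q(y,t),$$ where, for each $\bar m\in\mathbb{R}$, $g(\cdot,\bar m,\cdot)$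 solves $$g_t+\frac12g_{yy}=0\ \text{ in }\mathbb{R}\times[0,T),\qquad g(y,\bar m,T)=\big(\cdot-C(\cdot)-q(y,T)\big)^{(-1)}(\bar m).$$ Furthermore, $1-f_{\bar m}>0$ in $\mathbb{R}\times\mathbb{R}\times[0,T]$.
   Context: $T>0$; $\nu$ is a probability measure on $[\theta_1,\theta_2]$, $0<\theta_1<\theta_2<\infty$; $F(y,t)=\int_{\theta_1}^{\theta_2}e^{y\theta-\frac12\theta^2t}d\nu(\theta)$ and $b=F_y/F$ on $\mathbb{R}\times[0,T]$. $k:\mathbb{R}\times[0,T]\to\mathbb{R}$ is the bounded classical solution of $k_t+\frac12k_{yy}=\frac12b^2$, $k(y,T)=0$, and $c=b+k_y$, which solves $c_t+\frac12c_{yy}=0$, $c(y,T)=b(y,T)$. The function $q:\mathbb{R}\times[0,T]\to\mathbb{R}$ is $$q(y,t)=-\frac12\int_0^tc_y(0,s)\,ds+\int_0^yc(\rho,t)\,d\rho$$ (with $\int_0^y=-\int_y^0$ for $y<0$). $(\cdot)^{(-1)}$ denotes the inverse function in the $\bar m$-argument: e.g. $(\cdot-C(\cdot)-q(y,T))^{(-1)}$ is the inverse of $\zeta\mapsto\zeta-C(\zeta)-q(y,T)$, and $(g(y,\cdot,t))^{(-1)}$ the inverse of $\bar m\mapsto g(y,\bar m,t)$; $g$ is the solution of the heat equation given by the heat kernel. $\mathcal{P}_2$ is the space of probability measures on $\mathbb{R}$ with finite second moment; $f_m(y,m,z,t)$ is the Lions derivative in $m$ evaluated at $z$ (so if $f$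 depends on $m$ only through $\bar m$ then $f_m=f_{\bar m}$), $f_{mz}$ its $z$-derivative, $f_{mm}$ the second derivative in $m$, $f_{ym}$ the mixed derivative. (The first terminal value problem is the one determining the function $f$ in the mean field game with utility $J(x)=-e^{-x}$ and separable payoff $J(x-C(m))$.)
   Formalization: Uniqueness is stated only among solutions with |m̄| ≤ K'exp(L'(y²+(m̄−f(y,m̄,t))²)) for some K', L'; among all smooth solutions it fails (C=0, f=u(y,t) with u Tychonoff's null solution of the heat equation). *)

theory Defs
  imports "HOL-Probability.Probability"
begin

section \<open>The space of measures with finite second moment and the Lions derivative\<close>

definition P2 :: "real measure set" where
  "P2 = {m. prob_space m \<and> sets m = sets borel \<and> integrable m (\<lambda>z. z\<^sup>2)}"

definition mean :: "real measure \<Rightarrow> real" where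
  "mean m = (\<integral>z. z \<partial>m)"

definition couplings :: "real measure \<Rightarrow> real measure \<Rightarrow> (real \<times> real) measure set" where
  "couplings m m' = {\<pi>. prob_space \<pi> \<and> sets \<pi> = sets borel \<and>
     distr \<pi> borel fst = m \<and> distr \<pi> borel snd = m'}"

definition wasserstein2 :: "real measure \<Rightarrow> real measure \<Rightarrow> real" where
  "wasserstein2 m m' = sqrt (INF \<pi>\<in>couplings m m'. \<integral>w. (fst w - snd w)\<^sup>2 \<partial>\<pi>)"

text \<open>Joint continuity on \<open>S \<times> P2\<close>, with \<open>P2\<close> metrised by the 2-Wasserstein distance.\<close>

definition continuous_on_P2 :: "'a::metric_space set \<Rightarrow> ('a \<Rightarrow> real measure \<Rightarrow> real) \<Rightarrow> bool" where
  "continuous_on_P2 S U \<longleftrightarrow>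
     (\<forall>x\<in>S. \<forall>m\<in>P2. \<forall>e>0. \<exists>d>0. \<forall>x'\<in>S. \<forall>m'\<in>P2.
        dist x' x < d \<and> wasserstein2 m' m < d \<longrightarrow> \<bar>U x' m' - U x m\<bar> < e)"

text \<open>The atomless probability space on which functions of measures are lifted; every Borel
  probability measure on the line is the law of some random variable on it.\<close>

definition unit_space :: "real measure" where
  "unit_space = restrict_space lborel {0<..<1}"

definition L2_space :: "(real \<Rightarrow> real) set" where
  "L2_space = {X \<in> borel_measurable unit_space. integrable unit_space (\<lambda>\<omega>. (X \<omega>)\<^sup>2)}"

definition L2_norm :: "(real \<Rightarrow> real) \<Rightarrow> real" where
  "L2_norm X = sqrt (\<integral>\<omega>. (X \<omega>)\<^sup>2 \<partial>unit_space)"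

definition law :: "(real \<Rightarrow> real) \<Rightarrow> real measure" where
  "law X = distr unit_space borel X"

text \<open>\<open>\<xi>\<close> is (a version of) the Lions derivative of \<open>U\<close> at \<open>m\<close>: the lift \<open>X \<mapsto> U (law X)\<close> is Frechet
  differentiable in \<open>L\<^sup>2\<close> at some \<open>X\<close> with law \<open>m\<close>, and its gradient there is \<open>\<xi> \<circ> X\<close>.
  Only the \<open>m\<close>-almost everywhere class of \<open>\<xi>\<close> is determined.\<close>

definition has_lions_derivative ::
    "(real measure \<Rightarrow> real) \<Rightarrow> (real \<Rightarrow> real) \<Rightarrow> real measure \<Rightarrow> bool" where
  "has_lions_derivative U \<xi> m \<longleftrightarrow>
     \<xi> \<in> borel_measurable borel \<and> integrable m (\<lambda>z. (\<xi> z)\<^sup>2) \<and>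
     (\<exists>X\<in>L2_space. law X = m \<and>
        (\<forall>e>0. \<exists>d>0. \<forall>Y\<in>L2_space. L2_norm Y < d \<longrightarrow>
           \<bar>U (law (\<lambda>\<omega>. X \<omega> + Y \<omega>)) - U (law X) - (\<integral>\<omega>. \<xi> (X \<omega>) * Y \<omega> \<partial>unit_space)\<bar>
             \<le> e * L2_norm Y))"

section \<open>Classical solutions of the terminal value problems\<close>

text \<open>Throughout, time derivatives are taken within \<open>[0,T]\<close>, hence are one-sided at \<open>t = 0\<close>.\<close>

definition backward_heat_solution ::
    "real \<Rightarrow> (real \<Rightarrow> real \<Rightarrow> real) \<Rightarrow> (real \<Rightarrow> real) \<Rightarrow> (real \<Rightarrow> real \<Rightarrow> real) \<Rightarrow> bool" where
  "backward_heat_solution T source \<phi> u \<longleftrightarrow>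
     continuous_on (UNIV \<times> {0..T}) (\<lambda>(y,t). u y t) \<and>
     (\<exists>u_t u_y u_yy.
        continuous_on (UNIV \<times> {0..<T}) (\<lambda>(y,t). u_t y t) \<and>
        continuous_on (UNIV \<times> {0..<T}) (\<lambda>(y,t). u_y y t) \<and>
        continuous_on (UNIV \<times> {0..<T}) (\<lambda>(y,t). u_yy y t) \<and>
        (\<forall>y. \<forall>t\<in>{0..<T}.
           ((\<lambda>s. u y s) has_real_derivative u_t y t) (at t within {0..T}) \<and>
           ((\<lambda>x. u x t) has_real_derivative u_y y t) (at y) \<and>
           ((\<lambda>x. u_y x t) has_real_derivative u_yy y t) (at y) \<and>
           u_t y t + 1/2 * u_yy y t = source y t)) \<and>
     (\<forall>y. u y T = \<phi> y)"

text \<open>The problem on \<open>\<real> \<times> P2 \<times> [0,T]\<close>. The Lions derivatives are required to have jointly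
  continuous versions, which are then unique as functions of \<open>(y,m,z,t)\<close>. The second argument
  of \<open>f_mm\<close> is the new variable: \<open>f_mm y m z1 z2 t\<close> is the Lions derivative of
  \<open>m \<mapsto> f_m y m z1 t\<close>, evaluated at \<open>z2\<close>.\<close>

definition solves_measure_problem ::
    "real \<Rightarrow> (real \<Rightarrow> real \<Rightarrow> real) \<Rightarrow> (real measure \<Rightarrow> real) \<Rightarrow>
     (real \<Rightarrow> real measure \<Rightarrow> real \<Rightarrow> real) \<Rightarrow> bool" where
  "solves_measure_problem T c \<Phi> f \<longleftrightarrow>
     continuous_on_P2 (UNIV \<times> {0..T}) (\<lambda>(y,t) m. f y m t) \<and>
     (\<exists>f_t f_y f_yy f_m f_mz f_mm f_ym.
        continuous_on_P2 (UNIV \<times> {0..<T}) (\<lambda>(y,t) m. f_t y m t) \<and>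
        continuous_on_P2 (UNIV \<times> {0..<T}) (\<lambda>(y,t) m. f_y y m t) \<and>
        continuous_on_P2 (UNIV \<times> {0..<T}) (\<lambda>(y,t) m. f_yy y m t) \<and>
        continuous_on_P2 (UNIV \<times> UNIV \<times> {0..<T}) (\<lambda>(y,z,t) m. f_m y m z t) \<and>
        continuous_on_P2 (UNIV \<times> UNIV \<times> {0..<T}) (\<lambda>(y,z,t) m. f_mz y m z t) \<and>
        continuous_on_P2 (UNIV \<times> UNIV \<times> UNIV \<times> {0..<T}) (\<lambda>(y,z1,z2,t) m. f_mm y m z1 z2 t) \<and>
        continuous_on_P2 (UNIV \<times> UNIV \<times> {0..<T}) (\<lambda>(y,z,t) m. f_ym y m z t) \<and>
        (\<forall>y. \<forall>m\<in>P2. \<forall>t\<in>{0..<T}.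
           ((\<lambda>s. f y m s) has_real_derivative f_t y m t) (at t within {0..T}) \<and>
           ((\<lambda>x. f x m t) has_real_derivative f_y y m t) (at y) \<and>
           ((\<lambda>x. f_y x m t) has_real_derivative f_yy y m t) (at y) \<and>
           has_lions_derivative (\<lambda>m'. f y m' t) (\<lambda>z. f_m y m z t) m \<and>
           (\<forall>z. ((\<lambda>x. f_m y m x t) has_real_derivative f_mz y m z t) (at z)) \<and>
           (\<forall>z1. has_lions_derivative (\<lambda>m'. f_m y m' z1 t) (\<lambda>z2. f_mm y m z1 z2 t) m) \<and>
           has_lions_derivative (\<lambda>m'. f_y y m' t) (\<lambda>z. f_ym y m z t) m \<and>
           integrable m (\<lambda>z. f_mz y m z t) \<and>
           integrable (m \<Otimes>\<^sub>M m) (\<lambda>(z1,z2). f_mm y m z1 z2 t) \<and>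
           1 - (\<integral>z. f_m y m z t \<partial>m) \<noteq> 0 \<and>
           (let a = (f_y y m t + c y t) / (1 - (\<integral>z. f_m y m z t \<partial>m)) in
              f_t y m t
              + 1/2 * a\<^sup>2 * ((\<integral>(z1,z2). f_mm y m z1 z2 t \<partial>(m \<Otimes>\<^sub>M m)) + (\<integral>z. f_mz y m z t \<partial>m))
              + a * (\<integral>z. f_ym y m z t \<partial>m)
              + 1/2 * f_yy y m t = 0))) \<and>
     (\<forall>y. \<forall>m\<in>P2. f y m T = \<Phi> m)"

definition solves_reduced_problem ::
    "real \<Rightarrow> (real \<Rightarrow> real \<Rightarrow> real) \<Rightarrow> (real \<Rightarrow> real) \<Rightarrow> (real \<Rightarrow> real \<Rightarrow> real \<Rightarrow> real) \<Rightarrow> bool" where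
  "solves_reduced_problem T c C f \<longleftrightarrow>
     continuous_on (UNIV \<times> UNIV \<times> {0..T}) (\<lambda>(y,m,t). f y m t) \<and>
     (\<exists>f_t f_y f_m f_yy f_ym f_mm.
        continuous_on (UNIV \<times> UNIV \<times> {0..<T}) (\<lambda>(y,m,t). f_t y m t) \<and>
        continuous_on (UNIV \<times> UNIV \<times> {0..<T}) (\<lambda>(y,m,t). f_y y m t) \<and>
        continuous_on (UNIV \<times> UNIV \<times> {0..<T}) (\<lambda>(y,m,t). f_m y m t) \<and>
        continuous_on (UNIV \<times> UNIV \<times> {0..<T}) (\<lambda>(y,m,t). f_yy y m t) \<and>
        continuous_on (UNIV \<times> UNIV \<times> {0..<T}) (\<lambda>(y,m,t). f_ym y m t) \<and>
        continuous_on (UNIV \<times> UNIV \<times> {0..<T}) (\<lambda>(y,m,t). f_mm y m t) \<and>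
        (\<forall>y m. \<forall>t\<in>{0..<T}.
           ((\<lambda>s. f y m s) has_real_derivative f_t y m t) (at t within {0..T}) \<and>
           ((\<lambda>x. f x m t) has_real_derivative f_y y m t) (at y) \<and>
           ((\<lambda>x. f y x t) has_real_derivative f_m y m t) (at m) \<and>
           ((\<lambda>x. f_y x m t) has_real_derivative f_yy y m t) (at y) \<and>
           ((\<lambda>x. f_y y x t) has_real_derivative f_ym y m t) (at m) \<and>
           ((\<lambda>x. f_m y x t) has_real_derivative f_mm y m t) (at m) \<and>
           1 - f_m y m t \<noteq> 0 \<and>
           f_t y m t
           + 1/2 * ((f_y y m t + c y t) / (1 - f_m y m t))\<^sup>2 * f_mm y m t
           + (f_y y m t + c y t) / (1 - f_m y m t) * f_ym y m t
           + 1/2 * f_yy y m t = 0)) \<and>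
     (\<forall>y m. f y m T = C m)"

text \<open>Infinite differentiability on \<open>\<real> \<times> \<real> \<times> [0,T)\<close>: continuous, with partial derivatives in
  all three variables that are again infinitely differentiable.\<close>

coinductive smooth_before :: "real \<Rightarrow> (real \<Rightarrow> real \<Rightarrow> real \<Rightarrow> real) \<Rightarrow> bool" for T where
  "\<lbrakk>continuous_on (UNIV \<times> UNIV \<times> {0..<T}) (\<lambda>(y,m,t). f y m t);
    \<forall>y m. \<forall>t\<in>{0..<T}.
      ((\<lambda>x. f x m t) has_real_derivative f_y y m t) (at y) \<and>
      ((\<lambda>x. f y x t) has_real_derivative f_m y m t) (at m) \<and>
      ((\<lambda>s. f y m s) has_real_derivative f_t y m t) (at t within {0..T});
    smooth_before T f_y; smooth_before T f_m; smooth_before T f_t\<rbrakk>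
   \<Longrightarrow> smooth_before T f"

text \<open>The growth condition under which uniqueness holds. At \<open>t = T\<close> it is the bound
  \<open>\<bar>(id - C)\<^sup>-\<^sup>1 z\<bar> \<le> K exp (L z\<^sup>2)\<close>; in general it bounds the inverse of \<open>m \<mapsto> m - f y m t\<close> at \<open>z\<close> by
  \<open>K exp (L (y\<^sup>2 + z\<^sup>2))\<close>. Some such condition is needed: for \<open>C = 0\<close> every solution
  \<open>u\<close> of the backward heat equation with zero terminal data, for instance Tychonoff's,
  gives a solution \<open>f y m t = u y t\<close> of the reduced problem.\<close>

definition gaussian_inverse_growth :: "real \<Rightarrow> (real \<Rightarrow> real \<Rightarrow> real \<Rightarrow> real) \<Rightarrow> bool" where
  "gaussian_inverse_growth T f \<longleftrightarrow>
     (\<exists>K L. \<forall>y m. \<forall>t\<in>{0..T}. \<bar>m\<bar> \<le> K * exp (L * (y\<^sup>2 + (m - f y m t)\<^sup>2)))"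

definition C2 :: "(real \<Rightarrow> real) \<Rightarrow> bool" where
  "C2 C \<longleftrightarrow> (\<exists>C' C''. (\<forall>z. (C has_real_derivative C' z) (at z)) \<and>
     (\<forall>z. (C' has_real_derivative C'' z) (at z)) \<and> continuous_on UNIV C'')"

section \<open>The data of the problem\<close>

definition F_of :: "real measure \<Rightarrow> real \<Rightarrow> real \<Rightarrow> real" where
  "F_of \<nu> y t = (\<integral>\<theta>. exp (y * \<theta> - 1/2 * \<theta>\<^sup>2 * t) \<partial>\<nu>)"

definition b_of :: "real measure \<Rightarrow> real \<Rightarrow> real \<Rightarrow> real" where
  "b_of \<nu> y t = deriv (\<lambda>x. F_of \<nu> x t) y / F_of \<nu> y t"

definition c_of :: "real measure \<Rightarrow> (real \<Rightarrow> real \<Rightarrow> real) \<Rightarrow> real \<Rightarrow> real \<Rightarrow> real" where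
  "c_of \<nu> k y t = b_of \<nu> y t + deriv (\<lambda>x. k x t) y"

text \<open>\<open>LBINT \<rho>=0..y\<close> is the oriented integral, i.e. minus the integral over \<open>[y,0]\<close> when \<open>y < 0\<close>.\<close>

definition q_of :: "real measure \<Rightarrow> (real \<Rightarrow> real \<Rightarrow> real) \<Rightarrow> real \<Rightarrow> real \<Rightarrow> real" where
  "q_of \<nu> k y t =
     - 1/2 * (LBINT s=0..ereal t. deriv (\<lambda>x. c_of \<nu> k x s) 0) + (LBINT \<rho>=0..ereal y. c_of \<nu> k \<rho> t)"

definition heat_kernel_solution :: "real \<Rightarrow> (real \<Rightarrow> real) \<Rightarrow> real \<Rightarrow> real \<Rightarrow> real" where
  "heat_kernel_solution T \<phi> y t =
     (if t < T then \<integral>\<rho>. normal_density y (sqrt (T - t)) \<rho> * \<phi> \<rho> \<partial>lborel else \<phi> y)"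

definition g_terminal ::
    "real \<Rightarrow> real measure \<Rightarrow> (real \<Rightarrow> real \<Rightarrow> real) \<Rightarrow> (real \<Rightarrow> real) \<Rightarrow> real \<Rightarrow> real \<Rightarrow> real" where
  "g_terminal T \<nu> k C y m = inv (\<lambda>\<zeta>. \<zeta> - C \<zeta> - q_of \<nu> k y T) m"

definition g_of ::
    "real \<Rightarrow> real measure \<Rightarrow> (real \<Rightarrow> real \<Rightarrow> real) \<Rightarrow> (real \<Rightarrow> real) \<Rightarrow> real \<Rightarrow> real \<Rightarrow> real \<Rightarrow> real" where
  "g_of T \<nu> k C y m t = heat_kernel_solution T (\<lambda>\<rho>. g_terminal T \<nu> k C \<rho> m) y t"

definition f_of ::
    "real \<Rightarrow> real measure \<Rightarrow> (real \<Rightarrow> real \<Rightarrow> real) \<Rightarrow> (real \<Rightarrow> real) \<Rightarrow> real \<Rightarrow> real \<Rightarrow> real \<Rightarrow> real" where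
  "f_of T \<nu> k C y m t = m - inv (\<lambda>x. g_of T \<nu> k C y x t) m - q_of \<nu> k y t"

end

theory Submission
  imports Defs
begin

text \<open>
Interchanging the dependent variable and the variable \<open>m\<close> makes the nonlinear equation linear. Let \<open>f\<close> be a
solution with \<open>1 - f\<^sub>m > 0\<close>, and let \<open>h y x t = x - f y x t - q y t\<close>. Since \<open>q\<close> solves the backward heat equation and
\<open>q\<^sub>y = c\<close>, the equation for \<open>f\<close> says exactly that the inverse \<open>\<gamma> y z t\<close> of \<open>h y x t\<close> in \<open>x\<close> solves
\<open>\<gamma>\<^sub>t + 1/2 * \<gamma>\<^sub>y\<^sub>y = 0\<close> for every fixed \<open>z\<close>. Its terminal value is \<open>H (z + Q y)\<close>, where \<open>H\<close> is the inverse of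
\<open>m - C m\<close> and \<open>Q y = q y T\<close>. The pointwise computations are in \<open>inverse_family_second_derivatives\<close>,
\<open>inverse_equation\<close> and \<open>reduced_equation_linearised\<close>.

That \<open>q\<close> solves the heat equation is the Hopf-Cole transformation: \<open>k + ln F\<close> solves it because \<open>b\<close> is the
\<open>y\<close>-derivative of \<open>ln F\<close> (\<open>bounded_solution_eq\<close>), and \<open>q\<close> differs from \<open>k + ln F\<close> by a constant (\<open>q_of_eq\<close>).

Existence. The heat kernel solution \<open>g\<close> with terminal value \<open>H (m + Q y)\<close> increases in \<open>m\<close> at least linearly, like \<open>H\<close>;
so it has an inverse \<open>G\<close> in \<open>m\<close>, and \<open>f = m - G - q\<close> is a solution (\<open>f_solves\<close>). It is smooth before \<open>T\<close> although \<open>H\<close>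
is only as regular as \<open>C\<close>: the \<open>m\<close>-derivative of \<open>H (m + Q \<rho>)\<close> is its \<open>\<rho>\<close>-derivative divided by \<open>Q' \<rho> = b_of \<nu> \<rho> T\<close>,
which is bounded away from zero, and under the heat kernel integration by parts moves the \<open>\<rho>\<close>-derivative to the Gaussian
(\<open>level_moment_deriv_m\<close>, \<open>smooth_alg_derivs\<close>, \<open>smooth_before_level_inverse\<close>).

Uniqueness. For any other solution the functions \<open>h\<close> are increasing in \<open>x\<close>, because \<open>1 - f\<^sub>m\<close> has no zero and the terminal
values fix its sign. The growth condition makes them surjective and bounds the inverse by a Gaussian in \<open>y\<close>, so that
Tychonoff's theorem \<open>backward_heat_unique\<close> identifies it with \<open>g\<close> (\<open>reduced_solution_unique\<close>).

The problem on measures. The lift of a function of the mean is that function of an integral, so its Lions derivatives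
are constant in \<open>z\<close>, and a solution of the reduced problem solves the problem on measures. Conversely, the
equation at Dirac measures is the reduced equation. There the Lions derivative is determined a priori at the atom alone; it is
determined elsewhere by continuity along measures that give a small mass to the point in question
(\<open>lions_derivative_of_mean_at_dirac\<close>).
\<close>

abbreviation jointly_continuous :: "real set \<Rightarrow> (real \<Rightarrow> real \<Rightarrow> real \<Rightarrow> real) \<Rightarrow> bool" where
  "jointly_continuous S f \<equiv> continuous_on (UNIV \<times> UNIV \<times> S) (\<lambda>(y,m,t). f y m t)"

section \<open>Integrals depending on a parameter\<close>

lemma tendsto_integral_dominated:
  fixes f :: "'p::metric_space \<Rightarrow> 'a \<Rightarrow> real"
  assumes meas: "\<And>p. p \<in> S \<Longrightarrow> f p \<in> borel_measurable M" "f0 \<in> borel_measurable M"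
    and lim: "AE \<rho> in M. ((\<lambda>p. f p \<rho>) \<longlongrightarrow> f0 \<rho>) (at p0 within S)"
    and bound: "AE \<rho> in M. \<forall>p\<in>S. \<bar>f p \<rho>\<bar> \<le> w \<rho>"
    and w: "integrable M w"
  shows "((\<lambda>p. \<integral>\<rho>. f p \<rho> \<partial>M) \<longlongrightarrow> (\<integral>\<rho>. f0 \<rho> \<partial>M)) (at p0 within S)"
  unfolding tendsto_at_iff_sequentially comp_def
proof (intro allI impI)
  fix X :: "nat \<Rightarrow> 'p"
  assume X: "\<forall>i. X i \<in> S - {p0}" "X \<longlonglongrightarrow> p0"
  show "(\<lambda>i. \<integral>\<rho>. f (X i) \<rho> \<partial>M) \<longlonglongrightarrow> (\<integral>\<rho>. f0 \<rho> \<partial>M)"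
  proof (rule integral_dominated_convergence[OF _ _ w])
    show "AE x in M. (\<lambda>i. f (X i) x) \<longlonglongrightarrow> f0 x"
      using lim by eventually_elim (use X in \<open>simp add: tendsto_at_iff_sequentially comp_def\<close>)
    show "AE x in M. norm (f (X i) x) \<le> w x" for i
      using bound by eventually_elim (use X in auto)
  qed (use meas X in auto)
qed

text \<open>By the mean value theorem the bound on the derivatives also bounds the difference quotients, so
  dominated convergence applies to them.\<close>

lemma has_real_derivative_integral_dominated:
  fixes f f' :: "real \<Rightarrow> 'a \<Rightarrow> real"
  assumes S: "convex S" "x0 \<in> S"
    and int: "\<And>x. x \<in> S \<Longrightarrow> integrable M (f x)" and meas: "f' x0 \<in> borel_measurable M"
    and der: "AE \<rho> in M. \<forall>x\<in>S. ((\<lambda>x. f x \<rho>) has_real_derivative f' x \<rho>) (at x within S)"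
    and bound: "AE \<rho> in M. \<forall>x\<in>S. \<bar>f' x \<rho>\<bar> \<le> w \<rho>"
    and w: "integrable M w"
  shows "((\<lambda>x. \<integral>\<rho>. f x \<rho> \<partial>M) has_real_derivative (\<integral>\<rho>. f' x0 \<rho> \<partial>M)) (at x0 within S)"
proof -
  let ?D = "\<lambda>x \<rho>. if x = x0 then f' x0 \<rho> else (f x \<rho> - f x0 \<rho>) / (x - x0)"
  have "((\<lambda>x. \<integral>\<rho>. ?D x \<rho> \<partial>M) \<longlongrightarrow> (\<integral>\<rho>. f' x0 \<rho> \<partial>M)) (at x0 within S)"
  proof (rule tendsto_integral_dominated[OF _ meas _ _ w])
    show "?D x \<in> borel_measurable M" if "x \<in> S" for x
      using int[OF that] int[OF S(2)] meas by (cases "x = x0") (auto dest!: borel_measurable_integrable)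
    show "AE \<rho> in M. ((\<lambda>x. ?D x \<rho>) \<longlongrightarrow> f' x0 \<rho>) (at x0 within S)"
      using der
    proof eventually_elim
      case (elim \<rho>)
      then have "((\<lambda>x. (f x \<rho> - f x0 \<rho>) / (x - x0)) \<longlongrightarrow> f' x0 \<rho>) (at x0 within S)"
        using S(2) by (auto simp: has_field_derivative_iff)
      then show ?case
        by (rule Lim_transform_eventually) (auto simp: eventually_at_filter)
    qed
    show "AE \<rho> in M. \<forall>x\<in>S. \<bar>?D x \<rho>\<bar> \<le> w \<rho>"
      using der bound
    proof eventually_elim
      case (elim \<rho>)
      show ?case
      proof
        fix x assume x: "x \<in> S"
        have "norm (f x \<rho> - f x0 \<rho>) \<le> w \<rho> * norm (x - x0)"
          by (rule field_differentiable_bound[OF S(1), where f' = "\<lambda>x. f' x \<rho>"])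
            (use elim x S in auto)
        then show "\<bar>?D x \<rho>\<bar> \<le> w \<rho>"
          using elim S(2) by (auto simp: abs_divide divide_le_eq)
      qed
    qed
  qed
  moreover have "\<forall>\<^sub>F x in at x0 within S. (\<integral>\<rho>. ?D x \<rho> \<partial>M)
      = ((\<integral>\<rho>. f x \<rho> \<partial>M) - (\<integral>\<rho>. f x0 \<rho> \<partial>M)) / (x - x0)"
    using int S(2) by (auto simp: eventually_at_filter intro!: always_eventually)
  ultimately show ?thesis
    unfolding has_field_derivative_iff by (rule Lim_transform_eventually)
qed

section \<open>Families of increasing bijections and their inverses\<close>

text \<open>Chain rule along a curve, with the mean value theorem in the second variable: only the second
  partial derivative has to be continuous.\<close>

lemma has_real_derivative_along:
  fixes \<Phi> \<Phi>x :: "real \<Rightarrow> real \<Rightarrow> real"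
  assumes p0: "p0 \<in> S"
    and dp: "((\<lambda>p. \<Phi> p (\<gamma> p0)) has_real_derivative D) (at p0 within S)"
    and dx: "\<And>p x. p \<in> S \<Longrightarrow> (\<Phi> p has_real_derivative \<Phi>x p x) (at x)"
    and cx: "continuous_on (S \<times> UNIV) (\<lambda>(p,x). \<Phi>x p x)"
    and d\<gamma>: "(\<gamma> has_real_derivative \<gamma>') (at p0 within S)"
  shows "((\<lambda>p. \<Phi> p (\<gamma> p)) has_real_derivative D + \<Phi>x p0 (\<gamma> p0) * \<gamma>') (at p0 within S)"
proof -
  have "((\<lambda>(p,x). \<Phi> p x) has_derivative (\<lambda>(tp,tx). tp * D + blinfun_apply (blinfun_scaleR_left (\<Phi>x p0 (\<gamma> p0))) tx))
      (at (p0, \<gamma> p0) within S \<times> UNIV)"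
  proof (rule has_derivative_partialsI[where fy = "\<lambda>p x. blinfun_scaleR_left (\<Phi>x p x)"])
    show "((\<lambda>p. \<Phi> p (\<gamma> p0)) has_derivative (\<lambda>tp. tp * D)) (at p0 within S)"
      using dp by (simp add: has_field_derivative_def mult_commute_abs)
    show "(\<Phi> p has_derivative blinfun_apply (blinfun_scaleR_left (\<Phi>x p x))) (at x within UNIV)"
      if "p \<in> S" for p x
      using dx[OF that, of x] by (simp add: has_field_derivative_def mult_commute_abs)
    have "continuous (at (p0, \<gamma> p0) within S \<times> UNIV) (\<lambda>(p,x). \<Phi>x p x)"
      using cx p0 by (auto simp: continuous_on_eq_continuous_within)
    then show "continuous (at (p0, \<gamma> p0) within S \<times> UNIV) (\<lambda>(p,x). blinfun_scaleR_left (\<Phi>x p x))"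
      unfolding split_def by (intro continuous_intros)
  qed auto
  then have *: "((\<lambda>(p,x). \<Phi> p x) has_derivative (\<lambda>(tp,tx). tp * D + tx * \<Phi>x p0 (\<gamma> p0)))
      (at (p0, \<gamma> p0) within (\<lambda>p. (p, \<gamma> p)) ` S)"
    by (rule has_derivative_subset[THEN has_derivative_eq_rhs]) (auto simp: fun_eq_iff)
  have "((\<lambda>p. (p, \<gamma> p)) has_derivative (\<lambda>h. (h, h * \<gamma>'))) (at p0 within S)"
    using d\<gamma> by (auto intro!: derivative_eq_intros simp: has_field_derivative_def mult_commute_abs)
  from has_derivative_in_compose[OF this *] show ?thesis
    by (auto simp: has_field_derivative_def algebra_simps mult_commute_abs elim!: has_derivative_eq_rhs)
qed

text \<open>An implicit function theorem: subtracting \<open>h p0 (\<gamma> p0) = z = h p (\<gamma> p)\<close> and using the mean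
  value theorem in the second variable turns difference quotients of \<open>\<gamma>\<close> into those of \<open>h\<close>.\<close>

lemma has_real_derivative_implicit:
  fixes h hx :: "real \<Rightarrow> real \<Rightarrow> real"
  assumes p0: "p0 \<in> S"
    and dp: "((\<lambda>p. h p (\<gamma> p0)) has_real_derivative D) (at p0 within S)"
    and dx: "\<And>p x. p \<in> S \<Longrightarrow> (h p has_real_derivative hx p x) (at x)"
    and cx: "continuous_on (S \<times> UNIV) (\<lambda>(p,x). hx p x)"
    and pos: "\<And>p x. p \<in> S \<Longrightarrow> hx p x > 0"
    and level: "\<And>p. p \<in> S \<Longrightarrow> h p (\<gamma> p) = z"
    and c\<gamma>: "continuous_on S \<gamma>"
  shows "(\<gamma> has_real_derivative - D / hx p0 (\<gamma> p0)) (at p0 within S)"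
proof -
  have "\<exists>\<xi>. \<bar>\<xi> - \<gamma> p0\<bar> \<le> \<bar>\<gamma> p - \<gamma> p0\<bar> \<and> h p (\<gamma> p) - h p (\<gamma> p0) = hx p \<xi> * (\<gamma> p - \<gamma> p0)" if "p \<in> S" for p
  proof (cases "\<gamma> p" "\<gamma> p0" rule: linorder_cases)
    case less
    from MVT2[OF less, of "h p" "hx p"] dx[OF that] obtain \<xi> where
      "\<gamma> p < \<xi>" "\<xi> < \<gamma> p0" "h p (\<gamma> p0) - h p (\<gamma> p) = (\<gamma> p0 - \<gamma> p) * hx p \<xi>" by blast
    then show ?thesis by (intro exI[of _ \<xi>]) (auto simp: algebra_simps)
  next
    case greater
    from MVT2[OF greater, of "h p" "hx p"] dx[OF that] obtain \<xi> where
      "\<gamma> p0 < \<xi>" "\<xi> < \<gamma> p" "h p (\<gamma> p) - h p (\<gamma> p0) = (\<gamma> p - \<gamma> p0) * hx p \<xi>" by blast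
    then show ?thesis by (intro exI[of _ \<xi>]) (auto simp: algebra_simps)
  qed auto
  then obtain \<xi> where \<xi>: "\<And>p. p \<in> S \<Longrightarrow> \<bar>\<xi> p - \<gamma> p0\<bar> \<le> \<bar>\<gamma> p - \<gamma> p0\<bar>"
      "\<And>p. p \<in> S \<Longrightarrow> h p (\<gamma> p) - h p (\<gamma> p0) = hx p (\<xi> p) * (\<gamma> p - \<gamma> p0)"
    by metis
  have S: "\<forall>\<^sub>F p in at p0 within S. p \<in> S" "\<forall>\<^sub>F p in at p0 within S. p \<noteq> p0"
    by (auto simp: eventually_at_filter)
  have \<gamma>: "(\<gamma> \<longlongrightarrow> \<gamma> p0) (at p0 within S)"
    using c\<gamma> p0 by (simp add: continuous_on_def)
  have "((\<lambda>p. \<xi> p - \<gamma> p0) \<longlongrightarrow> 0) (at p0 within S)"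
  proof (rule Lim_null_comparison)
    show "\<forall>\<^sub>F p in at p0 within S. norm (\<xi> p - \<gamma> p0) \<le> \<bar>\<gamma> p - \<gamma> p0\<bar>"
      using S(1) by eventually_elim (use \<xi> in auto)
    show "((\<lambda>p. \<bar>\<gamma> p - \<gamma> p0\<bar>) \<longlongrightarrow> 0) (at p0 within S)"
      using tendsto_rabs[OF tendsto_diff[OF \<gamma> tendsto_const[of "\<gamma> p0"]]] by simp
  qed
  then have \<xi>l: "(\<xi> \<longlongrightarrow> \<gamma> p0) (at p0 within S)"
    using LIM_zero_iff by blast
  have "((\<lambda>p. (\<lambda>(p,x). hx p x) (p, \<xi> p)) \<longlongrightarrow> (\<lambda>(p,x). hx p x) (p0, \<gamma> p0)) (at p0 within S)"
    by (rule continuous_on_tendsto_compose[OF cx]) (use \<xi>l S p0 in \<open>auto intro!: tendsto_intros\<close>)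
  then have hl: "((\<lambda>p. hx p (\<xi> p)) \<longlongrightarrow> hx p0 (\<gamma> p0)) (at p0 within S)" by simp
  have "((\<lambda>p. - ((h p (\<gamma> p0) - h p0 (\<gamma> p0)) / (p - p0)) / hx p (\<xi> p)) \<longlongrightarrow> - D / hx p0 (\<gamma> p0)) (at p0 within S)"
    using dp pos[OF p0, of "\<gamma> p0"] unfolding has_field_derivative_iff by (intro tendsto_intros hl) auto
  moreover have "\<forall>\<^sub>F p in at p0 within S. - ((h p (\<gamma> p0) - h p0 (\<gamma> p0)) / (p - p0)) / hx p (\<xi> p)
      = (\<gamma> p - \<gamma> p0) / (p - p0)"
    using S
  proof eventually_elim
    case (elim p)
    have "h p (\<gamma> p0) - h p0 (\<gamma> p0) = - (hx p (\<xi> p) * (\<gamma> p - \<gamma> p0))"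
      using \<xi>(2)[OF elim(1)] level[OF elim(1)] level[OF p0] by simp
    then show ?case using pos[OF elim(1), of "\<xi> p"] by simp
  qed
  ultimately show ?thesis
    unfolding has_field_derivative_iff by (rule Lim_transform_eventually)
qed

text \<open>If \<open>x\<^sub>1 < \<gamma> p\<^sub>0 z\<^sub>0 < x\<^sub>2\<close>, then \<open>h p x\<^sub>1 < z < h p x\<^sub>2\<close> for \<open>(p, z)\<close> near \<open>(p\<^sub>0, z\<^sub>0)\<close>, and monotonicity
  traps \<open>\<gamma> p z\<close> between \<open>x\<^sub>1\<close> and \<open>x\<^sub>2\<close>.\<close>

lemma continuous_on_inverse_family:
  fixes h :: "'p::metric_space \<Rightarrow> real \<Rightarrow> real"
  assumes ch: "continuous_on (S \<times> UNIV) (\<lambda>(p,x). h p x)"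
    and mono: "\<And>p. p \<in> S \<Longrightarrow> strict_mono (h p)"
    and inv: "\<And>p z. p \<in> S \<Longrightarrow> h p (\<gamma> p z) = z"
  shows "continuous_on (S \<times> UNIV) (\<lambda>(p,z). \<gamma> p z)"
  unfolding continuous_on_def
proof clarsimp
  fix p0 and z0 :: real assume p0: "p0 \<in> S"
  let ?F = "at (p0, z0) within S \<times> UNIV"
  have S: "\<forall>\<^sub>F w in ?F. fst w \<in> S"
    unfolding eventually_at_filter by (rule always_eventually) auto
  have lim: "((\<lambda>w. h (fst w) x) \<longlongrightarrow> h p0 x) ?F" for x
  proof -
    have "((\<lambda>w. (\<lambda>(p,x). h p x) (fst w, x)) \<longlongrightarrow> (\<lambda>(p,x). h p x) (p0, x)) ?F"
      by (rule continuous_on_tendsto_compose[OF ch]) (use S p0 in \<open>auto intro!: tendsto_eq_intros\<close>)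
    then show ?thesis by simp
  qed
  have lz: "(snd \<longlongrightarrow> z0) ?F"
    by (auto intro!: tendsto_eq_intros)
  show "((\<lambda>(p,z). \<gamma> p z) \<longlongrightarrow> \<gamma> p0 z0) ?F"
  proof (rule order_tendstoI)
    fix x assume "x < \<gamma> p0 z0"
    then have "h p0 x < z0"
      using mono[OF p0] inv[OF p0] by (metis strict_mono_less)
    then have "\<forall>\<^sub>F w in ?F. h (fst w) x < snd w"
      by (rule order_tendstoD[OF tendsto_diff[OF lz lim], of 0, simplified])
    with S show "\<forall>\<^sub>F w in ?F. x < (\<lambda>(p,z). \<gamma> p z) w"
      by eventually_elim (use mono inv in \<open>metis case_prod_beta strict_mono_less\<close>)
  next
    fix x assume "\<gamma> p0 z0 < x"
    then have "z0 < h p0 x"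
      using mono[OF p0] inv[OF p0] by (metis strict_mono_less)
    then have "\<forall>\<^sub>F w in ?F. snd w < h (fst w) x"
      by (rule order_tendstoD[OF tendsto_diff[OF lim lz], of 0, simplified])
    with S show "\<forall>\<^sub>F w in ?F. (\<lambda>(p,z). \<gamma> p z) w < x"
      by eventually_elim (use mono inv in \<open>metis case_prod_beta strict_mono_less\<close>)
  qed
qed

section \<open>Uniqueness for the backward heat equation\<close>

lemma second_derivative_at_interior_max:
  fixes z z' :: "real \<Rightarrow> real"
  assumes d: "\<And>x. (z has_real_derivative z' x) (at x)" and d2: "(z' has_real_derivative D) (at y)"
    and R: "\<bar>y\<bar> < R" and max: "\<And>x. \<bar>x\<bar> \<le> R \<Longrightarrow> z x \<le> z y"
  shows "D \<le> 0"
proof (rule ccontr)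
  assume "\<not> D \<le> 0"
  with has_real_derivative_pos_inc_right[OF d2] obtain d where
    d': "d > 0" "\<And>h. 0 < h \<Longrightarrow> h < d \<Longrightarrow> z' y < z' (y + h)" by auto
  have "z' y = 0"
    by (rule DERIV_local_max[OF d, of "R - \<bar>y\<bar>"]) (use R max in auto)
  define h where "h = min (d / 2) (R - \<bar>y\<bar>)"
  have h: "0 < h" "h < d" "\<bar>y + h\<bar> \<le> R"
    using d' R by (auto simp: h_def min_def)
  from MVT2[of y "y + h" z z'] d h obtain x where
    x: "y < x" "x < y + h" "z (y + h) - z y = h * z' x" by auto
  have "z' x > 0" using d'(2)[of "x - y"] x h \<open>z' y = 0\<close> by auto
  then have "z (y + h) > z y" using x(3) h by (metis diff_gt_0_iff_gt mult_pos_pos)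
  with max[OF h(3)] show False by simp
qed

text \<open>A maximum principle on a short time interval. The function \<open>v\<close> below is a strict supersolution
  that grows faster than \<open>w\<close>, so \<open>w - \<mu> v\<close> cannot have a positive maximum, however small \<open>\<mu> > 0\<close>;
  the time interval has to be short because \<open>v\<close> stops being a supersolution after a time of order \<open>1/L\<close>.\<close>

lemma backward_heat_nonpos_short_time:
  fixes w w_t w_y w_yy :: "real \<Rightarrow> real \<Rightarrow> real"
  assumes L: "0 < L" and short: "t1 - t0 \<le> 1 / (16 * L)"
    and cont: "continuous_on (UNIV \<times> {t0..t1}) (\<lambda>(y,t). w y t)"
    and dt: "\<And>y t. t0 \<le> t \<Longrightarrow> t < t1 \<Longrightarrow> (w y has_real_derivative w_t y t) (at t within {t0..t1})"
    and dy: "\<And>y t. t0 \<le> t \<Longrightarrow> t < t1 \<Longrightarrow> ((\<lambda>x. w x t) has_real_derivative w_y y t) (at y)"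
    and dyy: "\<And>y t. t0 \<le> t \<Longrightarrow> t < t1 \<Longrightarrow> ((\<lambda>x. w_y x t) has_real_derivative w_yy y t) (at y)"
    and heat: "\<And>y t. t0 \<le> t \<Longrightarrow> t < t1 \<Longrightarrow> w_t y t + 1/2 * w_yy y t = 0"
    and growth: "\<And>y t. t0 \<le> t \<Longrightarrow> t \<le> t1 \<Longrightarrow> w y t \<le> K * exp (L * y\<^sup>2)"
    and terminal: "\<And>y. w y t1 \<le> 0"
    and t: "t0 \<le> t" "t \<le> t1"
  shows "w y t \<le> 0"
proof (rule ccontr)
  assume "\<not> w y t \<le> 0"
  then have wpos: "w y t > 0" by simp
  define a where "a = 2 * L"
  have a: "a > 0" using L by (simp add: a_def)
  (* At s = t1 the exponent is a * x^2 with a = 2 * L, twice the growth rate allowed for w. *)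
  define p where "p x s = a * x\<^sup>2 * (1 + 8 * a * (t1 - s)) + 3 * a * (t1 - s)" for x s :: real
  define v where "v x s = exp (p x s)" for x s
  have vpos: "v x s > 0" for x s by (simp add: v_def)
  define \<mu> where "\<mu> = w y t / (2 * v y t)"
  have \<mu>: "\<mu> > 0" using wpos vpos by (simp add: \<mu>_def)
  define z where "z x s = w x s - \<mu> * v x s" for x s
  have zpos: "z y t > 0" using wpos vpos[of y t] by (simp add: z_def \<mu>_def)
  have vbig: "v x s \<ge> exp (2 * L * x\<^sup>2)" if "t0 \<le> s" "s \<le> t1" for x s
  proof -
    have "2 * L * x\<^sup>2 * 1 + 0 \<le> p x s"
      unfolding p_def a_def using that L by (intro add_mono mult_left_mono) auto
    then show ?thesis by (simp add: v_def)
  qed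
  (* So large that L * R^2 >= |K| / mu, whence K * exp (L * R^2) <= mu * exp (2 * L * R^2). *)
  define R where "R = \<bar>y\<bar> + 1 + \<bar>K\<bar> / (L * \<mu>)"
  have "\<bar>K\<bar> / (L * \<mu>) \<ge> 0" using L \<mu> by simp
  then have R: "R > \<bar>y\<bar>" "R \<ge> 1" "R \<ge> \<bar>K\<bar> / (L * \<mu>)"
    unfolding R_def by linarith+
  have side: "z x s \<le> 0" if "\<bar>x\<bar> = R" "t0 \<le> s" "s \<le> t1" for x s
  proof -
    have xR: "x\<^sup>2 = R\<^sup>2" using that by (metis power2_abs)
    have "R \<le> R\<^sup>2" using R by (simp add: power2_eq_square)
    then have "\<bar>K\<bar> / (L * \<mu>) \<le> R\<^sup>2" using R by simp
    then have "\<bar>K\<bar> \<le> \<mu> * (L * R\<^sup>2)" using L \<mu> by (simp add: field_simps)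
    also have "\<dots> \<le> \<mu> * exp (L * R\<^sup>2)"
      using exp_ge_add_one_self[of "L * R\<^sup>2"] \<mu> by (intro mult_left_mono) linarith+
    finally have K: "K \<le> \<mu> * exp (L * R\<^sup>2)" by simp
    have "w x s \<le> K * exp (L * R\<^sup>2)" using growth[OF that(2,3), of x] xR by simp
    also have "\<dots> \<le> \<mu> * exp (L * R\<^sup>2) * exp (L * R\<^sup>2)"
      by (rule mult_right_mono[OF K]) simp
    also have "\<dots> = \<mu> * exp (2 * L * x\<^sup>2)"
      using xR by (simp add: exp_add[symmetric])
    also have "\<dots> \<le> \<mu> * v x s"
      using vbig[OF that(2,3), of x] \<mu> by simp
    finally show ?thesis by (simp add: z_def)
  qed
  have "compact ({-R..R} \<times> {t0..t1})" by (intro compact_Times) auto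
  moreover have "{-R..R} \<times> {t0..t1} \<noteq> {}" using t R by auto
  moreover have "continuous_on ({-R..R} \<times> {t0..t1}) (\<lambda>(x,s). z x s)"
    unfolding z_def v_def p_def split_def
    by (intro continuous_intros continuous_on_subset[OF cont, unfolded split_def]) auto
  ultimately obtain ym tm where m: "ym \<in> {-R..R}" "tm \<in> {t0..t1}"
      and max: "\<And>x s. x \<in> {-R..R} \<Longrightarrow> s \<in> {t0..t1} \<Longrightarrow> z x s \<le> z ym tm"
    using continuous_attains_sup[of "{-R..R} \<times> {t0..t1}" "\<lambda>(x,s). z x s"] by fastforce
  have zm: "z ym tm > 0" using max[of y t] zpos t R by force
  have "tm \<noteq> t1"
    using zm terminal[of ym] mult_pos_pos[OF \<mu> vpos[of ym t1]] by (auto simp: z_def)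
  then have tm: "t0 \<le> tm" "tm < t1" using m by auto
  have "\<bar>ym\<bar> \<noteq> R" using side[of ym tm] zm tm by auto
  then have ym: "\<bar>ym\<bar> < R" using m by auto
  define \<beta> where "\<beta> = 1 + 8 * a * (t1 - tm)"
  have \<beta>: "1 \<le> \<beta>" "\<beta> \<le> 2"
  proof -
    show "1 \<le> \<beta>" unfolding \<beta>_def using a tm by simp
    have "8 * a * (t1 - tm) \<le> 8 * a * (1 / (16 * L))"
      using short tm a by (intro mult_left_mono) auto
    also have "\<dots> = 1" using L by (simp add: a_def)
    finally show "\<beta> \<le> 2" by (simp add: \<beta>_def)
  qed
  define V where "V = v ym tm"
  define v_t where "v_t = (- 8 * a\<^sup>2 * ym\<^sup>2 - 3 * a) * V"
  have dvt: "(v ym has_real_derivative v_t) (at tm within {t0..t1})"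
    unfolding v_def p_def v_t_def V_def
    by (auto intro!: derivative_eq_intros simp: algebra_simps power2_eq_square)
  have dvy: "((\<lambda>x. v x tm) has_real_derivative 2 * a * \<beta> * x * v x tm) (at x)" for x
    unfolding v_def p_def \<beta>_def
    by (auto intro!: derivative_eq_intros simp: algebra_simps power2_eq_square)
  define v_yy where "v_yy = (4 * a\<^sup>2 * \<beta>\<^sup>2 * ym\<^sup>2 + 2 * a * \<beta>) * V"
  have dvyy: "((\<lambda>x. 2 * a * \<beta> * x * v x tm) has_real_derivative v_yy) (at ym)"
    unfolding v_yy_def V_def
    by (auto intro!: derivative_eq_intros dvy simp: algebra_simps power2_eq_square)
  have zt: "(z ym has_real_derivative w_t ym tm - \<mu> * v_t) (at tm within {t0..t1})"
    unfolding z_def by (intro derivative_intros dt dvt DERIV_cmult tm)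
  have "w_t ym tm - \<mu> * v_t \<le> 0"
  proof (rule ccontr)
    assume "\<not> ?thesis"
    with has_real_derivative_pos_inc_right[OF zt] obtain d where
      d: "d > 0" "\<And>h. 0 < h \<Longrightarrow> tm + h \<in> {t0..t1} \<Longrightarrow> h < d \<Longrightarrow> z ym tm < z ym (tm + h)" by auto
    define h where "h = min (d / 2) (t1 - tm)"
    have "0 < h" "h < d" "tm + h \<in> {t0..t1}" using d tm by (auto simp: h_def min_def)
    with d(2)[of h] max[of ym "tm + h"] m show False by auto
  qed
  moreover have "w_yy ym tm - \<mu> * v_yy \<le> 0"
  proof (rule second_derivative_at_interior_max[OF _ _ ym])
    show "((\<lambda>x. z x tm) has_real_derivative w_y x tm - \<mu> * (2 * a * \<beta> * x * v x tm)) (at x)" for x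
      unfolding z_def by (intro derivative_intros dy dvy DERIV_cmult tm)
    show "((\<lambda>x. w_y x tm - \<mu> * (2 * a * \<beta> * x * v x tm)) has_real_derivative w_yy ym tm - \<mu> * v_yy) (at ym)"
      by (intro derivative_intros dyy dvyy DERIV_cmult tm)
    show "z x tm \<le> z ym tm" if "\<bar>x\<bar> \<le> R" for x using max[of x tm] that m by force
  qed
  ultimately have "\<mu> * (v_t + 1/2 * v_yy) \<ge> 0"
    using heat[OF tm, of ym] by (simp add: algebra_simps)
  then have nonneg: "v_t + 1/2 * v_yy \<ge> 0" using \<mu> by (simp add: zero_le_mult_iff)
  have "v_t + 1/2 * v_yy = (a\<^sup>2 * ym\<^sup>2 * (2 * \<beta>\<^sup>2 - 8) + a * (\<beta> - 3)) * V"
    by (simp add: v_t_def v_yy_def algebra_simps)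
  also have "\<dots> < 0"
  proof (rule mult_neg_pos)
    have "\<beta>\<^sup>2 \<le> 2\<^sup>2" using \<beta> by (intro power_mono) auto
    then have "a\<^sup>2 * ym\<^sup>2 * (2 * \<beta>\<^sup>2 - 8) \<le> 0" by (intro mult_nonneg_nonpos) auto
    moreover have "a * (\<beta> - 3) < 0" using a \<beta> by (intro mult_pos_neg) auto
    ultimately show "a\<^sup>2 * ym\<^sup>2 * (2 * \<beta>\<^sup>2 - 8) + a * (\<beta> - 3) < 0" by simp
    show "V > 0" using vpos by (simp add: V_def)
  qed
  finally show False using nonneg by simp
qed

text \<open>Tychonoff's uniqueness theorem: the maximum principle for \<open>\<plusminus> w\<close>, iterated backwards over time
  intervals of equal length.\<close>

theorem backward_heat_unique:
  fixes w w_t w_y w_yy :: "real \<Rightarrow> real \<Rightarrow> real"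
  assumes cont: "continuous_on (UNIV \<times> {0..T}) (\<lambda>(y,t). w y t)"
    and dt: "\<And>y t. 0 \<le> t \<Longrightarrow> t < T \<Longrightarrow> (w y has_real_derivative w_t y t) (at t within {0..T})"
    and dy: "\<And>y t. 0 \<le> t \<Longrightarrow> t < T \<Longrightarrow> ((\<lambda>x. w x t) has_real_derivative w_y y t) (at y)"
    and dyy: "\<And>y t. 0 \<le> t \<Longrightarrow> t < T \<Longrightarrow> ((\<lambda>x. w_y x t) has_real_derivative w_yy y t) (at y)"
    and heat: "\<And>y t. 0 \<le> t \<Longrightarrow> t < T \<Longrightarrow> w_t y t + 1/2 * w_yy y t = 0"
    and terminal: "\<And>y. w y T = 0"
    and growth: "\<And>y t. 0 \<le> t \<Longrightarrow> t \<le> T \<Longrightarrow> \<bar>w y t\<bar> \<le> K * exp (L * y\<^sup>2)" and L: "0 < L"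
    and t: "0 \<le> t" "t \<le> T"
  shows "w y t = 0"
proof -
  define \<delta> where "\<delta> = 1 / (16 * L)"
  have \<delta>: "\<delta> > 0" using L by (simp add: \<delta>_def)
  have "\<forall>y s. 0 \<le> s \<longrightarrow> s \<le> T \<longrightarrow> T - real n * \<delta> \<le> s \<longrightarrow> w y s = 0" for n
  proof (induction n)
    case 0
    then show ?case using terminal by auto
  next
    case (Suc n)
    show ?case
    proof (intro allI impI)
      fix y s assume s: "0 \<le> s" "s \<le> T" "T - real (Suc n) * \<delta> \<le> s"
      show "w y s = 0"
      proof (cases "T - real n * \<delta> \<le> s")
        case True
        then show ?thesis using Suc s by auto
      next
        case False
        define t1 where "t1 = T - real n * \<delta>"
        define t0 where "t0 = max 0 (t1 - \<delta>)"
        have t1: "t1 \<le> T" "t1 - t0 \<le> 1 / (16 * L)" "0 \<le> t0"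
          using \<delta> unfolding \<delta>_def[symmetric] by (auto simp: t1_def t0_def)
        have st: "t0 \<le> s" "s \<le> t1" "0 \<le> t1" using s False by (auto simp: t1_def t0_def algebra_simps)
        have sub: "{t0..t1} \<subseteq> {0..T}" using t1 by auto
        have z1: "w x t1 = 0" for x
          using Suc st t1 by (auto simp: t1_def)
        have cw: "continuous_on (UNIV \<times> {t0..t1}) (\<lambda>(y, t). w y t)"
          by (rule continuous_on_subset[OF cont]) (use sub in auto)
        have "w y s \<le> 0"
        proof (rule backward_heat_nonpos_short_time[OF L t1(2), of w w_t w_y w_yy K])
          show "continuous_on (UNIV \<times> {t0..t1}) (\<lambda>(y, t). w y t)" by (rule cw)
          show "w x u \<le> K * exp (L * x\<^sup>2)" if "t0 \<le> u" "u \<le> t1" for x u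
            using growth[of u x] that t1 by auto
          show "(w y has_real_derivative w_t y t) (at t within {t0..t1})" if "t0 \<le> t" "t < t1" for y t
            by (rule has_field_derivative_subset[OF dt sub]) (use that t1 in auto)
          show "w_t y t + 1/2 * w_yy y t = 0" if "t0 \<le> t" "t < t1" for y t
            using heat[of t y] that t1 by auto
        qed (use t1 st z1 in \<open>auto intro!: dt dy dyy\<close>)
        moreover have "- w y s \<le> 0"
        proof (rule backward_heat_nonpos_short_time[OF L t1(2), of "\<lambda>y t. - w y t"
              "\<lambda>y t. - w_t y t" "\<lambda>y t. - w_y y t" "\<lambda>y t. - w_yy y t" K])
          show "continuous_on (UNIV \<times> {t0..t1}) (\<lambda>(y, t). - w y t)"
            using continuous_on_minus[OF cw] by (simp add: split_def)
          show "- w x u \<le> K * exp (L * x\<^sup>2)" if "t0 \<le> u" "u \<le> t1" for x u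
            using growth[of u x] that t1 by auto
          show "((\<lambda>t. - w y t) has_real_derivative - w_t y t) (at t within {t0..t1})"
            if "t0 \<le> t" "t < t1" for y t
            by (intro DERIV_minus has_field_derivative_subset[OF dt sub]) (use that t1 in auto)
          show "- w_t y t + 1/2 * - w_yy y t = 0" if "t0 \<le> t" "t < t1" for y t
            using heat[of t y] that t1 by auto
        qed (use t1 st z1 in \<open>auto intro!: DERIV_minus dy dyy\<close>)
        ultimately show ?thesis by simp
      qed
    qed
  qed
  moreover obtain n where "T < real n * \<delta>"
    using \<delta> reals_Archimedean3[of \<delta>] by auto
  ultimately show ?thesis using t by (metis diff_less_eq add_0 less_eq_real_def order.trans)
qed

section \<open>Gaussian moments of functions of exponential growth\<close>

text \<open>Functions of a parameter \<open>m\<close> and a space variable \<open>\<rho>\<close> of at most exponential growth in \<open>\<rho>\<close>, locally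
  uniformly in \<open>m\<close>: every Gaussian makes them integrable.\<close>

definition tame :: "(real \<Rightarrow> real \<Rightarrow> real) \<Rightarrow> bool" where
  "tame \<psi> \<longleftrightarrow> continuous_on UNIV (\<lambda>(m,\<rho>). \<psi> m \<rho>) \<and>
     (\<forall>M. \<exists>D. \<forall>m \<rho>. \<bar>m\<bar> \<le> M \<longrightarrow> \<bar>\<psi> m \<rho>\<bar> \<le> D * exp \<bar>\<rho>\<bar>)"

text \<open>The moments are not normalised: this keeps time derivatives of the Gaussian apart from those of the
  factor \<open>1 / sqrt (2 * pi * (T - t))\<close>, and moments are then closed under differentiation up to powers of
  \<open>1 / (T - t)\<close>.\<close>

definition gauss_integrand ::
    "real \<Rightarrow> nat \<Rightarrow> (real \<Rightarrow> real \<Rightarrow> real) \<Rightarrow> real \<Rightarrow> real \<Rightarrow> real \<Rightarrow> real \<Rightarrow> real" where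
  "gauss_integrand T i \<psi> y m t \<rho> = (\<rho> - y) ^ i * exp (- (\<rho> - y)\<^sup>2 / (2 * (T - t))) * \<psi> m \<rho>"

definition gauss_moment ::
    "real \<Rightarrow> nat \<Rightarrow> (real \<Rightarrow> real \<Rightarrow> real) \<Rightarrow> real \<Rightarrow> real \<Rightarrow> real \<Rightarrow> real" where
  "gauss_moment T i \<psi> y m t = (\<integral>\<rho>. gauss_integrand T i \<psi> y m t \<rho> \<partial>lborel)"

lemma integrable_exp_neg_square: "integrable lborel (\<lambda>\<rho>. exp (- a * \<rho>\<^sup>2))" if "a > 0" for a :: real
proof -
  let ?\<sigma> = "1 / sqrt (2 * a)"
  have "exp (- a * \<rho>\<^sup>2) = sqrt (2 * pi * ?\<sigma>\<^sup>2) * normal_density 0 ?\<sigma> \<rho>" for \<rho>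
    using that by (simp add: normal_density_def power_divide)
  moreover have "integrable lborel (\<lambda>\<rho>. sqrt (2 * pi * ?\<sigma>\<^sup>2) * normal_density 0 ?\<sigma> \<rho>)"
    using that by (intro integrable_mult_right integrable_normal_density) simp
  ultimately show ?thesis by simp
qed

lemma power_le_fact_exp: "x ^ i \<le> fact i * exp x" if "x \<ge> 0" for x :: real
proof -
  have s: "(\<lambda>n. x ^ n /\<^sub>R fact n) sums exp x" by (rule exp_converges)
  have "sum (\<lambda>n. x ^ n /\<^sub>R fact n) {i} \<le> (\<Sum>n. x ^ n /\<^sub>R fact n)"
    by (rule sum_le_suminf[OF sums_summable[OF s]]) (use that in auto)
  then show ?thesis using sums_unique[OF s] by (simp add: field_simps)
qed

lemma tameD:
  assumes "tame \<psi>"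
  shows "\<exists>D\<ge>0. \<forall>m \<rho>. \<bar>m\<bar> \<le> M \<longrightarrow> \<bar>\<psi> m \<rho>\<bar> \<le> D * exp \<bar>\<rho>\<bar>"
proof -
  from assms obtain D where D: "\<And>m \<rho>. \<bar>m\<bar> \<le> M \<Longrightarrow> \<bar>\<psi> m \<rho>\<bar> \<le> D * exp \<bar>\<rho>\<bar>"
    unfolding tame_def by blast
  have "\<bar>\<psi> m \<rho>\<bar> \<le> max D 0 * exp \<bar>\<rho>\<bar>" if "\<bar>m\<bar> \<le> M" for m \<rho>
    using D[OF that, of \<rho>] by (rule order_trans) (auto intro: mult_right_mono)
  then show ?thesis by (intro exI[of _ "max D 0"]) auto
qed

text \<open>Half of the Gaussian exponent absorbs the shift \<open>y\<close>, and half of the rest absorbs the exponential growth;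
  what is left is a Gaussian that depends on \<open>T\<close> only.\<close>

lemma gauss_exponent_le:
  fixes y \<rho> \<tau> T Y :: real
  assumes "\<bar>y\<bar> \<le> Y" "0 < \<tau>" "\<tau> \<le> T"
  shows "\<bar>\<rho> - y\<bar> + \<bar>\<rho>\<bar> - (\<rho> - y)\<^sup>2 / (2 * \<tau>) \<le> Y + Y\<^sup>2 / (2 * T) + 8 * T - 1 / (8 * T) * \<rho>\<^sup>2"
proof -
  have T: "T > 0" using assms by simp
  have "0 \<le> (\<bar>\<rho>\<bar> - 8 * T)\<^sup>2" by simp
  also have "\<dots> = \<rho>\<^sup>2 + 64 * T\<^sup>2 - 16 * T * \<bar>\<rho>\<bar>"
    by (simp add: power2_diff algebra_simps power_mult_distrib)
  finally have 1: "2 * \<bar>\<rho>\<bar> \<le> \<rho>\<^sup>2 / (8 * T) + 8 * T"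
    using T by (simp add: field_simps power2_eq_square)
  have "(2 * y - \<rho>)\<^sup>2 \<ge> 0" by simp
  then have 2: "\<rho>\<^sup>2 / 2 - y\<^sup>2 \<le> (\<rho> - y)\<^sup>2" by (simp add: power2_eq_square algebra_simps)
  have "y\<^sup>2 \<le> Y\<^sup>2" using assms by (metis abs_ge_zero power2_abs power_mono)
  then have "\<rho>\<^sup>2 / 2 - Y\<^sup>2 \<le> (\<rho> - y)\<^sup>2" using 2 by simp
  then have "(\<rho>\<^sup>2 / 2 - Y\<^sup>2) / (2 * T) \<le> (\<rho> - y)\<^sup>2 / (2 * T)"
    using T by (intro divide_right_mono) auto
  also have "\<dots> \<le> (\<rho> - y)\<^sup>2 / (2 * \<tau>)"
    using assms by (intro divide_left_mono) auto
  finally have 3: "\<rho>\<^sup>2 / (4 * T) - Y\<^sup>2 / (2 * T) \<le> (\<rho> - y)\<^sup>2 / (2 * \<tau>)"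
    by (simp add: diff_divide_distrib)
  have 4: "\<rho>\<^sup>2 / (4 * T) = \<rho>\<^sup>2 / (8 * T) + \<rho>\<^sup>2 / (8 * T)" by (simp add: field_simps)
  have "\<bar>\<rho> - y\<bar> \<le> \<bar>\<rho>\<bar> + Y" using assms by simp
  moreover have "1 / (8 * T) * \<rho>\<^sup>2 = \<rho>\<^sup>2 / (8 * T)" by simp
  ultimately show ?thesis using 1 3 4 by linarith
qed

text \<open>One integrable majorant for all times before \<open>T\<close> and all \<open>y\<close>, \<open>m\<close> in a bounded set. It serves to
  dominate the integrands and, since derivatives are again combinations of moments, their derivatives.\<close>

lemma gauss_integrand_bound:
  assumes "tame \<psi>"
  shows "\<exists>B\<ge>0. \<forall>y m t \<rho>. \<bar>y\<bar> \<le> Y \<longrightarrow> \<bar>m\<bar> \<le> M \<longrightarrow> 0 \<le> t \<longrightarrow> t < T \<longrightarrow>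
    \<bar>gauss_integrand T i \<psi> y m t \<rho>\<bar> \<le> B * exp (- (1 / (8 * T)) * \<rho>\<^sup>2)"
proof -
  obtain D where D: "D \<ge> 0" "\<And>m \<rho>. \<bar>m\<bar> \<le> M \<Longrightarrow> \<bar>\<psi> m \<rho>\<bar> \<le> D * exp \<bar>\<rho>\<bar>"
    using tameD[OF assms, of M] by blast
  let ?E = "Y + Y\<^sup>2 / (2 * T) + 8 * T"
  have "\<bar>gauss_integrand T i \<psi> y m t \<rho>\<bar> \<le> (fact i * D * exp ?E) * exp (- (1 / (8 * T)) * \<rho>\<^sup>2)"
    if H: "\<bar>y\<bar> \<le> Y" "\<bar>m\<bar> \<le> M" "0 \<le> t" "t < T" for y m t \<rho>
  proof -
    have "\<bar>gauss_integrand T i \<psi> y m t \<rho>\<bar>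
        = \<bar>\<rho> - y\<bar> ^ i * exp (- (\<rho> - y)\<^sup>2 / (2 * (T - t))) * \<bar>\<psi> m \<rho>\<bar>"
      by (simp add: gauss_integrand_def abs_mult power_abs)
    also have "\<dots> \<le> (fact i * exp \<bar>\<rho> - y\<bar>) * exp (- (\<rho> - y)\<^sup>2 / (2 * (T - t))) * (D * exp \<bar>\<rho>\<bar>)"
      by (intro mult_mono power_le_fact_exp D H) (use D in auto)
    also have "\<dots> = (fact i * D) * exp (\<bar>\<rho> - y\<bar> + \<bar>\<rho>\<bar> - (\<rho> - y)\<^sup>2 / (2 * (T - t)))"
      by (simp add: exp_add exp_diff exp_minus field_simps)
    also have "\<dots> \<le> (fact i * D) * exp (?E - 1 / (8 * T) * \<rho>\<^sup>2)"
      using gauss_exponent_le[of y Y "T - t" T \<rho>] H D by (intro mult_left_mono) auto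
    also have "\<dots> = (fact i * D * exp ?E) * exp (- (1 / (8 * T)) * \<rho>\<^sup>2)"
      by (simp add: exp_diff exp_minus field_simps)
    finally show ?thesis .
  qed
  then show ?thesis using D by (intro exI[of _ "fact i * D * exp ?E"]) auto
qed

lemma tame_continuous:
  assumes "tame \<psi>"
  shows "continuous_on UNIV (\<psi> m)" "\<psi> m \<in> borel_measurable borel"
proof -
  have c: "continuous_on UNIV (\<lambda>(m,\<rho>). \<psi> m \<rho>)" using assms by (simp add: tame_def)
  show "continuous_on UNIV (\<psi> m)"
    using continuous_on_compose2[OF c, of UNIV "\<lambda>\<rho>. (m,\<rho>)"]
    by (simp add: continuous_on_Pair continuous_on_const continuous_on_id)
  then show "\<psi> m \<in> borel_measurable borel" by (rule borel_measurable_continuous_onI)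
qed

lemma measurable_gauss_integrand [measurable]:
  "tame \<psi> \<Longrightarrow> gauss_integrand T i \<psi> y m t \<in> borel_measurable borel"
  unfolding gauss_integrand_def using tame_continuous(2)[of \<psi> m] by measurable

lemma integrable_gauss_integrand:
  assumes "tame \<psi>" "0 \<le> t" "t < T"
  shows "integrable lborel (gauss_integrand T i \<psi> y m t)"
proof -
  obtain B where B: "B \<ge> 0" "\<And>\<rho>. \<bar>gauss_integrand T i \<psi> y m t \<rho>\<bar> \<le> B * exp (- (1 / (8 * T)) * \<rho>\<^sup>2)"
    using gauss_integrand_bound[OF assms(1), of "\<bar>y\<bar>" "\<bar>m\<bar>" T i] assms by blast
  show ?thesis
  proof (rule Bochner_Integration.integrable_bound)
    show "integrable lborel (\<lambda>\<rho>. B * exp (- (1 / (8 * T)) * \<rho>\<^sup>2))"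
      using assms by (intro integrable_mult_right integrable_exp_neg_square) auto
  qed (use B assms in \<open>auto simp: abs_mult\<close>)
qed

lemma continuous_on_gauss_moment:
  assumes \<psi>: "tame \<psi>" and T: "0 < T"
  shows "continuous_on (UNIV \<times> UNIV \<times> {0..<T}) (\<lambda>(y,m,t). gauss_moment T i \<psi> y m t)"
  unfolding continuous_on_def
proof (rule ballI)
  fix p0 :: "real \<times> real \<times> real" assume p0: "p0 \<in> UNIV \<times> UNIV \<times> {0..<T}"
  obtain y0 m0 t0 where p0_eq: "p0 = (y0, m0, t0)" by (cases p0) auto
  let ?S = "UNIV \<times> UNIV \<times> {0..<T} :: (real \<times> real \<times> real) set"
  let ?U = "ball y0 1 \<times> ball m0 1 \<times> UNIV :: (real \<times> real \<times> real) set"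
  have at: "at p0 within ?S = at p0 within (?S \<inter> ?U)"
    by (rule at_within_nhd[of _ ?U]) (auto simp: p0_eq open_Times)
  obtain B where B: "B \<ge> 0" "\<And>y m t \<rho>. \<bar>y\<bar> \<le> \<bar>y0\<bar> + 1 \<Longrightarrow> \<bar>m\<bar> \<le> \<bar>m0\<bar> + 1 \<Longrightarrow> 0 \<le> t \<Longrightarrow> t < T
      \<Longrightarrow> \<bar>gauss_integrand T i \<psi> y m t \<rho>\<bar> \<le> B * exp (- (1 / (8 * T)) * \<rho>\<^sup>2)"
    using gauss_integrand_bound[OF \<psi>, of "\<bar>y0\<bar> + 1" "\<bar>m0\<bar> + 1" T i] by blast
  have c\<psi>: "continuous_on UNIV (\<lambda>(m,\<rho>). \<psi> m \<rho>)" using \<psi> by (simp add: tame_def)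
  have "((\<lambda>p. \<integral>\<rho>. (\<lambda>(y,m,t). gauss_integrand T i \<psi> y m t) p \<rho> \<partial>lborel) \<longlongrightarrow>
      (\<integral>\<rho>. (\<lambda>(y,m,t). gauss_integrand T i \<psi> y m t) p0 \<rho> \<partial>lborel)) (at p0 within (?S \<inter> ?U))"
  proof (rule tendsto_integral_dominated)
    show "integrable lborel (\<lambda>\<rho>. B * exp (- (1 / (8 * T)) * \<rho>\<^sup>2))"
      using T by (intro integrable_mult_right integrable_exp_neg_square) auto
    show "AE \<rho> in lborel. \<forall>p\<in>?S \<inter> ?U. \<bar>(\<lambda>(y,m,t). gauss_integrand T i \<psi> y m t) p \<rho>\<bar>
        \<le> B * exp (- (1 / (8 * T)) * \<rho>\<^sup>2)"
    proof (intro AE_I2 ballI)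
      fix \<rho> p assume p: "p \<in> ?S \<inter> ?U"
      obtain y m t where p_eq: "p = (y, m, t)" by (cases p) auto
      have "\<bar>y\<bar> \<le> \<bar>y0\<bar> + 1" "\<bar>m\<bar> \<le> \<bar>m0\<bar> + 1" "0 \<le> t" "t < T"
        using p by (auto simp: p_eq dist_real_def)
      from B(2)[OF this, of \<rho>]
      show "\<bar>(\<lambda>(y,m,t). gauss_integrand T i \<psi> y m t) p \<rho>\<bar> \<le> B * exp (- (1 / (8 * T)) * \<rho>\<^sup>2)"
        unfolding p_eq prod.case .
    qed
    show "AE \<rho> in lborel. ((\<lambda>p. (\<lambda>(y,m,t). gauss_integrand T i \<psi> y m t) p \<rho>) \<longlongrightarrow>
        (\<lambda>(y,m,t). gauss_integrand T i \<psi> y m t) p0 \<rho>) (at p0 within (?S \<inter> ?U))"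
    proof (intro AE_I2)
      fix \<rho> :: real
      have c\<psi>': "continuous_on ?S (\<lambda>p. \<psi> (fst (snd p)) \<rho>)"
      proof -
        have "continuous_on ?S (\<lambda>p. (fst (snd p), \<rho>))" by (intro continuous_intros)
        from continuous_on_compose2[OF c\<psi> this] show ?thesis by simp
      qed
      have "continuous_on ?S (\<lambda>p. gauss_integrand T i \<psi> (fst p) (fst (snd p)) (snd (snd p)) \<rho>)"
        unfolding gauss_integrand_def
        by (intro continuous_intros c\<psi>') auto
      then show "((\<lambda>p. (\<lambda>(y,m,t). gauss_integrand T i \<psi> y m t) p \<rho>) \<longlongrightarrow>
        (\<lambda>(y,m,t). gauss_integrand T i \<psi> y m t) p0 \<rho>) (at p0 within (?S \<inter> ?U))"
        using p0 unfolding continuous_on_def at[symmetric] by (auto simp: split_def)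
    qed
  qed (use \<psi> in \<open>auto simp: split_def\<close>)
  then show "((\<lambda>(y,m,t). gauss_moment T i \<psi> y m t) \<longlongrightarrow> (\<lambda>(y,m,t). gauss_moment T i \<psi> y m t) p0)
      (at p0 within ?S)"
    unfolding at by (simp add: gauss_moment_def split_def)
qed

lemma gauss_exp_deriv:
  assumes "T - t \<noteq> (0::real)"
  shows "((\<lambda>x. exp (- (\<rho> - x)\<^sup>2 / (2 * (T - t)))) has_real_derivative
      exp (- (\<rho> - y)\<^sup>2 / (2 * (T - t))) * ((\<rho> - y) / (T - t))) (at y)"
    and "((\<lambda>r. exp (- (r - y)\<^sup>2 / (2 * (T - t)))) has_real_derivative
      exp (- (\<rho> - y)\<^sup>2 / (2 * (T - t))) * (- (\<rho> - y) / (T - t))) (at \<rho>)"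
    and "((\<lambda>s. exp (- (\<rho> - y)\<^sup>2 / (2 * (T - s)))) has_real_derivative
      exp (- (\<rho> - y)\<^sup>2 / (2 * (T - t))) * (- (\<rho> - y)\<^sup>2 / (2 * (T - t)\<^sup>2))) (at t)"
proof -
  have "((\<lambda>x. - (\<rho> - x)\<^sup>2) has_real_derivative 2 * (\<rho> - y)) (at y)"
    by (auto intro!: derivative_eq_intros)
  from DERIV_cdivide[OF this, of "2 * (T - t)"]
  have "((\<lambda>x. - (\<rho> - x)\<^sup>2 / (2 * (T - t))) has_real_derivative (\<rho> - y) / (T - t)) (at y)"
    by (simp only: mult_divide_mult_cancel_left[of "2::real"] zero_neq_numeral[symmetric] simp_thms)
  from DERIV_fun_exp[OF this]
  show "((\<lambda>x. exp (- (\<rho> - x)\<^sup>2 / (2 * (T - t)))) has_real_derivative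
      exp (- (\<rho> - y)\<^sup>2 / (2 * (T - t))) * ((\<rho> - y) / (T - t))) (at y)" .
  have "((\<lambda>r. - (r - y)\<^sup>2) has_real_derivative 2 * - (\<rho> - y)) (at \<rho>)"
    by (auto intro!: derivative_eq_intros)
  from DERIV_cdivide[OF this, of "2 * (T - t)"]
  have "((\<lambda>r. - (r - y)\<^sup>2 / (2 * (T - t))) has_real_derivative - (\<rho> - y) / (T - t)) (at \<rho>)"
    by (simp only: mult_divide_mult_cancel_left[of "2::real"] zero_neq_numeral[symmetric] simp_thms)
  from DERIV_fun_exp[OF this]
  show "((\<lambda>r. exp (- (r - y)\<^sup>2 / (2 * (T - t)))) has_real_derivative
      exp (- (\<rho> - y)\<^sup>2 / (2 * (T - t))) * (- (\<rho> - y) / (T - t))) (at \<rho>)" .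
  have "((\<lambda>s. - a / (2 * (T - s))) has_real_derivative - a / (2 * (T - t)\<^sup>2)) (at t)" for a
    using assms by (auto intro!: derivative_eq_intros simp: divide_simps power2_eq_square) (simp add: algebra_simps)
  from DERIV_fun_exp[OF this, of "(\<rho> - y)\<^sup>2"]
  show "((\<lambda>s. exp (- (\<rho> - y)\<^sup>2 / (2 * (T - s)))) has_real_derivative
      exp (- (\<rho> - y)\<^sup>2 / (2 * (T - t))) * (- (\<rho> - y)\<^sup>2 / (2 * (T - t)\<^sup>2))) (at t)" .
qed

lemma gauss_integrand_deriv_y:
  assumes "T - t \<noteq> 0"
  shows "((\<lambda>x. gauss_integrand T i \<psi> x m t \<rho>) has_real_derivative
    - real i * gauss_integrand T (i - 1) \<psi> y m t \<rho> + gauss_integrand T (i + 1) \<psi> y m t \<rho> / (T - t)) (at y)"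
proof -
  have "((\<lambda>x. (\<rho> - x) ^ i) has_real_derivative - real i * (\<rho> - y) ^ (i - 1)) (at y)"
    by (auto intro!: derivative_eq_intros)
  from DERIV_mult[OF DERIV_mult[OF this gauss_exp_deriv(1)[OF assms]] DERIV_const[of "\<psi> m \<rho>"]]
  show ?thesis
    unfolding gauss_integrand_def
    by (rule DERIV_cong) (simp add: algebra_simps add_divide_distrib diff_divide_distrib)
qed

lemma gauss_integrand_deriv_\<rho>:
  assumes "T - t \<noteq> 0" and d: "(\<psi> m has_real_derivative \<psi>' m \<rho>) (at \<rho>)"
  shows "(gauss_integrand T i \<psi> y m t has_real_derivative
    real i * gauss_integrand T (i - 1) \<psi> y m t \<rho> - gauss_integrand T (i + 1) \<psi> y m t \<rho> / (T - t)
    + gauss_integrand T i \<psi>' y m t \<rho>) (at \<rho>)"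
proof -
  have "((\<lambda>r. (r - y) ^ i) has_real_derivative real i * (\<rho> - y) ^ (i - 1)) (at \<rho>)"
    by (auto intro!: derivative_eq_intros)
  from DERIV_mult[OF DERIV_mult[OF this gauss_exp_deriv(2)[where y = y, OF assms(1)]] d]
  show ?thesis
    unfolding gauss_integrand_def[abs_def]
    by (rule DERIV_cong) (simp add: algebra_simps add_divide_distrib diff_divide_distrib)
qed

lemma gauss_integrand_deriv_t:
  assumes "T - t \<noteq> 0"
  shows "((\<lambda>s. gauss_integrand T i \<psi> y m s \<rho>) has_real_derivative
    - gauss_integrand T (i + 2) \<psi> y m t \<rho> / (2 * (T - t)\<^sup>2)) (at t)"
proof -
  from DERIV_mult[OF DERIV_cmult[OF gauss_exp_deriv(3)[OF assms], of "(\<rho> - y) ^ i"] DERIV_const[of "\<psi> m \<rho>"]]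
  show ?thesis
    unfolding gauss_integrand_def
    by (rule DERIV_cong) (simp add: power_add algebra_simps power2_eq_square)
qed

lemma gauss_moment_deriv_y:
  assumes \<psi>: "tame \<psi>" and t: "0 \<le> t" "t < T"
  shows "((\<lambda>x. gauss_moment T i \<psi> x m t) has_real_derivative
    - real i * gauss_moment T (i - 1) \<psi> y m t + gauss_moment T (i + 1) \<psi> y m t / (T - t)) (at y)"
proof -
  let ?g = "\<lambda>i y. gauss_integrand T i \<psi> y m t"
  let ?e = "\<lambda>\<rho>. exp (- (1 / (8 * T)) * \<rho>\<^sup>2)"
  let ?D = "\<lambda>x \<rho>. - real i * ?g (i - 1) x \<rho> + ?g (i + 1) x \<rho> / (T - t)"
  obtain B1 where B1: "B1 \<ge> 0" "\<And>x \<rho>. \<bar>x\<bar> \<le> \<bar>y\<bar> + 1 \<Longrightarrow> \<bar>?g (i - 1) x \<rho>\<bar> \<le> B1 * ?e \<rho>"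
    using gauss_integrand_bound[OF \<psi>, of "\<bar>y\<bar> + 1" "\<bar>m\<bar>" T "i - 1"] t by blast
  obtain B2 where B2: "B2 \<ge> 0" "\<And>x \<rho>. \<bar>x\<bar> \<le> \<bar>y\<bar> + 1 \<Longrightarrow> \<bar>?g (i + 1) x \<rho>\<bar> \<le> B2 * ?e \<rho>"
    using gauss_integrand_bound[OF \<psi>, of "\<bar>y\<bar> + 1" "\<bar>m\<bar>" T "i + 1"] t by blast
  have "((\<lambda>x. \<integral>\<rho>. ?g i x \<rho> \<partial>lborel) has_real_derivative (\<integral>\<rho>. ?D y \<rho> \<partial>lborel)) (at y within {y-1..y+1})"
  proof (rule has_real_derivative_integral_dominated)
    show "integrable lborel (\<lambda>\<rho>. (real i * B1 + B2 / (T - t)) * ?e \<rho>)"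
      using t by (intro integrable_mult_right integrable_exp_neg_square) auto
    show "AE \<rho> in lborel. \<forall>x\<in>{y-1..y+1}. ((\<lambda>x. ?g i x \<rho>) has_real_derivative ?D x \<rho>) (at x within {y-1..y+1})"
    proof (intro AE_I2 ballI)
      fix \<rho> x
      show "((\<lambda>x. ?g i x \<rho>) has_real_derivative ?D x \<rho>) (at x within {y-1..y+1})"
        by (rule has_field_derivative_at_within[OF gauss_integrand_deriv_y]) (use t in simp)
    qed
    show "AE \<rho> in lborel. \<forall>x\<in>{y-1..y+1}. \<bar>?D x \<rho>\<bar> \<le> (real i * B1 + B2 / (T - t)) * ?e \<rho>"
    proof (intro AE_I2 ballI)
      fix \<rho> x assume "x \<in> {y-1..y+1}"
      then have x: "\<bar>x\<bar> \<le> \<bar>y\<bar> + 1" by auto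
      have "\<bar>?D x \<rho>\<bar> \<le> real i * \<bar>?g (i - 1) x \<rho>\<bar> + \<bar>?g (i + 1) x \<rho>\<bar> / (T - t)"
        using t by (intro order_trans[OF abs_triangle_ineq]) (auto simp: abs_mult)
      also have "\<dots> \<le> real i * (B1 * ?e \<rho>) + B2 * ?e \<rho> / (T - t)"
        using t by (intro add_mono mult_left_mono divide_right_mono B1 B2 x) auto
      finally show "\<bar>?D x \<rho>\<bar> \<le> (real i * B1 + B2 / (T - t)) * ?e \<rho>" by (simp add: algebra_simps)
    qed
  qed (use integrable_gauss_integrand[OF \<psi> t] \<psi> in auto)
  moreover have "(\<integral>\<rho>. ?D y \<rho> \<partial>lborel) = - real i * gauss_moment T (i - 1) \<psi> y m t + gauss_moment T (i + 1) \<psi> y m t / (T - t)"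
    unfolding gauss_moment_def using integrable_gauss_integrand[OF \<psi> t] by simp
  ultimately show ?thesis
    by (simp add: gauss_moment_def at_within_Icc_at)
qed

lemma gauss_moment_deriv_t:
  assumes \<psi>: "tame \<psi>" and t: "0 \<le> t" "t < T"
  shows "((\<lambda>s. gauss_moment T i \<psi> y m s) has_real_derivative
    - gauss_moment T (i + 2) \<psi> y m t / (2 * (T - t)\<^sup>2)) (at t within {0..T})"
proof -
  let ?g = "\<lambda>i s. gauss_integrand T i \<psi> y m s"
  let ?e = "\<lambda>\<rho>. exp (- (1 / (8 * T)) * \<rho>\<^sup>2)"
  (* On S the factor 1 / (T - s)^2 of the derivative stays bounded. *)
  define S where "S = {0..(t + T) / 2}"
  let ?D = "\<lambda>s \<rho>. - ?g (i + 2) s \<rho> / (2 * (T - s)\<^sup>2)"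
  have S: "0 \<le> s" "s < T" "(T - t) / 2 \<le> T - s" if "s \<in> S" for s
    using that t by (auto simp: S_def)
  obtain B where B: "B \<ge> 0" "\<And>s \<rho>. s \<in> S \<Longrightarrow> \<bar>?g (i + 2) s \<rho>\<bar> \<le> B * ?e \<rho>"
    using gauss_integrand_bound[OF \<psi>, of "\<bar>y\<bar>" "\<bar>m\<bar>" T "i + 2"] S(1,2) by blast
  have "((\<lambda>s. \<integral>\<rho>. ?g i s \<rho> \<partial>lborel) has_real_derivative (\<integral>\<rho>. ?D t \<rho> \<partial>lborel)) (at t within S)"
  proof (rule has_real_derivative_integral_dominated)
    show "integrable lborel (\<lambda>\<rho>. (B / (2 * ((T - t) / 2)\<^sup>2)) * ?e \<rho>)"
      using t by (intro integrable_mult_right integrable_exp_neg_square) auto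
    show "AE \<rho> in lborel. \<forall>s\<in>S. ((\<lambda>s. ?g i s \<rho>) has_real_derivative ?D s \<rho>) (at s within S)"
    proof (intro AE_I2 ballI)
      fix \<rho> s assume "s \<in> S"
      then have "T - s \<noteq> 0" using S by fastforce
      then show "((\<lambda>s. ?g i s \<rho>) has_real_derivative ?D s \<rho>) (at s within S)"
        by (rule has_field_derivative_at_within[OF gauss_integrand_deriv_t])
    qed
    show "AE \<rho> in lborel. \<forall>s\<in>S. \<bar>?D s \<rho>\<bar> \<le> (B / (2 * ((T - t) / 2)\<^sup>2)) * ?e \<rho>"
    proof (intro AE_I2 ballI)
      fix \<rho> s assume s: "s \<in> S"
      have "\<bar>?D s \<rho>\<bar> = \<bar>?g (i + 2) s \<rho>\<bar> / (2 * (T - s)\<^sup>2)" by simp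
      also have "\<dots> \<le> (B * ?e \<rho>) / (2 * ((T - t) / 2)\<^sup>2)"
        using t S[OF s] by (intro frac_le mult_left_mono power_mono B s mult_nonneg_nonneg) simp_all
      finally show "\<bar>?D s \<rho>\<bar> \<le> (B / (2 * ((T - t) / 2)\<^sup>2)) * ?e \<rho>" by simp
    qed
    show "t \<in> S" "convex S" using t by (auto simp: S_def)
  qed (use integrable_gauss_integrand[OF \<psi>] S \<psi> in auto)
  moreover have "(\<integral>\<rho>. ?D t \<rho> \<partial>lborel) = - gauss_moment T (i + 2) \<psi> y m t / (2 * (T - t)\<^sup>2)"
    unfolding gauss_moment_def by simp
  moreover have "at t within {0..T} = at t within S"
    by (rule at_within_nhd[of _ "{..<(t + T) / 2}"]) (use t in \<open>auto simp: S_def\<close>)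
  ultimately show ?thesis
    by (simp add: gauss_moment_def)
qed

lemma gauss_moment_deriv_parameter:
  assumes \<psi>: "tame \<psi>" and \<psi>': "tame \<psi>'" and t: "0 \<le> t" "t < T"
    and d: "\<And>x \<rho>. ((\<lambda>x. \<psi> x \<rho>) has_real_derivative \<psi>' x \<rho>) (at x)"
  shows "((\<lambda>x. gauss_moment T i \<psi> y x t) has_real_derivative gauss_moment T i \<psi>' y m t) (at m)"
proof -
  let ?e = "\<lambda>\<rho>. exp (- (1 / (8 * T)) * \<rho>\<^sup>2)"
  obtain B where B: "B \<ge> 0" "\<And>x \<rho>. \<bar>x\<bar> \<le> \<bar>m\<bar> + 1 \<Longrightarrow> \<bar>gauss_integrand T i \<psi>' y x t \<rho>\<bar> \<le> B * ?e \<rho>"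
    using gauss_integrand_bound[OF \<psi>', of "\<bar>y\<bar>" "\<bar>m\<bar> + 1" T i] t by blast
  have "((\<lambda>x. \<integral>\<rho>. gauss_integrand T i \<psi> y x t \<rho> \<partial>lborel) has_real_derivative
      (\<integral>\<rho>. gauss_integrand T i \<psi>' y m t \<rho> \<partial>lborel)) (at m within {m-1..m+1})"
  proof (rule has_real_derivative_integral_dominated)
    show "integrable lborel (\<lambda>\<rho>. B * ?e \<rho>)"
      using t by (intro integrable_mult_right integrable_exp_neg_square) auto
    show "AE \<rho> in lborel. \<forall>x\<in>{m-1..m+1}. ((\<lambda>x. gauss_integrand T i \<psi> y x t \<rho>) has_real_derivative
        gauss_integrand T i \<psi>' y x t \<rho>) (at x within {m-1..m+1})"
      unfolding gauss_integrand_def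
      by (intro AE_I2 ballI DERIV_cmult has_field_derivative_at_within[OF d])
    show "AE \<rho> in lborel. \<forall>x\<in>{m-1..m+1}. \<bar>gauss_integrand T i \<psi>' y x t \<rho>\<bar> \<le> B * ?e \<rho>"
      by (intro AE_I2 ballI B) auto
  qed (use integrable_gauss_integrand[OF \<psi> t] \<psi>' in auto)
  then show ?thesis
    by (simp add: gauss_moment_def at_within_Icc_at)
qed

lemma integral_derivative_whole_line:
  fixes F f :: "real \<Rightarrow> real"
  assumes F: "\<And>x. (F has_real_derivative f x) (at x)" and f: "continuous_on UNIV f" "integrable lborel f"
    and lim: "(F \<longlongrightarrow> 0) at_top" "(F \<longlongrightarrow> 0) at_bot"
  shows "(\<integral>x. f x \<partial>lborel) = 0"
proof -
  have "(LBINT x=-\<infinity>..\<infinity>. f x) = 0 - 0"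
  proof (rule interval_integral_FTC_integrable[where F = F])
    show "(F has_vector_derivative f x) (at x)" for x
      using F by (simp add: has_real_derivative_iff_has_vector_derivative)
    show "isCont f x" for x using f(1) by (simp add: continuous_on_eq_continuous_at)
    show "set_integrable lborel (einterval (-\<infinity>) \<infinity>) f"
      using f(2) by (simp add: set_integrable_def einterval_def)
    show "((F \<circ> real_of_ereal) \<longlongrightarrow> 0) (at_right (-\<infinity>))"
      using lim(2) by (simp add: ereal_tendsto_simps)
    show "((F \<circ> real_of_ereal) \<longlongrightarrow> 0) (at_left \<infinity>)"
      using lim(1) by (simp add: ereal_tendsto_simps)
  qed auto
  then show ?thesis
    by (simp add: interval_lebesgue_integral_def set_lebesgue_integral_def einterval_def)
qed

text \<open>The boundary terms vanish by the Gaussian majorant.\<close>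

lemma gauss_moment_by_parts:
  assumes \<eta>: "tame \<eta>" and \<eta>': "tame \<eta>'" and t: "0 \<le> t" "t < T"
    and d: "\<And>\<rho>. (\<eta> m has_real_derivative \<eta>' m \<rho>) (at \<rho>)"
  shows "gauss_moment T i \<eta>' y m t
    = - real i * gauss_moment T (i - 1) \<eta> y m t + gauss_moment T (i + 1) \<eta> y m t / (T - t)"
proof -
  let ?g = "\<lambda>i \<psi> \<rho>. gauss_integrand T i \<psi> y m t \<rho>"
  let ?f = "\<lambda>\<rho>. real i * ?g (i - 1) \<eta> \<rho> - ?g (i + 1) \<eta> \<rho> / (T - t) + ?g i \<eta>' \<rho>"
  obtain B where B: "B \<ge> 0" "\<And>\<rho>. \<bar>?g i \<eta> \<rho>\<bar> \<le> B * exp (- (1 / (8 * T)) * \<rho>\<^sup>2)"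
    using gauss_integrand_bound[OF \<eta>, of "\<bar>y\<bar>" "\<bar>m\<bar>" T i] t by blast
  have "(\<integral>\<rho>. ?f \<rho> \<partial>lborel) = 0"
  proof (rule integral_derivative_whole_line[where F = "?g i \<eta>"])
    show "(?g i \<eta> has_real_derivative ?f \<rho>) (at \<rho>)" for \<rho>
      by (rule gauss_integrand_deriv_\<rho>[where \<psi> = \<eta> and \<psi>' = \<eta>']) (use t d in simp_all)
    show "continuous_on UNIV ?f"
      unfolding gauss_integrand_def using t
      by (intro continuous_intros tame_continuous(1)[OF \<eta>] tame_continuous(1)[OF \<eta>']) auto
    show "integrable lborel ?f"
      using integrable_gauss_integrand[OF \<eta> t] integrable_gauss_integrand[OF \<eta>' t] by auto
    have lim: "((\<lambda>\<rho>. B * exp (- (1 / (8 * T)) * \<rho>\<^sup>2)) \<longlongrightarrow> 0) F"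
      if "filterlim (\<lambda>\<rho>::real. \<rho>\<^sup>2) at_top F" for F
    proof -
      have "filterlim (\<lambda>\<rho>. - (1 / (8 * T)) * \<rho>\<^sup>2) at_bot F"
        by (rule filterlim_tendsto_neg_mult_at_bot[OF tendsto_const _ that]) (use t in auto)
      then have "((\<lambda>\<rho>. exp (- (1 / (8 * T)) * \<rho>\<^sup>2)) \<longlongrightarrow> 0) F"
        by (rule filterlim_compose[OF exp_at_bot])
      then show ?thesis by (rule tendsto_mult_right_zero)
    qed
    have top: "filterlim (\<lambda>\<rho>::real. \<rho>\<^sup>2) at_top at_top" "filterlim (\<lambda>\<rho>::real. \<rho>\<^sup>2) at_top at_bot"
      by (rule filterlim_pow_at_top filterlim_pow_at_bot_even; simp add: filterlim_ident)+
    show "(?g i \<eta> \<longlongrightarrow> 0) at_top" "(?g i \<eta> \<longlongrightarrow> 0) at_bot"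
      by (rule Lim_null_comparison[OF always_eventually lim[OF top(1)]]; use B in simp)
         (rule Lim_null_comparison[OF always_eventually lim[OF top(2)]]; use B in simp)
  qed
  then show ?thesis
    unfolding gauss_moment_def
    using integrable_gauss_integrand[OF \<eta> t] integrable_gauss_integrand[OF \<eta>' t] by simp
qed

section \<open>The heat kernel\<close>

lemma heat_kernel_solution_eq_moment:
  assumes "t < T"
  shows "heat_kernel_solution T (\<psi> m) y t = 1 / sqrt (2 * pi) * (1 / sqrt (T - t)) * gauss_moment T 0 \<psi> y m t"
proof -
  have "normal_density y (sqrt (T - t)) \<rho> * \<psi> m \<rho>
      = 1 / sqrt (2 * pi) * (1 / sqrt (T - t)) * gauss_integrand T 0 \<psi> y m t \<rho>" for \<rho>
    using assms by (simp add: normal_density_def gauss_integrand_def real_sqrt_mult)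
  then show ?thesis
    using assms by (simp add: heat_kernel_solution_def gauss_moment_def)
qed

text \<open>In units of the standard deviation the heat kernel is a fixed Gaussian, which makes its action
  regular up to the terminal time.\<close>

lemma heat_kernel_solution_standard:
  assumes "t \<le> T"
  shows "heat_kernel_solution T \<phi> y t = (\<integral>z. std_normal_density z * \<phi> (y + sqrt (T - t) * z) \<partial>lborel)"
proof (cases "t < T")
  case True
  define \<sigma> where "\<sigma> = sqrt (T - t)"
  have \<sigma>: "\<sigma> > 0" using True by (simp add: \<sigma>_def)
  have "(\<integral>\<rho>. normal_density y \<sigma> \<rho> * \<phi> \<rho> \<partial>lborel)
      = \<bar>\<sigma>\<bar> *\<^sub>R (\<integral>z. normal_density y \<sigma> (y + \<sigma> * z) * \<phi> (y + \<sigma> * z) \<partial>lborel)"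
    by (rule lborel_integral_real_affine) (use \<sigma> in auto)
  also have "\<dots> = (\<integral>z. \<sigma> * (normal_density y \<sigma> (y + \<sigma> * z) * \<phi> (y + \<sigma> * z)) \<partial>lborel)"
    using \<sigma> by simp
  also have "\<dots> = (\<integral>z. std_normal_density z * \<phi> (y + \<sigma> * z) \<partial>lborel)"
    using \<sigma> by (intro Bochner_Integration.integral_cong)
      (auto simp: normal_density_def real_sqrt_mult power_mult_distrib)
  finally show ?thesis
    using True by (simp add: heat_kernel_solution_def \<sigma>_def)
next
  case False
  then show ?thesis using assms by (simp add: heat_kernel_solution_def)
qed

lemma integrable_std_normal_exp: "integrable lborel (\<lambda>z. std_normal_density z * exp (s * \<bar>z\<bar>))"
proof (rule Bochner_Integration.integrable_bound)
  show "integrable lborel (\<lambda>z. exp (s\<^sup>2) * exp (- (1/4) * z\<^sup>2))"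
    by (intro integrable_mult_right integrable_exp_neg_square) auto
  show "AE z in lborel. norm (std_normal_density z * exp (s * \<bar>z\<bar>)) \<le> norm (exp (s\<^sup>2) * exp (- (1/4) * z\<^sup>2))"
  proof (rule AE_I2)
    fix z :: real
    have "0 \<le> (s - \<bar>z\<bar> / 2)\<^sup>2" by simp
    then have "s * \<bar>z\<bar> - z\<^sup>2 / 2 \<le> s\<^sup>2 - z\<^sup>2 / 4"
      by (simp add: power2_eq_square algebra_simps)
    then have "exp (s * \<bar>z\<bar> - z\<^sup>2 / 2) \<le> exp (s\<^sup>2 - z\<^sup>2 / 4)" by simp
    moreover have "1 / sqrt (2 * pi) \<le> 1"
      using pi_ge_two by (simp add: real_sqrt_ge_one)
    ultimately have "1 / sqrt (2 * pi) * exp (s * \<bar>z\<bar> - z\<^sup>2 / 2) \<le> 1 * exp (s\<^sup>2 - z\<^sup>2 / 4)"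
      by (intro mult_mono) auto
    moreover have "norm (std_normal_density z * exp (s * \<bar>z\<bar>)) = 1 / sqrt (2 * pi) * exp (s * \<bar>z\<bar> - z\<^sup>2 / 2)"
      by (simp add: std_normal_density_def abs_mult mult_exp_exp)
    moreover have "norm (exp (s\<^sup>2) * exp (- (1/4) * z\<^sup>2)) = 1 * exp (s\<^sup>2 - z\<^sup>2 / 4)"
      by (simp add: mult_exp_exp)
    ultimately show "norm (std_normal_density z * exp (s * \<bar>z\<bar>)) \<le> norm (exp (s\<^sup>2) * exp (- (1/4) * z\<^sup>2))"
      by (simp only:)
  qed
qed auto

lemma std_normal_integrand_bound:
  fixes \<phi> :: "real \<Rightarrow> real"
  assumes "\<And>\<rho>. \<bar>\<phi> \<rho>\<bar> \<le> D * exp \<bar>\<rho>\<bar>" "\<bar>y\<bar> \<le> Y" "0 \<le> \<sigma>" "\<sigma> \<le> s" "0 \<le> D"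
  shows "\<bar>std_normal_density z * \<phi> (y + \<sigma> * z)\<bar> \<le> D * exp Y * (std_normal_density z * exp (s * \<bar>z\<bar>))"
proof -
  have "\<bar>\<sigma> * z\<bar> \<le> s * \<bar>z\<bar>" using assms by (simp add: abs_mult mult_right_mono)
  then have "\<bar>y + \<sigma> * z\<bar> \<le> Y + s * \<bar>z\<bar>" using assms(2) by linarith
  then have "D * exp \<bar>y + \<sigma> * z\<bar> \<le> D * exp (Y + s * \<bar>z\<bar>)"
    using assms by (intro mult_left_mono) auto
  with assms(1)[of "y + \<sigma> * z"] have "\<bar>\<phi> (y + \<sigma> * z)\<bar> \<le> D * exp Y * exp (s * \<bar>z\<bar>)"
    by (simp add: exp_add)
  from mult_left_mono[OF this, of "std_normal_density z"] show ?thesis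
    by (simp add: abs_mult algebra_simps)
qed

lemma integrable_std_normal:
  fixes \<phi> :: "real \<Rightarrow> real"
  assumes "continuous_on UNIV \<phi>" "\<And>\<rho>. \<bar>\<phi> \<rho>\<bar> \<le> D * exp \<bar>\<rho>\<bar>" "0 \<le> \<sigma>"
  shows "integrable lborel (\<lambda>z. std_normal_density z * \<phi> (y + \<sigma> * z))"
proof (rule Bochner_Integration.integrable_bound)
  have D: "D \<ge> 0" using assms(2)[of 0] by (simp add: order_trans[OF abs_ge_zero])
  show "integrable lborel (\<lambda>z. D * exp \<bar>y\<bar> * (std_normal_density z * exp (\<sigma> * \<bar>z\<bar>)))"
    by (intro integrable_mult_right integrable_std_normal_exp)
  have [measurable]: "\<phi> \<in> borel_measurable borel"
    by (rule borel_measurable_continuous_onI) fact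
  show "(\<lambda>z. std_normal_density z * \<phi> (y + \<sigma> * z)) \<in> borel_measurable lborel" by measurable
  show "AE z in lborel. norm (std_normal_density z * \<phi> (y + \<sigma> * z))
      \<le> norm (D * exp \<bar>y\<bar> * (std_normal_density z * exp (\<sigma> * \<bar>z\<bar>)))"
    using std_normal_integrand_bound[OF assms(2) order_refl assms(3) order_refl D] D
    by (auto simp: abs_mult)
qed

lemma continuous_on_heat_kernel_solution:
  assumes \<psi>: "tame \<psi>"
  shows "continuous_on (UNIV \<times> UNIV \<times> {0..T}) (\<lambda>(y,m,t). heat_kernel_solution T (\<psi> m) y t)"
  unfolding continuous_on_def
proof (rule ballI)
  fix p0 :: "real \<times> real \<times> real" assume p0: "p0 \<in> UNIV \<times> UNIV \<times> {0..T}"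
  obtain y0 m0 t0 where p0_eq: "p0 = (y0, m0, t0)" by (cases p0) auto
  let ?S = "UNIV \<times> UNIV \<times> {0..T} :: (real \<times> real \<times> real) set"
  let ?U = "ball y0 1 \<times> ball m0 1 \<times> UNIV :: (real \<times> real \<times> real) set"
  have at: "at p0 within ?S = at p0 within (?S \<inter> ?U)"
    by (rule at_within_nhd[of _ ?U]) (auto simp: p0_eq open_Times)
  obtain D where D: "D \<ge> 0" "\<And>m \<rho>. \<bar>m\<bar> \<le> \<bar>m0\<bar> + 1 \<Longrightarrow> \<bar>\<psi> m \<rho>\<bar> \<le> D * exp \<bar>\<rho>\<bar>"
    using tameD[OF \<psi>, of "\<bar>m0\<bar> + 1"] by blast
  have c\<psi>: "continuous_on UNIV (\<lambda>(m,\<rho>). \<psi> m \<rho>)" using \<psi> by (simp add: tame_def)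
  let ?f = "\<lambda>(y,m,t) z. std_normal_density z * \<psi> m (y + sqrt (T - t) * z)"
  have "((\<lambda>p. \<integral>z. ?f p z \<partial>lborel) \<longlongrightarrow> (\<integral>z. ?f p0 z \<partial>lborel)) (at p0 within (?S \<inter> ?U))"
  proof (rule tendsto_integral_dominated)
    show "integrable lborel (\<lambda>z. D * exp (\<bar>y0\<bar> + 1) * (std_normal_density z * exp (sqrt T * \<bar>z\<bar>)))"
      by (intro integrable_mult_right integrable_std_normal_exp)
    have meas: "?f p \<in> borel_measurable lborel" for p
    proof -
      have [measurable]: "\<psi> m \<in> borel_measurable borel" for m by (rule tame_continuous(2)[OF \<psi>])
      show ?thesis by (cases p) simp
    qed
    show "?f p \<in> borel_measurable lborel" "?f p0 \<in> borel_measurable lborel" for p by (rule meas)+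
    show "AE z in lborel. \<forall>p\<in>?S \<inter> ?U. \<bar>?f p z\<bar> \<le> D * exp (\<bar>y0\<bar> + 1) * (std_normal_density z * exp (sqrt T * \<bar>z\<bar>))"
    proof (intro AE_I2 ballI)
      fix z p assume p: "p \<in> ?S \<inter> ?U"
      obtain y m t where p_eq: "p = (y, m, t)" by (cases p) auto
      have "\<bar>y\<bar> \<le> \<bar>y0\<bar> + 1" "\<bar>m\<bar> \<le> \<bar>m0\<bar> + 1" "0 \<le> t" "t \<le> T"
        using p by (auto simp: p_eq dist_real_def)
      from std_normal_integrand_bound[OF D(2)[OF this(2)] this(1) _ _ D(1), where \<sigma> = "sqrt (T - t)" and z = z and s = "sqrt T"] this
      show "\<bar>?f p z\<bar> \<le> D * exp (\<bar>y0\<bar> + 1) * (std_normal_density z * exp (sqrt T * \<bar>z\<bar>))"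
        by (simp add: p_eq)
    qed
    show "AE z in lborel. ((\<lambda>p. ?f p z) \<longlongrightarrow> ?f p0 z) (at p0 within (?S \<inter> ?U))"
    proof (intro AE_I2)
      fix z :: real
      have "continuous_on ?S (\<lambda>p. (fst (snd p), fst p + sqrt (T - snd (snd p)) * z))"
        by (intro continuous_intros)
      from continuous_on_compose2[OF c\<psi> this]
      have c: "continuous_on ?S (\<lambda>p. \<psi> (fst (snd p)) (fst p + sqrt (T - snd (snd p)) * z))" by simp
      have "continuous_on ?S (\<lambda>p. ?f p z)"
        unfolding split_def by (intro continuous_intros c)
      then show "((\<lambda>p. ?f p z) \<longlongrightarrow> ?f p0 z) (at p0 within (?S \<inter> ?U))"
        using p0 unfolding continuous_on_def at[symmetric] by auto
    qed
  qed
  then have "((\<lambda>p. \<integral>z. ?f p z \<partial>lborel) \<longlongrightarrow> (\<integral>z. ?f p0 z \<partial>lborel)) (at p0 within ?S)"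
    by (simp only: at)
  moreover have "\<forall>\<^sub>F p in at p0 within ?S.
      (\<integral>z. ?f p z \<partial>lborel) = (\<lambda>(y,m,t). heat_kernel_solution T (\<psi> m) y t) p"
    unfolding eventually_at_filter
    by (rule always_eventually) (auto simp: heat_kernel_solution_standard)
  moreover have "(\<integral>z. ?f p0 z \<partial>lborel) = (\<lambda>(y,m,t). heat_kernel_solution T (\<psi> m) y t) p0"
    using p0 by (auto simp: heat_kernel_solution_standard p0_eq)
  ultimately show "((\<lambda>(y,m,t). heat_kernel_solution T (\<psi> m) y t) \<longlongrightarrow>
      (\<lambda>(y,m,t). heat_kernel_solution T (\<psi> m) y t) p0) (at p0 within ?S)"
    by (simp only: Lim_transform_eventually)
qed

text \<open>In the standardised form the derivative falls on \<open>\<phi>\<close> instead of the kernel. The derivatives of the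
  solution are therefore solutions themselves and are controlled up to the terminal time.\<close>

lemma heat_kernel_solution_deriv:
  fixes \<phi> \<phi>' :: "real \<Rightarrow> real"
  assumes d: "\<And>\<rho>. (\<phi> has_real_derivative \<phi>' \<rho>) (at \<rho>)" and c: "continuous_on UNIV \<phi>'"
    and b: "\<And>\<rho>. \<bar>\<phi> \<rho>\<bar> \<le> D * exp \<bar>\<rho>\<bar>" "\<And>\<rho>. \<bar>\<phi>' \<rho>\<bar> \<le> D * exp \<bar>\<rho>\<bar>" and t: "t \<le> T"
  shows "((\<lambda>x. heat_kernel_solution T \<phi> x t) has_real_derivative heat_kernel_solution T \<phi>' y t) (at y)"
proof -
  let ?\<sigma> = "sqrt (T - t)"
  have D: "D \<ge> 0" using b(1)[of 0] by (simp add: order_trans[OF abs_ge_zero])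
  have c\<phi>: "continuous_on UNIV \<phi>" by (meson DERIV_isCont continuous_at_imp_continuous_on d)
  have "((\<lambda>x. \<integral>z. std_normal_density z * \<phi> (x + ?\<sigma> * z) \<partial>lborel) has_real_derivative
      (\<integral>z. std_normal_density z * \<phi>' (y + ?\<sigma> * z) \<partial>lborel)) (at y within {y-1..y+1})"
  proof (rule has_real_derivative_integral_dominated)
    show "integrable lborel (\<lambda>z. D * exp (\<bar>y\<bar> + 1) * (std_normal_density z * exp (?\<sigma> * \<bar>z\<bar>)))"
      by (intro integrable_mult_right integrable_std_normal_exp)
    show "integrable lborel (\<lambda>z. std_normal_density z * \<phi> (x + ?\<sigma> * z))" for x
      by (rule integrable_std_normal[OF c\<phi> b(1)]) (use t in auto)
    show "(\<lambda>z. std_normal_density z * \<phi>' (y + ?\<sigma> * z)) \<in> borel_measurable lborel"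
      by (rule borel_measurable_integrable[OF integrable_std_normal[OF c b(2)]]) (use t in auto)
    show "AE z in lborel. \<forall>x\<in>{y-1..y+1}. ((\<lambda>x. std_normal_density z * \<phi> (x + ?\<sigma> * z))
        has_real_derivative std_normal_density z * \<phi>' (x + ?\<sigma> * z)) (at x within {y-1..y+1})"
    proof (intro AE_I2 ballI)
      fix z x :: real
      have "((\<lambda>x. \<phi> (x + ?\<sigma> * z)) has_real_derivative \<phi>' (x + ?\<sigma> * z)) (at x)"
        using d[of "x + ?\<sigma> * z"] by (simp add: DERIV_shift)
      from DERIV_cmult[OF has_field_derivative_at_within[OF this]]
      show "((\<lambda>x. std_normal_density z * \<phi> (x + ?\<sigma> * z))
        has_real_derivative std_normal_density z * \<phi>' (x + ?\<sigma> * z)) (at x within {y-1..y+1})" .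
    qed
    show "AE z in lborel. \<forall>x\<in>{y-1..y+1}. \<bar>std_normal_density z * \<phi>' (x + ?\<sigma> * z)\<bar>
        \<le> D * exp (\<bar>y\<bar> + 1) * (std_normal_density z * exp (?\<sigma> * \<bar>z\<bar>))"
    proof (intro AE_I2 ballI)
      fix z x assume "x \<in> {y-1..y+1}"
      then have "\<bar>x\<bar> \<le> \<bar>y\<bar> + 1" by auto
      from std_normal_integrand_bound[OF b(2) this _ order_refl D, where \<sigma> = ?\<sigma> and z = z] t
      show "\<bar>std_normal_density z * \<phi>' (x + ?\<sigma> * z)\<bar>
        \<le> D * exp (\<bar>y\<bar> + 1) * (std_normal_density z * exp (?\<sigma> * \<bar>z\<bar>))" by simp
    qed
  qed auto
  then show ?thesis
    using t by (simp add: at_within_Icc_at heat_kernel_solution_standard)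
qed

lemma heat_kernel_solution_linear_growth:
  fixes \<phi> :: "real \<Rightarrow> real"
  assumes c: "continuous_on UNIV \<phi>" and b: "\<And>\<rho>. \<bar>\<phi> \<rho>\<bar> \<le> A + B * \<bar>\<rho>\<bar>" and B: "0 \<le> B" and t: "0 \<le> t" "t \<le> T"
  shows "\<bar>heat_kernel_solution T \<phi> y t\<bar> \<le> A + B * \<bar>y\<bar> + B * sqrt T"
proof -
  let ?\<sigma> = "sqrt (T - t)"
  have A: "A \<ge> 0" using b[of 0] by simp
  have i1: "integrable lborel (\<lambda>z. std_normal_density z * \<bar>z\<bar>)"
    using integrable_std_normal_moment_abs[of 1] by simp
  have i2: "integrable lborel (\<lambda>z. (A + B * \<bar>y\<bar>) * std_normal_density z + B * ?\<sigma> * (std_normal_density z * \<bar>z\<bar>))"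
    by (intro Bochner_Integration.integrable_add integrable_mult_right i1 integrable_normal_density) auto
  have abs1: "(\<integral>z. std_normal_density z * \<bar>z\<bar> \<partial>lborel) \<le> 1"
    using integral_std_normal_moment_abs_odd[of 0] pi_ge_two by (simp add: real_sqrt_le_1_iff)
  have "\<bar>heat_kernel_solution T \<phi> y t\<bar> = \<bar>\<integral>z. std_normal_density z * \<phi> (y + ?\<sigma> * z) \<partial>lborel\<bar>"
    using t by (simp add: heat_kernel_solution_standard)
  also have "\<dots> \<le> (\<integral>z. \<bar>std_normal_density z * \<phi> (y + ?\<sigma> * z)\<bar> \<partial>lborel)"
    by (rule integral_abs_bound)
  also have "\<dots> \<le> (\<integral>z. (A + B * \<bar>y\<bar>) * std_normal_density z + B * ?\<sigma> * (std_normal_density z * \<bar>z\<bar>) \<partial>lborel)"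
  proof (rule integral_mono'[OF i2])
    fix z
    have "\<bar>\<phi> (y + ?\<sigma> * z)\<bar> \<le> A + B * \<bar>y + ?\<sigma> * z\<bar>" by (rule b)
    also have "\<dots> \<le> A + B * (\<bar>y\<bar> + ?\<sigma> * \<bar>z\<bar>)"
      using B t abs_triangle_ineq[of y "?\<sigma> * z"] by (intro add_left_mono mult_left_mono) (auto simp: abs_mult)
    finally have "std_normal_density z * \<bar>\<phi> (y + ?\<sigma> * z)\<bar> \<le> std_normal_density z * (A + B * (\<bar>y\<bar> + ?\<sigma> * \<bar>z\<bar>))"
      by (rule mult_left_mono) simp
    then show "\<bar>std_normal_density z * \<phi> (y + ?\<sigma> * z)\<bar>
        \<le> (A + B * \<bar>y\<bar>) * std_normal_density z + B * ?\<sigma> * (std_normal_density z * \<bar>z\<bar>)"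
      by (simp add: abs_mult algebra_simps)
  qed (use A B t in \<open>auto intro!: add_nonneg_nonneg mult_nonneg_nonneg\<close>)
  also have "\<dots> = (A + B * \<bar>y\<bar>) + B * ?\<sigma> * (\<integral>z. std_normal_density z * \<bar>z\<bar> \<partial>lborel)"
    using i1 by simp
  also have "\<dots> \<le> (A + B * \<bar>y\<bar>) + B * sqrt T * 1"
    using B t abs1 by (intro add_left_mono mult_mono) auto
  finally show ?thesis by simp
qed

section \<open>Second derivatives of an inverse family\<close>

lemma inverse_family_derivatives:
  fixes h h_y h_x :: "real \<Rightarrow> real \<Rightarrow> real"
  assumes dy: "\<And>y x. ((\<lambda>y. h y x) has_real_derivative h_y y x) (at y)"
    and dx: "\<And>y x. (h y has_real_derivative h_x y x) (at x)"
    and cx: "continuous_on UNIV (\<lambda>(y,x). h_x y x)" and pos: "\<And>y x. h_x y x > 0"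
    and level: "\<And>y z. h y (\<gamma> y z) = z" and c\<gamma>: "continuous_on UNIV (\<lambda>(y,z). \<gamma> y z)"
  shows "((\<lambda>y. \<gamma> y z) has_real_derivative - h_y y (\<gamma> y z) / h_x y (\<gamma> y z)) (at y)"
    and "(\<gamma> y has_real_derivative 1 / h_x y (\<gamma> y z)) (at z)"
proof -
  have "continuous_on UNIV (\<lambda>y. (y, z))" "continuous_on UNIV (\<lambda>z. (y, z))"
    by (simp_all add: continuous_on_Pair continuous_on_const continuous_on_id)
  from continuous_on_compose2[OF c\<gamma> this(1)] continuous_on_compose2[OF c\<gamma> this(2)]
  have c: "continuous_on UNIV (\<lambda>y. \<gamma> y z)" "continuous_on UNIV (\<gamma> y)" by simp_all
  show "((\<lambda>y. \<gamma> y z) has_real_derivative - h_y y (\<gamma> y z) / h_x y (\<gamma> y z)) (at y)"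
    by (rule has_real_derivative_implicit[where h = h and z = z]) (use dy dx cx pos level c in auto)
  have "continuous_on UNIV (\<lambda>p. (y, snd p))"
    by (intro continuous_intros)
  from continuous_on_compose2[OF cx this]
  have c': "continuous_on UNIV (\<lambda>(w,x). h_x y x)" by (simp add: split_def)
  have "(\<gamma> y has_real_derivative - (- 1) / h_x y (\<gamma> y z)) (at z)"
  proof (rule has_real_derivative_implicit[where h = "\<lambda>w x. h y x - w" and z = 0])
    show "((\<lambda>w. h y (\<gamma> y z) - w) has_real_derivative - 1) (at z)"
      by (auto intro!: derivative_eq_intros)
    show "((\<lambda>x. h y x - w) has_real_derivative h_x y x) (at x)" for w x
      by (auto intro!: derivative_eq_intros dx)
  qed (use c' pos level c in auto)
  then show "(\<gamma> y has_real_derivative 1 / h_x y (\<gamma> y z)) (at z)" by simp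
qed

text \<open>Differentiating \<open>h y (\<gamma> y z) = z\<close> twice. Here \<open>- R\<close> at \<open>(y, \<gamma> y z)\<close> is the first derivative of \<open>\<gamma>\<close> in \<open>y\<close>.
  Only derivatives in \<open>y\<close> and in the second argument occur, so that time can be frozen.\<close>

lemma inverse_family_second_derivatives:
  fixes h h_y h_x h_yy h_yx h_xy h_xx :: "real \<Rightarrow> real \<Rightarrow> real"
  assumes dy: "\<And>y x. ((\<lambda>y. h y x) has_real_derivative h_y y x) (at y)"
    and dx: "\<And>y x. (h y has_real_derivative h_x y x) (at x)"
    and dyy: "\<And>y x. ((\<lambda>y. h_y y x) has_real_derivative h_yy y x) (at y)"
    and dyx: "\<And>y x. (h_y y has_real_derivative h_yx y x) (at x)"
    and dxy: "\<And>y x. ((\<lambda>y. h_x y x) has_real_derivative h_xy y x) (at y)"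
    and dxx: "\<And>y x. (h_x y has_real_derivative h_xx y x) (at x)"
    and cy: "continuous_on UNIV (\<lambda>(y,x). h_y y x)"
    and cx: "continuous_on UNIV (\<lambda>(y,x). h_x y x)"
    and cyx: "continuous_on UNIV (\<lambda>(y,x). h_yx y x)"
    and cxx: "continuous_on UNIV (\<lambda>(y,x). h_xx y x)"
    and pos: "\<And>y x. h_x y x > 0"
    and level: "\<And>y z. h y (\<gamma> y z) = z" and c\<gamma>: "continuous_on UNIV (\<lambda>(y,z). \<gamma> y z)"
  defines "R \<equiv> \<lambda>y x. h_y y x / h_x y x"
  shows "((\<lambda>y. - R y (\<gamma> y z)) has_real_derivative
      - (h_yy y (\<gamma> y z) - R y (\<gamma> y z) * (h_xy y (\<gamma> y z) + h_yx y (\<gamma> y z))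
         + (R y (\<gamma> y z))\<^sup>2 * h_xx y (\<gamma> y z)) / h_x y (\<gamma> y z)) (at y)" (is ?yy)
    and "((\<lambda>z. - R y (\<gamma> y z)) has_real_derivative
      - (h_yx y (\<gamma> y z) - R y (\<gamma> y z) * h_xx y (\<gamma> y z)) / (h_x y (\<gamma> y z))\<^sup>2) (at z)" (is ?yz)
    and "((\<lambda>z. 1 / h_x y (\<gamma> y z)) has_real_derivative - h_xx y (\<gamma> y z) / (h_x y (\<gamma> y z)) ^ 3) (at z)" (is ?zz)
proof -
  note \<gamma>' = inverse_family_derivatives[OF dy dx cx pos level c\<gamma>]
  have ne: "h_x y x \<noteq> 0" for y x using pos[of y x] by simp
  let ?P_y = "\<lambda>y x. - ((h_yy y x * h_x y x - h_y y x * h_xy y x) / (h_x y x * h_x y x))"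
  let ?P_x = "\<lambda>y x. - ((h_yx y x * h_x y x - h_y y x * h_xx y x) / (h_x y x * h_x y x))"
  have dPy: "((\<lambda>y. - R y x) has_real_derivative ?P_y y x) (at y)" for y x
    unfolding R_def by (rule DERIV_minus[OF DERIV_divide[OF dyy dxy ne]])
  have dPx: "((\<lambda>x. - R y x) has_real_derivative ?P_x y x) (at x)" for y x
    unfolding R_def by (rule DERIV_minus[OF DERIV_divide[OF dyx dxx ne]])
  have cPx: "continuous_on (UNIV \<times> UNIV) (\<lambda>(y,x). ?P_x y x)"
    unfolding split_def
    by (intro continuous_intros cy[unfolded split_def] cx[unfolded split_def]
        cyx[unfolded split_def] cxx[unfolded split_def] continuous_on_subset[OF _ subset_UNIV]) (auto simp: ne)
  from has_real_derivative_along[OF _ dPy dPx cPx \<gamma>'(1), of y z]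
  have *: "((\<lambda>y. - R y (\<gamma> y z)) has_real_derivative
      ?P_y y (\<gamma> y z) + ?P_x y (\<gamma> y z) * (- h_y y (\<gamma> y z) / h_x y (\<gamma> y z))) (at y)" by simp
  have alg: "- ((a * x - b * c) / (x * x)) + - ((d * x - b * e) / (x * x)) * (- b / x)
      = - (a - b / x * (c + d) + (b / x)\<^sup>2 * e) / x" if "x \<noteq> 0" for a b c d e x :: real
    using that by (simp add: divide_simps) (simp add: algebra_simps power2_eq_square power3_eq_cube)
  have alg2: "- ((d * x - b * e) / (x * x)) * (1 / x) = - (d - b / x * e) / x\<^sup>2" if "x \<noteq> 0" for b d e x :: real
    using that by (simp add: field_simps power2_eq_square)
  show ?yy
    using * unfolding R_def by (simp only: alg[OF ne])
  show ?yz
    unfolding R_def by (rule DERIV_cong[OF DERIV_chain2[OF dPx[unfolded R_def] \<gamma>'(2)] alg2[OF ne]])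
  show ?zz
    by (rule DERIV_cong[OF DERIV_chain2[OF DERIV_divide[OF DERIV_const dxx ne] \<gamma>'(2)]])
      (simp add: ne power3_eq_cube divide_simps)
qed

section \<open>An algebra of smooth functions\<close>

lemma smooth_beforeD:
  assumes "smooth_before T f"
  shows "jointly_continuous {0..<T} f"
    and "\<exists>f_y f_m f_t. smooth_before T f_y \<and> smooth_before T f_m \<and> smooth_before T f_t \<and>
      (\<forall>y m. \<forall>t\<in>{0..<T}. ((\<lambda>x. f x m t) has_real_derivative f_y y m t) (at y) \<and>
      ((\<lambda>x. f y x t) has_real_derivative f_m y m t) (at m) \<and>
      ((\<lambda>s. f y m s) has_real_derivative f_t y m t) (at t within {0..T}))"
proof (atomize (full), cases rule: smooth_before.cases[OF assms])
  case (1 f' f_y f_m f_t)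
  show "jointly_continuous {0..<T} f \<and>
    (\<exists>f_y f_m f_t. smooth_before T f_y \<and> smooth_before T f_m \<and> smooth_before T f_t \<and>
      (\<forall>y m. \<forall>t\<in>{0..<T}. ((\<lambda>x. f x m t) has_real_derivative f_y y m t) (at y) \<and>
      ((\<lambda>x. f y x t) has_real_derivative f_m y m t) (at m) \<and>
      ((\<lambda>s. f y m s) has_real_derivative f_t y m t) (at t within {0..T})))"
    unfolding 1(1) by (intro conjI exI[of _ f_y] exI[of _ f_m] exI[of _ f_t] 1(2-))
qed

definition C1_Lipschitz :: "(real \<Rightarrow> real) \<Rightarrow> (real \<Rightarrow> real) \<Rightarrow> bool" where
  "C1_Lipschitz \<phi> \<phi>' \<longleftrightarrow> (\<forall>z. (\<phi> has_real_derivative \<phi>' z) (at z)) \<and>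
     continuous_on UNIV \<phi>' \<and> (\<exists>B. \<forall>z. \<bar>\<phi>' z\<bar> \<le> B)"

lemma C1_Lipschitz_linear_growth:
  assumes "C1_Lipschitz \<phi> \<phi>'"
  shows "\<exists>B\<ge>0. \<forall>z. \<bar>\<phi> z\<bar> \<le> B * (1 + \<bar>z\<bar>) \<and> \<bar>\<phi>' z\<bar> \<le> B * (1 + \<bar>z\<bar>)"
proof -
  obtain B where B: "\<And>z. \<bar>\<phi>' z\<bar> \<le> B" using assms unfolding C1_Lipschitz_def by blast
  have B0: "B \<ge> 0" using B[of 0] by simp
  let ?B = "B + \<bar>\<phi> 0\<bar>"
  have "\<bar>\<phi> z\<bar> \<le> ?B * (1 + \<bar>z\<bar>)" "\<bar>\<phi>' z\<bar> \<le> ?B * (1 + \<bar>z\<bar>)" for z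
  proof -
    have "norm (\<phi> z - \<phi> 0) \<le> B * norm (z - 0)"
      by (rule field_differentiable_bound[of UNIV \<phi> \<phi>'])
        (use assms B in \<open>auto simp: C1_Lipschitz_def\<close>)
    then have "\<bar>\<phi> z\<bar> \<le> \<bar>\<phi> 0\<bar> + B * \<bar>z\<bar>" by simp
    also have "\<dots> \<le> ?B * (1 + \<bar>z\<bar>)" using B0 by (simp add: algebra_simps)
    finally show "\<bar>\<phi> z\<bar> \<le> ?B * (1 + \<bar>z\<bar>)" .
    have "\<bar>\<phi>' z\<bar> \<le> ?B * 1" using B[of z] by simp
    also have "\<dots> \<le> ?B * (1 + \<bar>z\<bar>)" using B0 by (intro mult_left_mono) auto
    finally show "\<bar>\<phi>' z\<bar> \<le> ?B * (1 + \<bar>z\<bar>)" .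
  qed
  then show ?thesis using B0 by (intro exI[of _ ?B]) auto
qed

lemma one_add_abs_le_exp: "1 + \<bar>x\<bar> \<le> exp \<bar>x\<bar>" for x :: real
  by (rule exp_ge_add_one_self)

text \<open>The setting for integrands \<open>A \<rho> * \<phi> (m + Q \<rho>)\<close>. The amplitudes \<open>A\<close> range over a class of bounded functions that
  is closed under differentiation and under division by \<open>Q'\<close>; this is what repeated integration by parts
  along the level function \<open>Q\<close> produces.\<close>

locale gaussian_level =
  fixes T :: real and Q Q' :: "real \<Rightarrow> real" and \<A> :: "(real \<Rightarrow> real) set"
  assumes T: "0 < T"
    and Q: "\<And>\<rho>. (Q has_real_derivative Q' \<rho>) (at \<rho>)" and Q_pos: "\<And>\<rho>. Q' \<rho> > 0"
    and Q'_mem: "Q' \<in> \<A>" and one_mem: "(\<lambda>\<rho>. 1) \<in> \<A>"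
    and mem_divide: "\<And>A. A \<in> \<A> \<Longrightarrow> (\<lambda>\<rho>. A \<rho> / Q' \<rho>) \<in> \<A>"
    and mem_bounded: "\<And>A. A \<in> \<A> \<Longrightarrow> \<exists>B. \<forall>\<rho>. \<bar>A \<rho>\<bar> \<le> B"
    and mem_deriv: "\<And>A. A \<in> \<A> \<Longrightarrow> \<exists>A'\<in>\<A>. \<forall>\<rho>. (A has_real_derivative A' \<rho>) (at \<rho>)"
begin

lemma mem_continuous: "A \<in> \<A> \<Longrightarrow> continuous_on UNIV A"
  by (meson DERIV_isCont continuous_at_imp_continuous_on mem_deriv)

lemma C1_Lipschitz_Q: "C1_Lipschitz Q Q'"
  using Q Q'_mem mem_bounded mem_continuous by (auto simp: C1_Lipschitz_def)

lemma tame_level: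
  assumes A: "A \<in> \<A>" and c: "continuous_on UNIV \<phi>" and B: "\<And>z. \<bar>\<phi> z\<bar> \<le> B * (1 + \<bar>z\<bar>)"
  shows "tame (\<lambda>m \<rho>. A \<rho> * \<phi> (m + Q \<rho>))"
  unfolding tame_def
proof (intro conjI allI)
  have cQ: "continuous_on UNIV Q"
    by (meson DERIV_isCont continuous_at_imp_continuous_on Q)
  have "continuous_on UNIV (\<lambda>p::real\<times>real. A (snd p))" "continuous_on UNIV (\<lambda>p::real\<times>real. Q (snd p))"
    by (rule continuous_on_compose2[OF mem_continuous[OF A]] continuous_on_compose2[OF cQ];
        simp add: continuous_on_snd continuous_on_id)+
  moreover from this have "continuous_on UNIV (\<lambda>p::real\<times>real. \<phi> (fst p + Q (snd p)))"
    by (intro continuous_on_compose2[OF c] continuous_intros) auto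
  ultimately show "continuous_on UNIV (\<lambda>(m,\<rho>). A \<rho> * \<phi> (m + Q \<rho>))"
    unfolding split_def by (intro continuous_intros)
  fix M :: real
  obtain a where a: "\<And>\<rho>. \<bar>A \<rho>\<bar> \<le> a" using mem_bounded[OF A] by blast
  obtain q where q: "q \<ge> 0" "\<And>\<rho>. \<bar>Q \<rho>\<bar> \<le> q * (1 + \<bar>\<rho>\<bar>)"
    using C1_Lipschitz_linear_growth[OF C1_Lipschitz_Q] by blast
  have a0: "a \<ge> 0" using a[of 0] by simp
  have B0: "B \<ge> 0" using B[of 0] by simp
  have "\<bar>A \<rho> * \<phi> (m + Q \<rho>)\<bar> \<le> a * (B * (1 + \<bar>M\<bar> + q)) * exp \<bar>\<rho>\<bar>" if m: "\<bar>m\<bar> \<le> M" for m \<rho>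
  proof -
    have "1 + \<bar>m + Q \<rho>\<bar> \<le> 1 + \<bar>M\<bar> + q * (1 + \<bar>\<rho>\<bar>)" using m q(2)[of \<rho>] by linarith
    also have "\<dots> \<le> (1 + \<bar>M\<bar>) * (1 + \<bar>\<rho>\<bar>) + q * (1 + \<bar>\<rho>\<bar>)"
      by (intro add_right_mono) (simp add: algebra_simps)
    also have "\<dots> = (1 + \<bar>M\<bar> + q) * (1 + \<bar>\<rho>\<bar>)" by (simp add: algebra_simps)
    also have "\<dots> \<le> (1 + \<bar>M\<bar> + q) * exp \<bar>\<rho>\<bar>"
      using q one_add_abs_le_exp by (intro mult_left_mono) auto
    finally have "B * (1 + \<bar>m + Q \<rho>\<bar>) \<le> B * ((1 + \<bar>M\<bar> + q) * exp \<bar>\<rho>\<bar>)"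
      using B0 by (rule mult_left_mono)
    with B have "\<bar>\<phi> (m + Q \<rho>)\<bar> \<le> B * ((1 + \<bar>M\<bar> + q) * exp \<bar>\<rho>\<bar>)" by (rule order_trans)
    then have "\<bar>A \<rho>\<bar> * \<bar>\<phi> (m + Q \<rho>)\<bar> \<le> a * (B * ((1 + \<bar>M\<bar> + q) * exp \<bar>\<rho>\<bar>))"
      using a a0 by (intro mult_mono) auto
    then show ?thesis by (simp add: abs_mult mult.assoc)
  qed
  then show "\<exists>D. \<forall>m \<rho>. \<bar>m\<bar> \<le> M \<longrightarrow> \<bar>A \<rho> * \<phi> (m + Q \<rho>)\<bar> \<le> D * exp \<bar>\<rho>\<bar>" by blast
qed

lemma tame_level_C1:
  assumes "A \<in> \<A>" "C1_Lipschitz \<phi> \<phi>'"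
  shows "tame (\<lambda>m \<rho>. A \<rho> * \<phi> (m + Q \<rho>))" "tame (\<lambda>m \<rho>. A \<rho> * \<phi>' (m + Q \<rho>))"
proof -
  obtain B where B: "\<And>z. \<bar>\<phi> z\<bar> \<le> B * (1 + \<bar>z\<bar>)" "\<And>z. \<bar>\<phi>' z\<bar> \<le> B * (1 + \<bar>z\<bar>)"
    using C1_Lipschitz_linear_growth[OF assms(2)] by blast
  have "continuous_on UNIV \<phi>" "continuous_on UNIV \<phi>'"
    using assms(2) unfolding C1_Lipschitz_def
    by (meson DERIV_isCont continuous_at_imp_continuous_on)+
  then show "tame (\<lambda>m \<rho>. A \<rho> * \<phi> (m + Q \<rho>))" "tame (\<lambda>m \<rho>. A \<rho> * \<phi>' (m + Q \<rho>))"
    using tame_level[OF assms(1)] B by blast+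
qed

abbreviation level_moment :: "nat \<Rightarrow> (real \<Rightarrow> real) \<Rightarrow> (real \<Rightarrow> real) \<Rightarrow> real \<Rightarrow> real \<Rightarrow> real \<Rightarrow> real" where
  "level_moment i A \<phi> \<equiv> gauss_moment T i (\<lambda>m \<rho>. A \<rho> * \<phi> (m + Q \<rho>))"

text \<open>The derivative in \<open>m\<close> falls on \<open>\<phi>\<close>, but \<open>\<phi>' (m + Q \<rho>)\<close> is \<open>1 / Q' \<rho>\<close> times a \<open>\<rho>\<close>-derivative,
  so that integration by parts gives a combination of moments that contain \<open>\<phi>\<close> alone.\<close>

lemma level_moment_deriv_m:
  assumes A: "A \<in> \<A>" and \<phi>: "C1_Lipschitz \<phi> \<phi>'" and t: "0 \<le> t" "t < T"
    and A1: "A1 = (\<lambda>\<rho>. A \<rho> / Q' \<rho>)" and A1': "A1' \<in> \<A>" "\<And>\<rho>. (A1 has_real_derivative A1' \<rho>) (at \<rho>)"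
  shows "((\<lambda>x. level_moment i A \<phi> y x t) has_real_derivative
      - real i * level_moment (i - 1) A1 \<phi> y m t + level_moment (i + 1) A1 \<phi> y m t / (T - t)
      - level_moment i A1' \<phi> y m t) (at m)"
proof -
  have A1_mem: "A1 \<in> \<A>" using mem_divide[OF A] by (simp add: A1)
  note tm = tame_level_C1[OF A \<phi>] tame_level_C1(1)[OF A1_mem \<phi>] tame_level_C1(1)[OF A1'(1) \<phi>]
  let ?\<eta>' = "\<lambda>m \<rho>. A1' \<rho> * \<phi> (m + Q \<rho>) + A \<rho> * \<phi>' (m + Q \<rho>)"
  have "tame ?\<eta>'"
    unfolding tame_def
  proof (intro conjI allI)
    show "continuous_on UNIV (\<lambda>(m,\<rho>). ?\<eta>' m \<rho>)"
      using tm(2,4) unfolding tame_def split_def by (intro continuous_on_add) auto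
    fix M
    obtain D1 D2 where D: "\<And>m \<rho>. \<bar>m\<bar> \<le> M \<Longrightarrow> \<bar>A1' \<rho> * \<phi> (m + Q \<rho>)\<bar> \<le> D1 * exp \<bar>\<rho>\<bar>"
      "\<And>m \<rho>. \<bar>m\<bar> \<le> M \<Longrightarrow> \<bar>A \<rho> * \<phi>' (m + Q \<rho>)\<bar> \<le> D2 * exp \<bar>\<rho>\<bar>"
      using tm(2,4) unfolding tame_def by meson
    have "\<bar>?\<eta>' m \<rho>\<bar> \<le> (D1 + D2) * exp \<bar>\<rho>\<bar>" if "\<bar>m\<bar> \<le> M" for m \<rho>
      using D(1)[OF that, of \<rho>] D(2)[OF that, of \<rho>] by (simp add: distrib_right)
    then show "\<exists>D. \<forall>m \<rho>. \<bar>m\<bar> \<le> M \<longrightarrow> \<bar>?\<eta>' m \<rho>\<bar> \<le> D * exp \<bar>\<rho>\<bar>" by blast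
  qed
  have d\<phi>: "(\<phi> has_real_derivative \<phi>' z) (at z)" for z using \<phi> by (simp add: C1_Lipschitz_def)
  have d\<phi>Q: "((\<lambda>\<rho>. \<phi> (m + Q \<rho>)) has_real_derivative \<phi>' (m + Q \<rho>) * Q' \<rho>) (at \<rho>)" for \<rho>
    by (rule DERIV_chain2[OF d\<phi>]) (auto intro!: derivative_eq_intros Q)
  have "gauss_moment T i ?\<eta>' y m t = - real i * level_moment (i - 1) A1 \<phi> y m t
      + level_moment (i + 1) A1 \<phi> y m t / (T - t)"
  proof (rule gauss_moment_by_parts[OF tm(3) \<open>tame ?\<eta>'\<close> t])
    fix \<rho>
    show "((\<lambda>\<rho>. A1 \<rho> * \<phi> (m + Q \<rho>)) has_real_derivative ?\<eta>' m \<rho>) (at \<rho>)"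
      by (rule DERIV_cong[OF DERIV_mult[OF A1'(2) d\<phi>Q]])
        (use Q_pos[of \<rho>] in \<open>simp add: A1\<close>)
  qed
  moreover have "gauss_moment T i ?\<eta>' y m t = level_moment i A1' \<phi> y m t + level_moment i A \<phi>' y m t"
  proof -
    have eq: "gauss_integrand T i ?\<eta>' y m t = (\<lambda>\<rho>. gauss_integrand T i (\<lambda>m \<rho>. A1' \<rho> * \<phi> (m + Q \<rho>)) y m t \<rho>
        + gauss_integrand T i (\<lambda>m \<rho>. A \<rho> * \<phi>' (m + Q \<rho>)) y m t \<rho>)"
      by (rule ext) (simp add: gauss_integrand_def distrib_left)
    show ?thesis
      unfolding gauss_moment_def eq using integrable_gauss_integrand[OF tm(4) t] integrable_gauss_integrand[OF tm(2) t]
      by simp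
  qed
  moreover have "((\<lambda>x. level_moment i A \<phi> y x t) has_real_derivative level_moment i A \<phi>' y m t) (at m)"
  proof (rule gauss_moment_deriv_parameter[OF tm(1,2) t])
    fix x \<rho>
    have "((\<lambda>x. \<phi> (x + Q \<rho>)) has_real_derivative \<phi>' (x + Q \<rho>)) (at x)"
      using d\<phi>[of "x + Q \<rho>"] by (simp add: DERIV_shift)
    then show "((\<lambda>x. A \<rho> * \<phi> (x + Q \<rho>)) has_real_derivative A \<rho> * \<phi>' (x + Q \<rho>)) (at x)"
      by (rule DERIV_cmult)
  qed
  ultimately show ?thesis
    by - (erule DERIV_cong, linarith)
qed

text \<open>An algebra of functions on \<open>\<real> \<times> \<real> \<times> [0,T)\<close>, generated by the level moments, that is closed under
  partial derivatives. It also contains reciprocals of nonvanishing members, as the derivatives of inverse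
  functions require.\<close>

inductive smooth_alg :: "(real \<Rightarrow> real \<Rightarrow> real \<Rightarrow> real) \<Rightarrow> bool" where
  const: "smooth_alg (\<lambda>y m t. r)"
| param: "smooth_alg (\<lambda>y m t. m)"
| scale: "smooth_alg (\<lambda>y m t. 1 / sqrt (T - t))"
| moment: "A \<in> \<A> \<Longrightarrow> C1_Lipschitz \<phi> \<phi>' \<Longrightarrow> smooth_alg (level_moment i A \<phi>)"
| add: "smooth_alg f \<Longrightarrow> smooth_alg g \<Longrightarrow> smooth_alg (\<lambda>y m t. f y m t + g y m t)"
| mult: "smooth_alg f \<Longrightarrow> smooth_alg g \<Longrightarrow> smooth_alg (\<lambda>y m t. f y m t * g y m t)"
| inverse: "smooth_alg f \<Longrightarrow> (\<And>y m t. 0 \<le> t \<Longrightarrow> t < T \<Longrightarrow> f y m t \<noteq> 0) \<Longrightarrow>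
    smooth_alg (\<lambda>y m t. inverse (f y m t))"

text \<open>Times before \<open>T\<close> only: the generator \<open>1 / sqrt (T - t)\<close> is singular at \<open>T\<close>.\<close>

definition derivs ::
    "(real \<Rightarrow> real \<Rightarrow> real \<Rightarrow> real) \<Rightarrow> (real \<Rightarrow> real \<Rightarrow> real \<Rightarrow> real) \<Rightarrow> (real \<Rightarrow> real \<Rightarrow> real \<Rightarrow> real) \<Rightarrow>
     (real \<Rightarrow> real \<Rightarrow> real \<Rightarrow> real) \<Rightarrow> bool" where
  "derivs f f_y f_m f_t \<longleftrightarrow> (\<forall>y m t. 0 \<le> t \<longrightarrow> t < T \<longrightarrow>
     ((\<lambda>x. f x m t) has_real_derivative f_y y m t) (at y) \<and>
     ((\<lambda>x. f y x t) has_real_derivative f_m y m t) (at m) \<and>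
     ((\<lambda>s. f y m s) has_real_derivative f_t y m t) (at t within {0..T}))"

lemma smooth_alg_diff: "smooth_alg f \<Longrightarrow> smooth_alg g \<Longrightarrow> smooth_alg (\<lambda>y m t. f y m t - g y m t)"
  using add[OF _ mult[OF const[of "-1"]], of f g] by simp

lemma smooth_alg_divide:
  assumes "smooth_alg f" "smooth_alg g" "\<And>y m t. 0 \<le> t \<Longrightarrow> t < T \<Longrightarrow> g y m t \<noteq> 0"
  shows "smooth_alg (\<lambda>y m t. f y m t / g y m t)"
  using mult[OF assms(1) inverse[OF assms(2,3)]] by (simp add: divide_inverse)

lemma derivs_moment:
  assumes A: "A \<in> \<A>" and \<phi>: "C1_Lipschitz \<phi> \<phi>'"
  shows "\<exists>f_y f_m f_t. smooth_alg f_y \<and> smooth_alg f_m \<and> smooth_alg f_t \<and>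
    derivs (level_moment i A \<phi>) f_y f_m f_t"
proof -
  let ?s = "\<lambda>y m t. 1 / sqrt (T - t)"
  let ?s2 = "\<lambda>y m t. ?s y m t * ?s y m t"
  have s2: "smooth_alg ?s2" by (intro mult scale)
  define A1 where "A1 = (\<lambda>\<rho>. A \<rho> / Q' \<rho>)"
  have A1: "A1 \<in> \<A>" using mem_divide[OF A] by (simp add: A1_def)
  obtain A1' where A1': "A1' \<in> \<A>" "\<And>\<rho>. (A1 has_real_derivative A1' \<rho>) (at \<rho>)"
    using mem_deriv[OF A1] by blast
  note tm = tame_level_C1(1)[OF A \<phi>]
  let ?f_y = "\<lambda>y m t. (- real i) * level_moment (i - 1) A \<phi> y m t + level_moment (i + 1) A \<phi> y m t * ?s2 y m t"
  let ?f_m = "\<lambda>y m t. ((- real i) * level_moment (i - 1) A1 \<phi> y m t + level_moment (i + 1) A1 \<phi> y m t * ?s2 y m t)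
      - level_moment i A1' \<phi> y m t"
  let ?f_t = "\<lambda>y m t. (- 1 / 2) * (level_moment (i + 2) A \<phi> y m t * (?s2 y m t * ?s2 y m t))"
  have mom: "smooth_alg (level_moment j B \<phi>)" if "B \<in> \<A>" for j B
    by (rule moment[OF that \<phi>])
  have y: "smooth_alg (\<lambda>y m t. (- real i) * level_moment (i - 1) B \<phi> y m t + level_moment (i + 1) B \<phi> y m t * ?s2 y m t)"
    if "B \<in> \<A>" for B
    by (rule add[OF mult[OF const mom] mult[OF mom s2]]; rule that)
  have "smooth_alg ?f_y" "smooth_alg ?f_m" "smooth_alg ?f_t"
    subgoal by (rule y[OF A])
    subgoal by (rule smooth_alg_diff[OF y[OF A1] mom[OF A1'(1)]])
    subgoal by (rule mult[OF const mult[OF mom[OF A] mult[OF s2 s2]]])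
    done
  moreover have "derivs (level_moment i A \<phi>) ?f_y ?f_m ?f_t"
    unfolding derivs_def
  proof (intro allI impI conjI)
    fix y m t assume t: "0 \<le> t" "t < T"
    have s: "X * ?s2 y m t = X / (T - t)" for X using t by simp
    have s4: "X * (?s2 y m t * ?s2 y m t) = X / (T - t)\<^sup>2" for X using t by (simp add: power2_eq_square)
    show "((\<lambda>x. level_moment i A \<phi> x m t) has_real_derivative ?f_y y m t) (at y)"
      using gauss_moment_deriv_y[OF tm t] by (simp only: s)
    show "((\<lambda>x. level_moment i A \<phi> y x t) has_real_derivative ?f_m y m t) (at m)"
      using level_moment_deriv_m[OF A \<phi> t A1_def A1'] by (simp only: s)
    show "((\<lambda>s. level_moment i A \<phi> y m s) has_real_derivative ?f_t y m t) (at t within {0..T})"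
      unfolding s4 by (rule DERIV_cong[OF gauss_moment_deriv_t[OF tm t]]) simp
  qed
  ultimately show ?thesis by blast
qed

definition closed_under_derivs :: "(real \<Rightarrow> real \<Rightarrow> real \<Rightarrow> real) \<Rightarrow> bool" where
  "closed_under_derivs f \<longleftrightarrow> jointly_continuous {0..<T} f \<and>
    (\<exists>f_y f_m f_t. smooth_alg f_y \<and> smooth_alg f_m \<and> smooth_alg f_t \<and> derivs f f_y f_m f_t)"

lemma closed_under_derivsI:
  assumes "jointly_continuous {0..<T} f"
    "derivs f f_y f_m f_t" "smooth_alg f_y" "smooth_alg f_m" "smooth_alg f_t"
  shows "closed_under_derivs f"
  unfolding closed_under_derivs_def
  by (intro conjI exI[of _ f_y] exI[of _ f_m] exI[of _ f_t] assms)

lemma closed_under_derivsE: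
  assumes "closed_under_derivs f"
  obtains f_y f_m f_t where "smooth_alg f_y" "smooth_alg f_m" "smooth_alg f_t" "derivs f f_y f_m f_t"
  using assms unfolding closed_under_derivs_def by (elim conjE exE)

text \<open>Induction over the generation of the algebra: sums, products and reciprocals follow the usual rules, and
  moments are differentiated by \<open>derivs_moment\<close>.\<close>

lemma smooth_alg_derivs: "smooth_alg f \<Longrightarrow> closed_under_derivs f"
proof (induction rule: smooth_alg.induct)
  case (const r)
  show ?case
    by (rule closed_under_derivsI[of _ "\<lambda>y m t. 0" "\<lambda>y m t. 0" "\<lambda>y m t. 0"])
      (auto simp: derivs_def intro: smooth_alg.const)
next
  case param
  show ?case
    by (rule closed_under_derivsI[of _ "\<lambda>y m t. 0" "\<lambda>y m t. 1" "\<lambda>y m t. 0"])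
      (auto simp: derivs_def split_def intro!: continuous_intros intro: smooth_alg.const)
next
  case scale
  let ?s = "\<lambda>y m t. 1 / sqrt (T - t)"
  show ?case
  proof (rule closed_under_derivsI)
    show "derivs ?s (\<lambda>y m t. 0) (\<lambda>y m t. 0) (\<lambda>y m t. (1/2) * (?s y m t * (?s y m t * ?s y m t)))"
      unfolding derivs_def by (auto intro!: derivative_eq_intros simp: divide_simps)
    show "continuous_on (UNIV \<times> UNIV \<times> {0..<T}) (\<lambda>(y,m,t). ?s y m t)"
      unfolding split_def by (intro continuous_intros) auto
    show "smooth_alg (\<lambda>y m t. (1/2) * (?s y m t * (?s y m t * ?s y m t)))"
      by (rule mult[OF smooth_alg.const mult[OF smooth_alg.scale mult[OF smooth_alg.scale smooth_alg.scale]]])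
  qed (rule smooth_alg.const)+
next
  case (moment A \<phi> \<phi>' i)
  then show ?case
    unfolding closed_under_derivs_def
    using derivs_moment continuous_on_gauss_moment[OF tame_level_C1(1) T] by fast
next
  case (add f g)
  from add.IH(1) obtain f_y f_m f_t where f: "smooth_alg f_y" "smooth_alg f_m" "smooth_alg f_t" "derivs f f_y f_m f_t"
    by (rule closed_under_derivsE)
  from add.IH(2) obtain g_y g_m g_t where g: "smooth_alg g_y" "smooth_alg g_m" "smooth_alg g_t" "derivs g g_y g_m g_t"
    by (rule closed_under_derivsE)
  show ?case
  proof (rule closed_under_derivsI)
    show "derivs (\<lambda>y m t. f y m t + g y m t) (\<lambda>y m t. f_y y m t + g_y y m t)
      (\<lambda>y m t. f_m y m t + g_m y m t) (\<lambda>y m t. f_t y m t + g_t y m t)"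
      using f(4) g(4) by (auto simp: derivs_def intro!: derivative_intros)
    show "continuous_on (UNIV \<times> UNIV \<times> {0..<T}) (\<lambda>(y,m,t). f y m t + g y m t)"
      using add.IH unfolding split_def closed_under_derivs_def by (intro continuous_on_add) auto
  qed (rule smooth_alg.add; fact)+
next
  case (mult f g)
  from mult.IH(1) obtain f_y f_m f_t where f: "smooth_alg f_y" "smooth_alg f_m" "smooth_alg f_t" "derivs f f_y f_m f_t"
    by (rule closed_under_derivsE)
  from mult.IH(2) obtain g_y g_m g_t where g: "smooth_alg g_y" "smooth_alg g_m" "smooth_alg g_t" "derivs g g_y g_m g_t"
    by (rule closed_under_derivsE)
  show ?case
  proof (rule closed_under_derivsI)
    show "derivs (\<lambda>y m t. f y m t * g y m t) (\<lambda>y m t. f_y y m t * g y m t + g_y y m t * f y m t)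
        (\<lambda>y m t. f_m y m t * g y m t + g_m y m t * f y m t)
        (\<lambda>y m t. f_t y m t * g y m t + g_t y m t * f y m t)"
      unfolding derivs_def
    proof (intro allI impI conjI)
      fix y m t assume t: "0 \<le> t" "t < T"
      note df = f(4)[unfolded derivs_def, rule_format, OF t, of m y]
      note dg = g(4)[unfolded derivs_def, rule_format, OF t, of m y]
      show "((\<lambda>x. f x m t * g x m t) has_real_derivative f_y y m t * g y m t + g_y y m t * f y m t) (at y)"
        by (rule DERIV_mult) (use df dg in blast)+
      show "((\<lambda>x. f y x t * g y x t) has_real_derivative f_m y m t * g y m t + g_m y m t * f y m t) (at m)"
        by (rule DERIV_mult) (use df dg in blast)+
      show "((\<lambda>s. f y m s * g y m s) has_real_derivative f_t y m t * g y m t + g_t y m t * f y m t) (at t within {0..T})"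
        by (rule DERIV_mult) (use df dg in blast)+
    qed
    show "continuous_on (UNIV \<times> UNIV \<times> {0..<T}) (\<lambda>(y,m,t). f y m t * g y m t)"
      using mult.IH unfolding split_def closed_under_derivs_def by (intro continuous_on_mult) auto
  qed (rule smooth_alg.add[OF smooth_alg.mult smooth_alg.mult]; fact)+
next
  case (inverse f)
  from inverse.IH obtain f_y f_m f_t where *:
    "smooth_alg f_y" "smooth_alg f_m" "smooth_alg f_t" "derivs f f_y f_m f_t"
    by (rule closed_under_derivsE)
  let ?d = "\<lambda>g y m t. (- 1) * (inverse (f y m t) * (g y m t * inverse (f y m t)))"
  have inv: "smooth_alg (\<lambda>y m t. inverse (f y m t))"
    by (rule smooth_alg.inverse[OF inverse.hyps])
  show ?case
  proof (rule closed_under_derivsI)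
    show "derivs (\<lambda>y m t. inverse (f y m t)) (?d f_y) (?d f_m) (?d f_t)"
      unfolding derivs_def
    proof (intro allI impI conjI)
      fix y m t assume t: "0 \<le> t" "t < T"
      note d = *(4)[unfolded derivs_def, rule_format, OF t, of m y] inverse.hyps(2)[OF t, of y m]
      show "((\<lambda>x. inverse (f x m t)) has_real_derivative ?d f_y y m t) (at y)"
        by (rule DERIV_cong[OF DERIV_inverse'[where f = "\<lambda>x. f x m t", OF conjunct1[OF d(1)] d(2)]]) simp
      show "((\<lambda>x. inverse (f y x t)) has_real_derivative ?d f_m y m t) (at m)"
        by (rule DERIV_cong[OF DERIV_inverse'[where f = "\<lambda>x. f y x t", OF conjunct1[OF conjunct2[OF d(1)]] d(2)]]) simp
      show "((\<lambda>s. inverse (f y m s)) has_real_derivative ?d f_t y m t) (at t within {0..T})"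
        by (rule DERIV_cong[OF DERIV_inverse'[where f = "\<lambda>s. f y m s", OF conjunct2[OF conjunct2[OF d(1)]] d(2)]]) simp
    qed
    show "smooth_alg (?d f_y)" "smooth_alg (?d f_m)" "smooth_alg (?d f_t)"
      by (rule smooth_alg.mult[OF smooth_alg.const smooth_alg.mult[OF inv smooth_alg.mult[OF _ inv]]], fact)+
    show "continuous_on (UNIV \<times> UNIV \<times> {0..<T}) (\<lambda>(y,m,t). inverse (f y m t))"
      using inverse.IH inverse.hyps(2) unfolding split_def closed_under_derivs_def
      by (intro continuous_on_inverse) auto
  qed
qed

end

lemma continuous_on_slice_space:
  assumes "jointly_continuous S f" "t \<in> S"
  shows "continuous_on UNIV (\<lambda>(y,m). f y m t)"
proof -
  have "continuous_on UNIV (\<lambda>p. (fst p, snd p, t))" by (intro continuous_intros)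
  from continuous_on_compose2[OF assms(1) this] assms(2) show ?thesis by (simp add: split_def image_subset_iff)
qed

lemma continuous_on_slice_time:
  assumes "jointly_continuous S f"
  shows "continuous_on (S \<times> UNIV) (\<lambda>(t,m). f y m t)"
proof -
  have "continuous_on (S \<times> UNIV) (\<lambda>p. (y, snd p, fst p))" by (intro continuous_intros)
  from continuous_on_compose2[OF assms(1) this] show ?thesis by (simp add: split_def image_subset_iff)
qed

lemma continuous_on_compose_level:
  assumes "jointly_continuous S \<Phi>"
    and "jointly_continuous S G"
  shows "continuous_on (UNIV \<times> UNIV \<times> S) (\<lambda>(y,m,t). \<Phi> y (G y m t) t)"
proof -
  have "continuous_on (UNIV \<times> UNIV \<times> S) (\<lambda>p. (fst p, G (fst p) (fst (snd p)) (snd (snd p)), snd (snd p)))"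
    using assms(2) unfolding split_def by (intro continuous_intros)
  from continuous_on_compose2[OF assms(1) this] show ?thesis by (simp add: split_def image_subset_iff)
qed

lemma jointly_continuous_inverse:
  assumes ch: "jointly_continuous S h" and "\<And>y t. t \<in> S \<Longrightarrow> strict_mono (\<lambda>x. h y x t)"
    and "\<And>y z t. t \<in> S \<Longrightarrow> h y (\<gamma> y z t) t = z"
  shows "jointly_continuous S \<gamma>"
proof -
  have "continuous_on ((UNIV \<times> S) \<times> UNIV) (\<lambda>(p,m). \<gamma> (fst p) m (snd p))"
  proof (rule continuous_on_inverse_family[where h = "\<lambda>p x. h (fst p) x (snd p)"])
    have "continuous_on ((UNIV \<times> S) \<times> UNIV) (\<lambda>p. (fst (fst p), snd p, snd (fst p)))"
      by (intro continuous_intros)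
    from continuous_on_compose2[OF ch this]
    show "continuous_on ((UNIV \<times> S) \<times> UNIV) (\<lambda>(p,x). h (fst p) x (snd p))"
      by (simp add: split_def image_subset_iff)
  qed (use assms in auto)
  moreover have "continuous_on (UNIV \<times> UNIV \<times> S) (\<lambda>p. ((fst p, snd (snd p)), fst (snd p)))"
    by (intro continuous_intros)
  ultimately show ?thesis
    using continuous_on_compose2[of "(UNIV \<times> S) \<times> UNIV" "\<lambda>(p,m). \<gamma> (fst p) m (snd p)"
        "UNIV \<times> UNIV \<times> S" "\<lambda>p. ((fst p, snd (snd p)), fst (snd p))"]
    by (simp add: split_def image_subset_iff)
qed

lemma at_within_half_open: "at t within {0..T} = at t within {0..<T}" if "t < T" for t T :: real
  by (rule at_within_nhd[of _ "{..<T}"]) (use that in auto)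

lemma has_real_derivative_transform:
  fixes f g :: "real \<Rightarrow> real"
  assumes "(f has_real_derivative D) (at x within S)" "x \<in> S" "\<And>x. x \<in> S \<Longrightarrow> g x = f x"
  shows "(g has_real_derivative D) (at x within S)"
  using assms has_derivative_transform unfolding has_field_derivative_def by blast

context gaussian_level
begin

lemma derivsD:
  assumes "derivs f f_y f_m f_t" "0 \<le> t" "t < T"
  shows "((\<lambda>x. f x m t) has_real_derivative f_y y m t) (at y)"
    "((\<lambda>x. f y x t) has_real_derivative f_m y m t) (at m)"
    "((\<lambda>s. f y m s) has_real_derivative f_t y m t) (at t within {0..T})"
  using assms unfolding derivs_def by blast+

text \<open>A smooth function of \<open>(y, G y m t, t)\<close>, where \<open>G\<close> inverts \<open>g\<close> in the middle argument, has
  derivatives of the same kind, because those of \<open>G\<close> are quotients of derivatives of \<open>g\<close> at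
  \<open>(y, G y m t, t)\<close>. So all such functions are smooth by coinduction.\<close>

theorem smooth_before_level_inverse:
  assumes dg: "derivs g g_y g_x g_t" and sg: "smooth_alg g_y" "smooth_alg g_x" "smooth_alg g_t"
    and pos: "\<And>y x t. 0 \<le> t \<Longrightarrow> t < T \<Longrightarrow> g_x y x t > 0"
    and level: "\<And>y z t. 0 \<le> t \<Longrightarrow> t < T \<Longrightarrow> g y (G y z t) t = z"
    and cG: "jointly_continuous {0..<T} G"
    and \<Phi>: "smooth_alg \<Phi>" and f: "\<And>y m t. 0 \<le> t \<Longrightarrow> t < T \<Longrightarrow> f y m t = \<Phi> y (G y m t) t"
  shows "smooth_before T f"
proof -
  have ne: "g_x y x t \<noteq> 0" if "0 \<le> t" "t < T" for y x t
    using pos[OF that, of y x] by simp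
  have cgx: "jointly_continuous {0..<T} g_x"
    using smooth_alg_derivs[OF sg(2)] by (simp add: closed_under_derivs_def)
  have cGt: "continuous_on {0..<T} (G y z)" for y z
  proof -
    have "continuous_on {0..<T} (\<lambda>s. (s, z))" by (intro continuous_intros)
    from continuous_on_compose2[OF continuous_on_slice_time[OF cG] this] show ?thesis by auto
  qed
  have Gy: "((\<lambda>y. G y z t) has_real_derivative - g_y y (G y z t) t / g_x y (G y z t) t) (at y)"
    and Gz: "((\<lambda>z. G y z t) has_real_derivative 1 / g_x y (G y z t) t) (at z)"
    if t: "0 \<le> t" "t < T" for y z t
    by (rule inverse_family_derivatives[where h = "\<lambda>y x. g y x t" and h_y = "\<lambda>y x. g_y y x t" and h_x = "\<lambda>y x. g_x y x t"],
        use t derivsD[OF dg t] pos level continuous_on_slice_space[OF cgx] continuous_on_slice_space[OF cG] in auto)+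
  have Gt: "(G y z has_real_derivative - g_t y (G y z t) t / g_x y (G y z t) t) (at t within {0..<T})"
    if t: "0 \<le> t" "t < T" for y z t
    by (rule has_real_derivative_implicit[where h = "\<lambda>s x. g y x s" and hx = "\<lambda>s x. g_x y x s" and z = z])
      (use t derivsD[OF dg] pos level continuous_on_slice_time[OF cgx] cGt in
        \<open>auto simp: at_within_half_open[symmetric]\<close>)
  define X where "X f \<longleftrightarrow> (\<exists>\<Phi>. smooth_alg \<Phi> \<and> (\<forall>y m t. 0 \<le> t \<longrightarrow> t < T \<longrightarrow> f y m t = \<Phi> y (G y m t) t))" for f
  have "X f" using \<Phi> f by (auto simp: X_def)
  then show ?thesis
  proof (coinduction arbitrary: f)
    case smooth_before
    then obtain \<Phi> where \<Phi>: "smooth_alg \<Phi>" and f: "\<And>y m t. 0 \<le> t \<Longrightarrow> t < T \<Longrightarrow> f y m t = \<Phi> y (G y m t) t"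
      by (auto simp: X_def)
    from smooth_alg_derivs[OF \<Phi>] obtain \<Phi>_y \<Phi>_x \<Phi>_t where
      s\<Phi>: "smooth_alg \<Phi>_y" "smooth_alg \<Phi>_x" "smooth_alg \<Phi>_t" and d\<Phi>: "derivs \<Phi> \<Phi>_y \<Phi>_x \<Phi>_t"
      by (rule closed_under_derivsE)
    have c\<Phi>: "jointly_continuous {0..<T} \<Phi>"
      and c\<Phi>x: "jointly_continuous {0..<T} \<Phi>_x"
      using smooth_alg_derivs[OF \<Phi>] smooth_alg_derivs[OF s\<Phi>(2)] by (simp_all add: closed_under_derivs_def)
    define P_y where "P_y = (\<lambda>y x t. \<Phi>_y y x t - \<Phi>_x y x t * (g_y y x t / g_x y x t))"
    define P_m where "P_m = (\<lambda>y x t. \<Phi>_x y x t / g_x y x t)"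
    define P_t where "P_t = (\<lambda>y x t. \<Phi>_t y x t - \<Phi>_x y x t * (g_t y x t / g_x y x t))"
    have P: "smooth_alg P_y" "smooth_alg P_m" "smooth_alg P_t"
      unfolding P_y_def P_m_def P_t_def
      subgoal by (rule smooth_alg_diff[OF s\<Phi>(1) mult[OF s\<Phi>(2) smooth_alg_divide[OF sg(1,2) ne]]])
      subgoal by (rule smooth_alg_divide[OF s\<Phi>(2) sg(2) ne])
      subgoal by (rule smooth_alg_diff[OF s\<Phi>(3) mult[OF s\<Phi>(2) smooth_alg_divide[OF sg(3,2) ne]]])
      done
    have "jointly_continuous {0..<T} f"
    proof -
      have "(\<lambda>(y,m,t). f y m t) p = (\<lambda>(y,m,t). \<Phi> y (G y m t) t) p" if "p \<in> UNIV \<times> UNIV \<times> {0..<T}" for p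
        using that f by auto
      with continuous_on_compose_level[OF c\<Phi> cG] show ?thesis
        by (subst continuous_on_cong[OF refl]) auto
    qed
    moreover have "((\<lambda>x. f x m t) has_real_derivative P_y y (G y m t) t) (at y) \<and>
      ((\<lambda>x. f y x t) has_real_derivative P_m y (G y m t) t) (at m) \<and>
      ((\<lambda>s. f y m s) has_real_derivative P_t y (G y m t) t) (at t within {0..T})"
      if t: "0 \<le> t" "t < T" for y m t
    proof (intro conjI)
      note d = derivsD[OF d\<Phi> t]
      have "((\<lambda>y. \<Phi> y (G y m t) t) has_real_derivative
          \<Phi>_y y (G y m t) t + \<Phi>_x y (G y m t) t * (- g_y y (G y m t) t / g_x y (G y m t) t)) (at y)"
        by (rule has_real_derivative_along[where \<Phi> = "\<lambda>y x. \<Phi> y x t" and \<Phi>x = "\<lambda>y x. \<Phi>_x y x t" and S = UNIV])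
          (use d Gy[OF t] continuous_on_slice_space[OF c\<Phi>x] t in auto)
      then show "((\<lambda>x. f x m t) has_real_derivative P_y y (G y m t) t) (at y)"
        by (simp add: f t P_y_def)
      have "((\<lambda>z. \<Phi> y (G y z t) t) has_real_derivative \<Phi>_x y (G y m t) t * (1 / g_x y (G y m t) t)) (at m)"
        by (rule DERIV_chain2[OF d(2) Gz[OF t]])
      then show "((\<lambda>x. f y x t) has_real_derivative P_m y (G y m t) t) (at m)"
        by (simp add: f t P_m_def)
      have "((\<lambda>s. \<Phi> y (G y m s) s) has_real_derivative
          \<Phi>_t y (G y m t) t + \<Phi>_x y (G y m t) t * (- g_t y (G y m t) t / g_x y (G y m t) t)) (at t within {0..<T})"
        by (rule has_real_derivative_along[where \<Phi> = "\<lambda>s x. \<Phi> y x s" and \<Phi>x = "\<lambda>s x. \<Phi>_x y x s"])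
          (use t derivsD[OF d\<Phi>] Gt[OF t] continuous_on_slice_time[OF c\<Phi>x] in
            \<open>auto simp: at_within_half_open[symmetric]\<close>)
      then have "((\<lambda>s. f y m s) has_real_derivative
          \<Phi>_t y (G y m t) t + \<Phi>_x y (G y m t) t * (- g_t y (G y m t) t / g_x y (G y m t) t)) (at t within {0..<T})"
        by (rule has_real_derivative_transform) (use t f in auto)
      then show "((\<lambda>s. f y m s) has_real_derivative P_t y (G y m t) t) (at t within {0..T})"
        by (simp add: P_t_def at_within_half_open[OF t(2)])
    qed
    moreover have "X (\<lambda>y m t. P y (G y m t) t)" if "smooth_alg P" for P
      using that by (auto simp: X_def)
    ultimately show ?case
      using P
      by (intro exI[of _ f] exI[of _ "\<lambda>y m t. P_y y (G y m t) t"]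
          exI[of _ "\<lambda>y m t. P_m y (G y m t) t"] exI[of _ "\<lambda>y m t. P_t y (G y m t) t"]) auto
  qed
qed

end

section \<open>The mean as a function of the measure\<close>

text \<open>The variance is nonnegative.\<close>

lemma (in prob_space) square_integral_le:
  fixes X :: "'a \<Rightarrow> real"
  assumes X: "X \<in> borel_measurable M" and X2: "integrable M (\<lambda>\<omega>. (X \<omega>)\<^sup>2)"
  shows "integrable M X" and "(\<integral>\<omega>. X \<omega> \<partial>M)\<^sup>2 \<le> (\<integral>\<omega>. (X \<omega>)\<^sup>2 \<partial>M)"
proof -
  have "\<bar>x\<bar> \<le> 1 + x\<^sup>2" for x :: real
  proof -
    have "0 \<le> (\<bar>x\<bar> - 1)\<^sup>2" by simp
    then have "2 * \<bar>x\<bar> \<le> 1 + x\<^sup>2" by (simp add: power2_diff)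
    then show ?thesis by simp
  qed
  then have "AE \<omega> in M. norm (X \<omega>) \<le> norm (1 + (X \<omega>)\<^sup>2)" by simp
  then show i: "integrable M X"
    by (rule Bochner_Integration.integrable_bound[rotated 2]) (use X X2 in auto)
  let ?c = "\<integral>\<omega>. X \<omega> \<partial>M"
  have "0 \<le> (\<integral>\<omega>. (X \<omega> - ?c)\<^sup>2 \<partial>M)" by simp
  also have "\<dots> = (\<integral>\<omega>. (X \<omega>)\<^sup>2 - 2 * ?c * X \<omega> + ?c\<^sup>2 \<partial>M)"
    by (simp add: power2_diff algebra_simps)
  also have "\<dots> = (\<integral>\<omega>. (X \<omega>)\<^sup>2 \<partial>M) - 2 * ?c * ?c + ?c\<^sup>2"
    using i X2 by (simp add: prob_space)
  finally show "?c\<^sup>2 \<le> (\<integral>\<omega>. (X \<omega>)\<^sup>2 \<partial>M)" by (simp add: power2_eq_square)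
qed

lemma prob_space_unit_space: "prob_space unit_space"
  by (auto simp: unit_space_def space_restrict_space emeasure_restrict_space intro!: prob_spaceI)

interpretation unit_space: prob_space unit_space by (rule prob_space_unit_space)

lemma L2_space_measurable: "X \<in> L2_space \<Longrightarrow> X \<in> borel_measurable unit_space"
  and L2_space_square: "X \<in> L2_space \<Longrightarrow> integrable unit_space (\<lambda>\<omega>. (X \<omega>)\<^sup>2)"
  by (auto simp: L2_space_def)

lemma L2_space_integrable: "X \<in> L2_space \<Longrightarrow> integrable unit_space X"
  by (rule unit_space.square_integral_le) (auto simp: L2_space_def)

lemma abs_integral_le_L2_norm: "X \<in> L2_space \<Longrightarrow> \<bar>\<integral>\<omega>. X \<omega> \<partial>unit_space\<bar> \<le> L2_norm X"
  using unit_space.square_integral_le(2)[of X] unfolding L2_norm_def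
  by (auto simp: L2_space_def intro!: real_le_rsqrt)

lemma integrable_sum_squares:
  fixes X Y :: "'a \<Rightarrow> real"
  assumes "X \<in> borel_measurable M" "integrable M (\<lambda>\<omega>. (X \<omega>)\<^sup>2)"
    and "Y \<in> borel_measurable M" "integrable M (\<lambda>\<omega>. (Y \<omega>)\<^sup>2)"
  shows "integrable M (\<lambda>\<omega>. (X \<omega> + Y \<omega>)\<^sup>2)"
proof (rule Bochner_Integration.integrable_bound)
  show "integrable M (\<lambda>\<omega>. 2 * (X \<omega>)\<^sup>2 + 2 * (Y \<omega>)\<^sup>2)" using assms by simp
  show "(\<lambda>\<omega>. (X \<omega> + Y \<omega>)\<^sup>2) \<in> borel_measurable M" using assms by simp
  have "(X \<omega> + Y \<omega>)\<^sup>2 \<le> 2 * (X \<omega>)\<^sup>2 + 2 * (Y \<omega>)\<^sup>2" for \<omega>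
    using sum_squares_bound[of "X \<omega>" "Y \<omega>"] by (simp add: power2_sum)
  then show "AE \<omega> in M. norm ((X \<omega> + Y \<omega>)\<^sup>2) \<le> norm (2 * (X \<omega>)\<^sup>2 + 2 * (Y \<omega>)\<^sup>2)" by simp
qed

lemma L2_space_add: "X \<in> L2_space \<Longrightarrow> Y \<in> L2_space \<Longrightarrow> (\<lambda>\<omega>. X \<omega> + Y \<omega>) \<in> L2_space"
  using integrable_sum_squares[of X unit_space Y] by (auto simp: L2_space_def)

lemma L2_space_scale: "Y \<in> L2_space \<Longrightarrow> (\<lambda>\<omega>. h * Y \<omega>) \<in> L2_space"
  by (auto simp: L2_space_def power_mult_distrib)

lemma L2_space_bounded:
  assumes "X \<in> borel_measurable unit_space" "\<And>\<omega>. \<bar>X \<omega>\<bar> \<le> B"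
  shows "X \<in> L2_space"
proof -
  have "integrable unit_space (\<lambda>\<omega>. (X \<omega>)\<^sup>2)"
    by (rule unit_space.integrable_const_bound[of _ "B\<^sup>2"])
      (use assms abs_le_square_iff[of "X _" B] in \<open>force intro: order_trans[OF _ abs_ge_self]\<close>)+
  then show ?thesis using assms by (simp add: L2_space_def)
qed

lemma L2_norm_scale: "L2_norm (\<lambda>\<omega>. h * Y \<omega>) = \<bar>h\<bar> * L2_norm Y"
  by (simp add: L2_norm_def power_mult_distrib real_sqrt_mult)

lemma law_in_P2: "X \<in> L2_space \<Longrightarrow> law X \<in> P2"
  using L2_space_measurable[of X] L2_space_square[of X]
  by (auto simp: law_def P2_def integrable_distr_eq intro!: unit_space.prob_space_distr)

lemma mean_law: "X \<in> L2_space \<Longrightarrow> mean (law X) = (\<integral>\<omega>. X \<omega> \<partial>unit_space)"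
  using L2_space_measurable[of X] by (simp add: mean_def law_def integral_distr)

text \<open>The quantile transform.\<close>

lemma P2_law:
  assumes "m \<in> P2"
  shows "\<exists>X\<in>L2_space. law X = m"
proof -
  interpret cdf_distribution m
    using assms by (auto simp: P2_def cdf_distribution_def real_distribution_def real_distribution_axioms_def)
  have law: "law I = m"
    using distr_I_eq_M by (simp add: law_def unit_space_def)
  have meas: "I \<in> borel_measurable unit_space"
    using measurable_CI by (simp add: unit_space_def measurable_restrict_space1 cong: measurable_cong_sets)
  have "integrable (law I) (\<lambda>z. z\<^sup>2)" using assms by (simp add: law P2_def)
  then have "I \<in> L2_space"
    using meas by (simp add: L2_space_def law_def integrable_distr_eq)
  with law show ?thesis by blast
qed

lemma return_in_P2: "return borel x \<in> P2" for x :: real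
proof -
  interpret prob_space "return borel x" by (rule prob_space_return) simp
  have "AE z in return borel x. norm (z\<^sup>2) \<le> x\<^sup>2" by (subst AE_return) auto
  then have "integrable (return borel x) (\<lambda>z. z\<^sup>2)" by (rule integrable_const_bound) simp
  then show ?thesis by (simp add: P2_def prob_space_axioms)
qed

lemma mean_return: "mean (return borel x) = x"
  by (simp add: mean_def integral_return)

lemma measurable_fst_snd_borel:
  "fst \<in> borel_measurable (borel :: (real \<times> real) measure)"
  "snd \<in> borel_measurable (borel :: (real \<times> real) measure)"
  by (intro borel_measurable_continuous_onI continuous_intros)+

lemma coupling_exists:
  assumes "m \<in> P2" "m' \<in> P2"
  shows "couplings m m' \<noteq> {}"
proof -
  interpret m: prob_space m using assms by (simp add: P2_def)
  interpret m': prob_space m' using assms by (simp add: P2_def)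
  interpret pair_prob_space m m' ..
  have s: "sets m = sets borel" "sets m' = sets borel" using assms by (auto simp: P2_def)
  have "sets (m \<Otimes>\<^sub>M m') = sets (borel \<Otimes>\<^sub>M borel :: (real \<times> real) measure)"
    by (rule sets_pair_measure_cong) (use s in auto)
  then have "sets (m \<Otimes>\<^sub>M m') = sets borel" by (simp only: borel_prod)
  moreover have "distr (m \<Otimes>\<^sub>M m') borel fst = m"
    using m'.distr_pair_fst[of m] distr_cong[OF refl s(1)] by metis
  moreover have "distr (m \<Otimes>\<^sub>M m') borel snd = m'"
  proof (rule measure_eqI)
    fix A assume A: "A \<in> sets (distr (m \<Otimes>\<^sub>M m') borel snd)"
    then have A': "A \<in> sets m'" using s by simp
    have "emeasure (distr (m \<Otimes>\<^sub>M m') borel snd) A = emeasure (m \<Otimes>\<^sub>M m') (snd -` A \<inter> space (m \<Otimes>\<^sub>M m'))"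
      using A s by (intro emeasure_distr) (auto intro!: measurable_snd'' cong: measurable_cong_sets)
    also have "snd -` A \<inter> space (m \<Otimes>\<^sub>M m') = space m \<times> A"
      using sets.sets_into_space[OF A'] by (auto simp: space_pair_measure)
    also have "emeasure (m \<Otimes>\<^sub>M m') (space m \<times> A) = emeasure m' A"
      using A' by (simp add: m'.emeasure_pair_measure_Times m.emeasure_space_1)
    finally show "emeasure (distr (m \<Otimes>\<^sub>M m') borel snd) A = emeasure m' A" .
  qed (use s in simp)
  ultimately have "m \<Otimes>\<^sub>M m' \<in> couplings m m'"
    by (simp add: couplings_def prob_space_axioms)
  then show ?thesis by blast
qed

text \<open>For every coupling the difference of the means is the integral of \<open>fst w - snd w\<close>; its square is at most the
  cost of the coupling.\<close>

lemma mean_wasserstein2: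
  assumes m: "m \<in> P2" "m' \<in> P2"
  shows "\<bar>mean m - mean m'\<bar> \<le> wasserstein2 m m'"
proof -
  have "(mean m - mean m')\<^sup>2 \<le> (INF \<pi>\<in>couplings m m'. \<integral>w. (fst w - snd w)\<^sup>2 \<partial>\<pi>)"
  proof (rule cINF_greatest[OF coupling_exists[OF m]])
    fix \<pi> assume \<pi>: "\<pi> \<in> couplings m m'"
    then interpret prob_space \<pi> by (simp add: couplings_def)
    have [measurable_cong]: "sets \<pi> = sets borel" and d: "distr \<pi> borel fst = m" "distr \<pi> borel snd = m'"
      using \<pi> by (auto simp: couplings_def)
    have meas [measurable]: "fst \<in> borel_measurable \<pi>" "snd \<in> borel_measurable \<pi>"
      using measurable_fst_snd_borel by measurable
    have 1: "integrable \<pi> (\<lambda>w. (fst w)\<^sup>2)"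
      using m(1) d(1) integrable_distr[OF meas(1), of "\<lambda>z. z\<^sup>2"] by (simp add: P2_def)
    have 2: "integrable \<pi> (\<lambda>w. (- snd w)\<^sup>2)"
      using m(2) d(2) integrable_distr[OF meas(2), of "\<lambda>z. z\<^sup>2"] by (simp add: P2_def)
    have i: "integrable \<pi> fst" "integrable \<pi> snd"
      by (rule square_integral_le(1); use 1 2 in simp)+
    have "mean m - mean m' = (\<integral>w. fst w - snd w \<partial>\<pi>)"
      using i by (simp add: mean_def d(1)[symmetric] d(2)[symmetric] integral_distr)
    moreover have "integrable \<pi> (\<lambda>w. (fst w - snd w)\<^sup>2)"
      using integrable_sum_squares[OF _ 1 _ 2] by simp
    ultimately show "(mean m - mean m')\<^sup>2 \<le> (\<integral>w. (fst w - snd w)\<^sup>2 \<partial>\<pi>)"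
      using square_integral_le(2)[of "\<lambda>w. fst w - snd w"] by simp
  qed
  then show ?thesis unfolding wasserstein2_def by (intro real_le_rsqrt) simp
qed

text \<open>A measure and a Dirac measure are coupled by pairing every point with the atom.\<close>

lemma wasserstein2_dirac_le:
  assumes m: "m \<in> P2"
  shows "wasserstein2 m (return borel w) \<le> sqrt (\<integral>z. (z - w)\<^sup>2 \<partial>m)"
proof -
  interpret prob_space m using m by (simp add: P2_def)
  have s [measurable_cong]: "sets m = sets borel" using m by (simp add: P2_def)
  let ?\<pi> = "distr m borel (\<lambda>z. (z, w))"
  have meas [measurable]: "(\<lambda>z. (z, w)) \<in> m \<rightarrow>\<^sub>M borel"
    unfolding borel_prod[symmetric] by measurable
  note b [measurable] = measurable_fst_snd_borel
  have "distr ?\<pi> borel fst = m"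
    by (subst distr_distr) (use s in \<open>auto simp: comp_def intro!: distr_id2\<close>)
  moreover have "distr ?\<pi> borel snd = return borel w"
  proof (rule measure_eqI)
    fix A assume "A \<in> sets (distr ?\<pi> borel snd)"
    then have A: "A \<in> sets borel" by simp
    have "emeasure (distr ?\<pi> borel snd) A = emeasure (distr m borel (\<lambda>z. w)) A"
      by (subst distr_distr) (auto simp: comp_def)
    also have "\<dots> = emeasure (return borel w) A"
      using A by (auto simp: emeasure_distr emeasure_space_1 indicator_def)
    finally show "emeasure (distr ?\<pi> borel snd) A = emeasure (return borel w) A" .
  qed simp
  moreover have "prob_space ?\<pi>" by (rule prob_space_distr[OF meas])
  ultimately have "?\<pi> \<in> couplings m (return borel w)" by (simp add: couplings_def)
  then have "(INF \<pi>\<in>couplings m (return borel w). \<integral>w. (fst w - snd w)\<^sup>2 \<partial>\<pi>) \<le> (\<integral>w. (fst w - snd w)\<^sup>2 \<partial>?\<pi>)"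
    by (intro cINF_lower bdd_belowI[of _ 0]) auto
  also have "\<dots> = (\<integral>z. (z - w)\<^sup>2 \<partial>m)"
    by (subst integral_distr) auto
  finally show ?thesis unfolding wasserstein2_def by simp
qed

lemma continuous_on_P2_mean:
  fixes U :: "'a::metric_space \<Rightarrow> real \<Rightarrow> real"
  assumes "continuous_on (S \<times> UNIV) (\<lambda>(x,r). U x r)"
  shows "continuous_on_P2 S (\<lambda>x m. U x (mean m))"
  unfolding continuous_on_P2_def
proof (intro ballI allI impI)
  fix x m and e :: real assume x: "x \<in> S" and m: "m \<in> P2" and e: "0 < e"
  from assms x e obtain d where d: "d > 0"
    "\<And>x' r. x' \<in> S \<Longrightarrow> dist (x', r) (x, mean m) < d \<Longrightarrow> dist (U x' r) (U x (mean m)) < e"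
    unfolding continuous_on_iff by (metis (no_types, lifting) UNIV_I case_prod_conv mem_Sigma_iff)
  show "\<exists>d>0. \<forall>x'\<in>S. \<forall>m'\<in>P2. dist x' x < d \<and> wasserstein2 m' m < d \<longrightarrow> \<bar>U x' (mean m') - U x (mean m)\<bar> < e"
  proof (intro exI[of _ "d/2"] conjI ballI impI)
    fix x' m' assume H: "x' \<in> S" "m' \<in> P2" "dist x' x < d / 2 \<and> wasserstein2 m' m < d / 2"
    have "dist (x', mean m') (x, mean m) \<le> dist x' x + dist (mean m') (mean m)"
      unfolding dist_Pair_Pair using sqrt_sum_squares_le_sum[of "dist x' x" "dist (mean m') (mean m)"] by simp
    also have "\<dots> < d"
      using H mean_wasserstein2[OF H(2) m] by (simp add: dist_real_def)
    finally show "\<bar>U x' (mean m') - U x (mean m)\<bar> < e"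
      using d(2)[OF H(1)] by (simp add: dist_real_def)
  qed (use d in simp)
qed

lemma continuous_on_P2_dirac:
  fixes V :: "'a::metric_space \<Rightarrow> real measure \<Rightarrow> real"
  assumes "continuous_on_P2 S V"
  shows "continuous_on (S \<times> UNIV) (\<lambda>(x,r). V x (return borel r))"
  unfolding continuous_on_iff
proof (clarify)
  fix x r and e :: real assume x: "x \<in> S" and e: "0 < e"
  from assms x e return_in_P2[of r] obtain d where d: "d > 0"
    "\<And>x' m'. x' \<in> S \<Longrightarrow> m' \<in> P2 \<Longrightarrow> dist x' x < d \<Longrightarrow> wasserstein2 m' (return borel r) < d \<Longrightarrow>
      \<bar>V x' m' - V x (return borel r)\<bar> < e"
    unfolding continuous_on_P2_def by meson
  show "\<exists>d>0. \<forall>p\<in>S \<times> UNIV. dist p (x, r) < d \<longrightarrow>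
      dist ((\<lambda>(x,r). V x (return borel r)) p) (V x (return borel r)) < e"
  proof (intro exI[of _ d] conjI ballI impI)
    fix p assume p: "p \<in> S \<times> (UNIV :: real set)" "dist p (x, r) < d"
    obtain x' r' where p_eq: "p = (x', r')" by (cases p) auto
    have x': "dist x' x < d" and r': "dist r' r < d"
      using p(2) dist_fst_le[of p "(x,r)"] dist_snd_le[of p "(x,r)"] by (auto simp: p_eq)
    have "wasserstein2 (return borel r') (return borel r) \<le> sqrt (\<integral>z. (z - r)\<^sup>2 \<partial>return borel r')"
      by (rule wasserstein2_dirac_le[OF return_in_P2])
    also have "\<dots> = dist r' r" by (simp add: integral_return dist_real_def)
    finally have "wasserstein2 (return borel r') (return borel r) < d" using r' by simp
    from d(2)[OF _ return_in_P2 x' this] p(1)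
    show "dist ((\<lambda>(x,r). V x (return borel r)) p) (V x (return borel r)) < e"
      by (simp add: p_eq dist_real_def)
  qed (use d in simp)
qed

section \<open>Lions derivatives of functions of the mean\<close>

text \<open>The mean of the law of \<open>X + Y\<close> differs from that of \<open>X\<close> by the integral of \<open>Y\<close>, so the lift of \<open>\<phi> \<circ> mean\<close> is
  \<open>\<phi>\<close> after a bounded linear functional and its gradient is constant.\<close>

lemma has_lions_derivative_mean:
  assumes m: "m \<in> P2" and \<phi>: "(\<phi> has_real_derivative D) (at (mean m))"
  shows "has_lions_derivative (\<lambda>m'. \<phi> (mean m')) (\<lambda>z. D) m"
  unfolding has_lions_derivative_def
proof (intro conjI)
  interpret prob_space m using m by (simp add: P2_def)
  show "integrable m (\<lambda>z. D\<^sup>2)" by simp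
  obtain X where X: "X \<in> L2_space" "law X = m" using P2_law[OF m] by blast
  show "\<exists>X\<in>L2_space. law X = m \<and> (\<forall>e>0. \<exists>d>0. \<forall>Y\<in>L2_space. L2_norm Y < d \<longrightarrow>
     \<bar>\<phi> (mean (law (\<lambda>\<omega>. X \<omega> + Y \<omega>))) - \<phi> (mean (law X)) - (\<integral>\<omega>. D * Y \<omega> \<partial>unit_space)\<bar> \<le> e * L2_norm Y)"
  proof (intro bexI[OF _ X(1)] conjI allI impI X(2))
    fix e :: real assume e: "0 < e"
    from \<phi> have "(\<phi> has_derivative (*) D) (at (mean m))" by (simp add: has_field_derivative_def)
    with e obtain d where d: "d > 0"
      "\<And>r. \<bar>r - mean m\<bar> < d \<Longrightarrow> \<bar>\<phi> r - \<phi> (mean m) - D * (r - mean m)\<bar> \<le> e * \<bar>r - mean m\<bar>"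
      unfolding has_derivative_at_alt by auto
    show "\<exists>d>0. \<forall>Y\<in>L2_space. L2_norm Y < d \<longrightarrow>
      \<bar>\<phi> (mean (law (\<lambda>\<omega>. X \<omega> + Y \<omega>))) - \<phi> (mean (law X)) - (\<integral>\<omega>. D * Y \<omega> \<partial>unit_space)\<bar> \<le> e * L2_norm Y"
    proof (intro exI[of _ d] conjI ballI impI)
      fix Y assume Y: "Y \<in> L2_space" "L2_norm Y < d"
      let ?h = "\<integral>\<omega>. Y \<omega> \<partial>unit_space"
      have r: "mean (law (\<lambda>\<omega>. X \<omega> + Y \<omega>)) = mean m + ?h"
        using L2_space_integrable[OF X(1)] L2_space_integrable[OF Y(1)]
        by (simp add: mean_law L2_space_add X(1) Y(1) X(2)[symmetric])
      have h: "\<bar>?h\<bar> \<le> L2_norm Y" by (rule abs_integral_le_L2_norm[OF Y(1)])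
      have "\<bar>\<phi> (mean m + ?h) - \<phi> (mean m) - D * ?h\<bar> \<le> e * \<bar>?h\<bar>"
        using d(2)[of "mean m + ?h"] h Y(2) by simp
      also have "\<dots> \<le> e * L2_norm Y" using h e by simp
      finally show "\<bar>\<phi> (mean (law (\<lambda>\<omega>. X \<omega> + Y \<omega>))) - \<phi> (mean (law X)) - (\<integral>\<omega>. D * Y \<omega> \<partial>unit_space)\<bar> \<le> e * L2_norm Y"
        by (simp add: r X(2))
    qed (use d in simp)
  qed
qed simp

lemma has_lions_derivative_directional:
  assumes "has_lions_derivative U \<xi> m"
  shows "\<exists>X\<in>L2_space. law X = m \<and> (\<forall>Y\<in>L2_space.
    ((\<lambda>h. U (law (\<lambda>\<omega>. X \<omega> + h * Y \<omega>))) has_real_derivative (\<integral>\<omega>. \<xi> (X \<omega>) * Y \<omega> \<partial>unit_space)) (at 0))"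
proof -
  from assms obtain X where X: "X \<in> L2_space" "law X = m" and
    fr: "\<And>e. e > 0 \<Longrightarrow> \<exists>d>0. \<forall>Y\<in>L2_space. L2_norm Y < d \<longrightarrow>
      \<bar>U (law (\<lambda>\<omega>. X \<omega> + Y \<omega>)) - U (law X) - (\<integral>\<omega>. \<xi> (X \<omega>) * Y \<omega> \<partial>unit_space)\<bar> \<le> e * L2_norm Y"
    unfolding has_lions_derivative_def by blast
  have "((\<lambda>h. U (law (\<lambda>\<omega>. X \<omega> + h * Y \<omega>))) has_real_derivative (\<integral>\<omega>. \<xi> (X \<omega>) * Y \<omega> \<partial>unit_space)) (at 0)"
    if Y: "Y \<in> L2_space" for Y
    unfolding has_field_derivative_def has_derivative_at_alt
  proof (intro conjI allI impI)
    fix e :: real assume e: "0 < e"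
    let ?n = "L2_norm Y + 1"
    have n: "?n > 0" "L2_norm Y \<ge> 0" by (auto simp: L2_norm_def add_nonneg_pos)
    have "e / ?n > 0" using e n by simp
    from fr[OF this] obtain d where d: "d > 0" "\<And>Z. Z \<in> L2_space \<Longrightarrow> L2_norm Z < d \<Longrightarrow>
      \<bar>U (law (\<lambda>\<omega>. X \<omega> + Z \<omega>)) - U (law X) - (\<integral>\<omega>. \<xi> (X \<omega>) * Z \<omega> \<partial>unit_space)\<bar> \<le> e / ?n * L2_norm Z"
      by blast
    show "\<exists>d>0. \<forall>h. norm (h - 0) < d \<longrightarrow>
      norm (U (law (\<lambda>\<omega>. X \<omega> + h * Y \<omega>)) - U (law (\<lambda>\<omega>. X \<omega> + 0 * Y \<omega>)) - (\<integral>\<omega>. \<xi> (X \<omega>) * Y \<omega> \<partial>unit_space) * (h - 0))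
      \<le> e * norm (h - 0)"
    proof (intro exI[of _ "d / ?n"] conjI allI impI)
      fix h :: real assume "norm (h - 0) < d / ?n"
      then have h: "\<bar>h\<bar> * ?n < d" using n by (simp add: field_simps)
      have "\<bar>h\<bar> * L2_norm Y \<le> \<bar>h\<bar> * ?n" by (intro mult_left_mono) auto
      with h have hd: "L2_norm (\<lambda>\<omega>. h * Y \<omega>) < d" by (simp add: L2_norm_scale)
      have i: "(\<integral>\<omega>. \<xi> (X \<omega>) * (h * Y \<omega>) \<partial>unit_space) = (\<integral>\<omega>. \<xi> (X \<omega>) * Y \<omega> \<partial>unit_space) * h"
        by (subst integral_mult_left_zero[symmetric]) (simp add: algebra_simps)
      have "e / ?n * (\<bar>h\<bar> * L2_norm Y) \<le> e / ?n * (\<bar>h\<bar> * ?n)"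
        using e n by (intro mult_left_mono) auto
      also have "\<dots> = e * \<bar>h\<bar>" using n by simp
      finally have "e / ?n * L2_norm (\<lambda>\<omega>. h * Y \<omega>) \<le> e * \<bar>h\<bar>" by (simp add: L2_norm_scale)
      with d(2)[OF L2_space_scale[OF Y] hd] i
      show "norm (U (law (\<lambda>\<omega>. X \<omega> + h * Y \<omega>)) - U (law (\<lambda>\<omega>. X \<omega> + 0 * Y \<omega>))
          - (\<integral>\<omega>. \<xi> (X \<omega>) * Y \<omega> \<partial>unit_space) * (h - 0)) \<le> e * norm (h - 0)" by simp
    qed (use d n in simp)
  qed (auto intro: bounded_linear_mult_right)
  with X show ?thesis by blast
qed

text \<open>Perturbing a random variable with law \<open>\<delta>\<^sub>x\<close> by the constant \<open>h\<close> moves the law to \<open>\<delta>\<^bsub>x+h\<^esub>\<close>.\<close>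

lemma has_lions_derivative_dirac:
  assumes L: "has_lions_derivative U \<xi> (return borel x)"
  shows "((\<lambda>r. U (return borel r)) has_real_derivative \<xi> x) (at x)"
proof -
  from has_lions_derivative_directional[OF L] obtain X where X: "X \<in> L2_space" "law X = return borel x"
    and d: "\<And>Y. Y \<in> L2_space \<Longrightarrow>
      ((\<lambda>h. U (law (\<lambda>\<omega>. X \<omega> + h * Y \<omega>))) has_real_derivative (\<integral>\<omega>. \<xi> (X \<omega>) * Y \<omega> \<partial>unit_space)) (at 0)" by blast
  have [measurable]: "X \<in> borel_measurable unit_space" "\<xi> \<in> borel_measurable borel"
    using X(1) L by (auto simp: L2_space_def has_lions_derivative_def)
  have law: "law (\<lambda>\<omega>. X \<omega> + h * 1) = return borel (x + h)" for h
  proof -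
    have "law (\<lambda>\<omega>. X \<omega> + h * 1) = distr (law X) borel (\<lambda>z. z + h)"
      unfolding law_def by (subst distr_distr) (auto simp: comp_def)
    also have "\<dots> = return borel (x + h)" unfolding X(2) by (rule distr_return) auto
    finally show ?thesis .
  qed
  have "(\<integral>\<omega>. \<xi> (X \<omega>) * 1 \<partial>unit_space) = (\<integral>z. \<xi> z \<partial>law X)"
    unfolding law_def by (subst integral_distr) auto
  also have "\<dots> = \<xi> x" unfolding X(2) by (rule integral_return) auto
  finally have i: "(\<integral>\<omega>. \<xi> (X \<omega>) * 1 \<partial>unit_space) = \<xi> x" .
  have "((\<lambda>h. U (return borel (x + h))) has_real_derivative \<xi> x) (at 0)"
    using d[OF L2_space_bounded[of "\<lambda>\<omega>. 1" 1]] unfolding law i by simp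
  then show ?thesis
    using DERIV_shift[of "\<lambda>r. U (return borel r)" "\<xi> x" 0 x] by (simp add: add.commute)
qed

text \<open>Moving an atom at \<open>z\<close> alone changes the mean in proportion to the mass of the atom.\<close>

lemma has_lions_derivative_mean_atom:
  assumes m: "m \<in> P2" and L: "has_lions_derivative (\<lambda>m'. \<phi> (mean m')) \<xi> m"
    and \<phi>: "(\<phi> has_real_derivative D) (at (mean m))" and atom: "measure m {z} > 0"
  shows "\<xi> z = D"
proof -
  from has_lions_derivative_directional[OF L] obtain X where X: "X \<in> L2_space" "law X = m"
    and d: "\<And>Y. Y \<in> L2_space \<Longrightarrow> ((\<lambda>h. \<phi> (mean (law (\<lambda>\<omega>. X \<omega> + h * Y \<omega>)))) has_real_derivative
      (\<integral>\<omega>. \<xi> (X \<omega>) * Y \<omega> \<partial>unit_space)) (at 0)" by blast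
  have [measurable]: "X \<in> borel_measurable unit_space" using X(1) by (simp add: L2_space_def)
  let ?Y = "\<lambda>\<omega>. indicator {z} (X \<omega>) :: real"
  let ?p = "measure m {z}"
  have Y: "?Y \<in> L2_space" by (rule L2_space_bounded[of _ 1]) (auto simp: indicator_def)
  have p: "(\<integral>\<omega>. ?Y \<omega> \<partial>unit_space) = ?p"
  proof -
    interpret prob_space m using m by (simp add: P2_def)
    have "(\<integral>\<omega>. ?Y \<omega> \<partial>unit_space) = (\<integral>x. indicator {z} x \<partial>law X)"
      unfolding law_def by (subst integral_distr) auto
    also have "\<dots> = ?p" using m by (simp add: X(2) P2_def)
    finally show ?thesis .
  qed
  have "mean (law (\<lambda>\<omega>. X \<omega> + h * ?Y \<omega>)) = mean m + h * ?p" for h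
    using L2_space_integrable[OF X(1)] L2_space_integrable[OF Y]
    by (simp add: mean_law L2_space_add L2_space_scale X(1) Y X(2)[symmetric] p[unfolded X(2)[symmetric]])
  moreover have "(\<integral>\<omega>. \<xi> (X \<omega>) * ?Y \<omega> \<partial>unit_space) = \<xi> z * ?p"
  proof -
    have "(\<integral>\<omega>. \<xi> (X \<omega>) * ?Y \<omega> \<partial>unit_space) = (\<integral>\<omega>. \<xi> z * ?Y \<omega> \<partial>unit_space)"
      by (rule Bochner_Integration.integral_cong) (auto simp: indicator_def)
    then show ?thesis by (simp add: p)
  qed
  ultimately have 1: "((\<lambda>h. \<phi> (mean m + h * ?p)) has_real_derivative \<xi> z * ?p) (at 0)"
    using d[OF Y] by simp
  have 2: "((\<lambda>h. \<phi> (mean m + h * ?p)) has_real_derivative D * ?p) (at 0)"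
    by (rule DERIV_chain2[of \<phi>]) (use \<phi> in \<open>auto intro!: derivative_eq_intros\<close>)
  from DERIV_unique[OF 1 2] atom show ?thesis by simp
qed

text \<open>Measures with an atom at \<open>z\<close> that converge to \<open>\<delta>\<^sub>w\<close> as \<open>\<epsilon>\<close> tends to zero.\<close>

lemma two_point_law:
  fixes z w \<epsilon> :: real
  assumes \<epsilon>: "0 < \<epsilon>" "\<epsilon> < 1"
  defines "X \<equiv> \<lambda>\<omega>::real. if \<omega> < \<epsilon> then z else w"
  shows "law X \<in> P2" "measure (law X) {z} > 0" "mean (law X) = w + \<epsilon> * (z - w)"
    "wasserstein2 (law X) (return borel w) \<le> sqrt \<epsilon> * \<bar>z - w\<bar>"
proof -
  have [measurable]: "(\<lambda>\<omega>. \<omega>) \<in> borel_measurable unit_space"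
    unfolding unit_space_def by (rule measurable_restrict_space1) simp
  have meas [measurable]: "X \<in> borel_measurable unit_space" unfolding X_def by measurable
  have X: "X \<in> L2_space"
    by (rule L2_space_bounded[OF meas, of "\<bar>z\<bar> + \<bar>w\<bar>"]) (auto simp: X_def)
  show P2: "law X \<in> P2" by (rule law_in_P2[OF X])
  have space: "space unit_space = {0<..<1}" by (simp add: unit_space_def space_restrict_space)
  have m: "measure unit_space {\<omega> \<in> space unit_space. \<omega> < \<epsilon>} = \<epsilon>"
  proof -
    have "{\<omega> \<in> space unit_space. \<omega> < \<epsilon>} = {0<..<\<epsilon>}" using \<epsilon> by (auto simp: space)
    moreover have "measure unit_space {0<..<\<epsilon>} = measure lborel {0<..<\<epsilon>}"
      unfolding unit_space_def using \<epsilon> by (intro measure_restrict_space) auto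
    ultimately show ?thesis using \<epsilon> by simp
  qed
  have int: "(\<integral>\<omega>. indicator {\<omega> \<in> space unit_space. \<omega> < \<epsilon>} \<omega> \<partial>unit_space) = \<epsilon>"
    using m by simp
  have "measure (law X) {z} = measure unit_space (X -` {z} \<inter> space unit_space)"
    unfolding law_def by (rule measure_distr) auto
  also have "\<dots> \<ge> measure unit_space {\<omega> \<in> space unit_space. \<omega> < \<epsilon>}"
    by (rule unit_space.finite_measure_mono) (auto simp: X_def)
  finally show "measure (law X) {z} > 0" using m \<epsilon> by simp
  have i: "integrable unit_space (indicator {\<omega> \<in> space unit_space. \<omega> < \<epsilon>} :: real \<Rightarrow> real)"
    by (simp add: integrable_indicator_iff unit_space.emeasure_eq_measure)
  have "mean (law X) = (\<integral>\<omega>. w + (z - w) * indicator {\<omega> \<in> space unit_space. \<omega> < \<epsilon>} \<omega> \<partial>unit_space)"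
    unfolding mean_law[OF X] by (rule Bochner_Integration.integral_cong) (auto simp: X_def indicator_def)
  also have "\<dots> = w + \<epsilon> * (z - w)"
    using i int by (simp add: unit_space.prob_space)
  finally show "mean (law X) = w + \<epsilon> * (z - w)" .
  have "(\<integral>x. (x - w)\<^sup>2 \<partial>law X) = (\<integral>\<omega>. (X \<omega> - w)\<^sup>2 \<partial>unit_space)"
    unfolding law_def by (subst integral_distr) auto
  also have "\<dots> = (\<integral>\<omega>. (z - w)\<^sup>2 * indicator {\<omega> \<in> space unit_space. \<omega> < \<epsilon>} \<omega> \<partial>unit_space)"
    by (rule Bochner_Integration.integral_cong) (auto simp: X_def indicator_def)
  also have "\<dots> = (z - w)\<^sup>2 * \<epsilon>" using int by simp
  finally have "sqrt (\<integral>x. (x - w)\<^sup>2 \<partial>law X) = sqrt \<epsilon> * \<bar>z - w\<bar>" by (simp add: real_sqrt_mult)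
  with wasserstein2_dirac_le[OF P2, of w]
  show "wasserstein2 (law X) (return borel w) \<le> sqrt \<epsilon> * \<bar>z - w\<bar>" by simp
qed

lemma continuous_on_P2_meanI:
  assumes "jointly_continuous S U"
  shows "continuous_on_P2 (UNIV \<times> S) (\<lambda>(y,t) m. U y (mean m) t)"
    and "continuous_on_P2 (UNIV \<times> UNIV \<times> S) (\<lambda>(y,z::real,t) m. U y (mean m) t)"
    and "continuous_on_P2 (UNIV \<times> UNIV \<times> UNIV \<times> S) (\<lambda>(y,z1::real,z2::real,t) m. U y (mean m) t)"
proof -
  have "continuous_on ((UNIV \<times> S) \<times> UNIV) (\<lambda>p. (fst (fst p), snd p, snd (fst p)))"
    by (intro continuous_intros)
  from continuous_on_compose2[OF assms this]
  have "continuous_on ((UNIV \<times> S) \<times> UNIV) (\<lambda>(x,r). (\<lambda>(y,t) r. U y r t) x r)"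
    by (simp add: split_def image_subset_iff)
  from continuous_on_P2_mean[OF this]
  show "continuous_on_P2 (UNIV \<times> S) (\<lambda>(y,t) m. U y (mean m) t)" by (simp add: split_def)
  have "continuous_on ((UNIV \<times> UNIV \<times> S) \<times> UNIV) (\<lambda>p::(_ \<times> real \<times> _) \<times> _. (fst (fst p), snd p, snd (snd (fst p))))"
    by (intro continuous_intros)
  from continuous_on_compose2[OF assms this]
  have "continuous_on ((UNIV \<times> UNIV \<times> S) \<times> UNIV) (\<lambda>(x,r). (\<lambda>(y,z::real,t) r. U y r t) x r)"
    by (simp add: split_def image_subset_iff)
  from continuous_on_P2_mean[OF this]
  show "continuous_on_P2 (UNIV \<times> UNIV \<times> S) (\<lambda>(y,z::real,t) m. U y (mean m) t)" by (simp add: split_def)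
  have "continuous_on ((UNIV \<times> UNIV \<times> UNIV \<times> S) \<times> UNIV)
      (\<lambda>p::(_ \<times> real \<times> real \<times> _) \<times> _. (fst (fst p), snd p, snd (snd (snd (fst p)))))"
    by (intro continuous_intros)
  from continuous_on_compose2[OF assms this]
  have "continuous_on ((UNIV \<times> UNIV \<times> UNIV \<times> S) \<times> UNIV) (\<lambda>(x,r). (\<lambda>(y,z1::real,z2::real,t) r. U y r t) x r)"
    by (simp add: split_def image_subset_iff)
  from continuous_on_P2_mean[OF this]
  show "continuous_on_P2 (UNIV \<times> UNIV \<times> UNIV \<times> S) (\<lambda>(y,z1::real,z2::real,t) m. U y (mean m) t)"
    by (simp add: split_def)
qed

lemma continuous_on_P2_diracD:
  "continuous_on_P2 (UNIV \<times> S) (\<lambda>(y,t) m. V y m t) \<Longrightarrow>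
    continuous_on (UNIV \<times> UNIV \<times> S) (\<lambda>(y,r,t). V y (return borel r) t)"
  "continuous_on_P2 (UNIV \<times> UNIV \<times> S) (\<lambda>(y,z,t) m. V1 y m z t) \<Longrightarrow>
    continuous_on (UNIV \<times> UNIV \<times> S) (\<lambda>(y,r,t). V1 y (return borel r) r t)"
  "continuous_on_P2 (UNIV \<times> UNIV \<times> UNIV \<times> S) (\<lambda>(y,z1,z2,t) m. V2 y m z1 z2 t) \<Longrightarrow>
    continuous_on (UNIV \<times> UNIV \<times> S) (\<lambda>(y,r,t). V2 y (return borel r) r r t)"
proof -
  assume "continuous_on_P2 (UNIV \<times> S) (\<lambda>(y,t) m. V y m t)"
  from continuous_on_P2_dirac[OF this]
  have c: "continuous_on ((UNIV \<times> S) \<times> UNIV) (\<lambda>((y,t),r). V y (return borel r) t)" by (simp add: split_def)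
  have "continuous_on (UNIV \<times> UNIV \<times> S) (\<lambda>p. ((fst p, snd (snd p)), fst (snd p)))"
    by (intro continuous_intros)
  from continuous_on_compose2[OF c this]
  show "continuous_on (UNIV \<times> UNIV \<times> S) (\<lambda>(y,r,t). V y (return borel r) t)"
    by (simp add: split_def image_subset_iff)
next
  assume "continuous_on_P2 (UNIV \<times> UNIV \<times> S) (\<lambda>(y,z,t) m. V1 y m z t)"
  from continuous_on_P2_dirac[OF this]
  have c: "continuous_on ((UNIV \<times> UNIV \<times> S) \<times> UNIV) (\<lambda>((y,z,t),r). V1 y (return borel r) z t)"
    by (simp add: split_def)
  have "continuous_on (UNIV \<times> UNIV \<times> S) (\<lambda>p. ((fst p, fst (snd p), snd (snd p)), fst (snd p)))"
    by (intro continuous_intros)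
  from continuous_on_compose2[OF c this]
  show "continuous_on (UNIV \<times> UNIV \<times> S) (\<lambda>(y,r,t). V1 y (return borel r) r t)"
    by (simp add: split_def image_subset_iff)
next
  assume "continuous_on_P2 (UNIV \<times> UNIV \<times> UNIV \<times> S) (\<lambda>(y,z1,z2,t) m. V2 y m z1 z2 t)"
  from continuous_on_P2_dirac[OF this]
  have c: "continuous_on ((UNIV \<times> UNIV \<times> UNIV \<times> S) \<times> UNIV) (\<lambda>((y,z1,z2,t),r). V2 y (return borel r) z1 z2 t)"
    by (simp add: split_def)
  have "continuous_on (UNIV \<times> UNIV \<times> S) (\<lambda>p. ((fst p, fst (snd p), fst (snd p), snd (snd p)), fst (snd p)))"
    by (intro continuous_intros)
  from continuous_on_compose2[OF c this]
  show "continuous_on (UNIV \<times> UNIV \<times> S) (\<lambda>(y,r,t). V2 y (return borel r) r r t)"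
    by (simp add: split_def image_subset_iff)
qed

text \<open>The Lions derivative at a Dirac measure is determined away from the atom by continuity: give a point
  \<open>z\<close> a small mass, and let that mass tend to zero.\<close>

lemma lions_derivative_of_mean_at_dirac:
  assumes cont: "continuous_on_P2 S V" and x: "x \<in> S"
    and L: "\<And>m. m \<in> P2 \<Longrightarrow> has_lions_derivative (\<lambda>m'. \<phi> (mean m')) (\<xi> m) m"
    and V: "\<And>m. V x m = \<xi> m z"
    and \<phi>: "\<And>r. (\<phi> has_real_derivative D r) (at r)" and D: "isCont D w"
  shows "\<xi> (return borel w) z = D w"
proof (rule ccontr)
  assume ne: "\<xi> (return borel w) z \<noteq> D w"
  define e where "e = \<bar>\<xi> (return borel w) z - D w\<bar> / 2"
  have e: "e > 0" using ne by (simp add: e_def)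
  from cont x e return_in_P2[of w] obtain d1 where d1: "d1 > 0"
    "\<And>m'. m' \<in> P2 \<Longrightarrow> wasserstein2 m' (return borel w) < d1 \<Longrightarrow> \<bar>V x m' - V x (return borel w)\<bar> < e"
    unfolding continuous_on_P2_def by (metis dist_self)
  from D e obtain d2 where d2: "d2 > 0" "\<And>r. dist r w < d2 \<Longrightarrow> dist (D r) (D w) < e"
    unfolding continuous_at_eps_delta by (metis dist_real_def real_norm_def)
  let ?K = "\<bar>z - w\<bar> + 1"
  have K: "?K > 0" by simp
  define A B where "A = (d1 / ?K)\<^sup>2" and "B = d2 / ?K"
  have AB: "A > 0" "B > 0" using d1(1) d2(1) K by (auto simp: A_def B_def)
  (* The distance to the Dirac measure is at most sqrt eps * |z - w|, that of the means eps * |z - w|. *)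
  define \<epsilon> where "\<epsilon> = min (1/2) (min (A / 2) (B / 2))"
  have \<epsilon>: "0 < \<epsilon>" "\<epsilon> < 1" "\<epsilon> < (d1 / ?K)\<^sup>2" "\<epsilon> < d2 / ?K"
    unfolding A_def[symmetric] B_def[symmetric] using AB by (auto simp: \<epsilon>_def min_def)
  define m where "m = law (\<lambda>\<omega>. if \<omega> < \<epsilon> then z else w)"
  note m = two_point_law[OF \<epsilon>(1,2), of z w, folded m_def]
  have "sqrt \<epsilon> < d1 / ?K" using \<epsilon>(3) d1(1) K by (intro real_less_lsqrt) auto
  then have "sqrt \<epsilon> * ?K < d1" using K by (simp add: pos_less_divide_eq)
  moreover have "sqrt \<epsilon> * \<bar>z - w\<bar> \<le> sqrt \<epsilon> * ?K" using \<epsilon> by (intro mult_left_mono) auto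
  ultimately have "wasserstein2 m (return borel w) < d1" using m(4) by linarith
  from d1(2)[OF m(1) this] have 1: "\<bar>\<xi> m z - \<xi> (return borel w) z\<bar> < e" by (simp add: V)
  have "\<epsilon> * ?K < d2" using \<epsilon>(4) K by (simp add: pos_less_divide_eq)
  moreover have "\<epsilon> * \<bar>z - w\<bar> \<le> \<epsilon> * ?K" using \<epsilon> by (intro mult_left_mono) auto
  ultimately have "\<epsilon> * \<bar>z - w\<bar> < d2" by linarith
  then have "dist (mean m) w < d2" using \<epsilon>(1) by (simp add: m(3) dist_real_def abs_mult)
  from d2(2)[OF this] have 2: "\<bar>D (mean m) - D w\<bar> < e" by (simp add: dist_real_def)
  have "\<xi> m z = D (mean m)" by (rule has_lions_derivative_mean_atom[OF m(1) L[OF m(1)] \<phi> m(2)])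
  with 1 2 have "\<bar>\<xi> (return borel w) z - D w\<bar> < 2 * e" by linarith
  then show False by (simp add: e_def)
qed

lemma integral_product_dirac:
  fixes F :: "real \<times> real \<Rightarrow> real"
  assumes i: "integrable (return borel x \<Otimes>\<^sub>M return borel x) F"
  shows "(\<integral>p. F p \<partial>(return borel x \<Otimes>\<^sub>M return borel x)) = F (x, x)"
proof -
  interpret prob_space "return borel x :: real measure" by (rule prob_space_return) simp
  interpret pair_sigma_finite "return borel x :: real measure" "return borel x :: real measure" ..
  have [measurable]: "F \<in> borel_measurable (borel \<Otimes>\<^sub>M borel)"
    using borel_measurable_integrable[OF i]
    by (simp cong: measurable_cong_sets add: measurable_cong_sets[OF sets_pair_measure_cong[OF sets_return sets_return] refl])
  have "(\<integral>p. F p \<partial>(return borel x \<Otimes>\<^sub>M return borel x)) = (\<integral>a. \<integral>b. F (a, b) \<partial>return borel x \<partial>return borel x)"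
    by (rule integral_fst'[OF i, symmetric])
  also have "\<dots> = (\<integral>a. F (a, x) \<partial>return borel x)"
    by (intro Bochner_Integration.integral_cong refl integral_return) auto
  also have "\<dots> = F (x, x)" by (rule integral_return) auto
  finally show ?thesis .
qed

section \<open>Reduction to a problem for functions of the mean\<close>

text \<open>The functions \<open>f_t\<close>, ..., \<open>f_mm\<close> witness that \<open>f\<close> is a classical solution.\<close>

definition reduced_derivs where
  "reduced_derivs T c f f_t f_y f_m f_yy f_ym f_mm \<longleftrightarrow>
     jointly_continuous {0..<T} f_t \<and> jointly_continuous {0..<T} f_y \<and> jointly_continuous {0..<T} f_m \<and>
     jointly_continuous {0..<T} f_yy \<and> jointly_continuous {0..<T} f_ym \<and> jointly_continuous {0..<T} f_mm \<and>
     (\<forall>y m. \<forall>t\<in>{0..<T}.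
        ((\<lambda>s. f y m s) has_real_derivative f_t y m t) (at t within {0..T}) \<and>
        ((\<lambda>x. f x m t) has_real_derivative f_y y m t) (at y) \<and>
        ((\<lambda>x. f y x t) has_real_derivative f_m y m t) (at m) \<and>
        ((\<lambda>x. f_y x m t) has_real_derivative f_yy y m t) (at y) \<and>
        ((\<lambda>x. f_y y x t) has_real_derivative f_ym y m t) (at m) \<and>
        ((\<lambda>x. f_m y x t) has_real_derivative f_mm y m t) (at m) \<and>
        1 - f_m y m t \<noteq> 0 \<and>
        f_t y m t
        + 1/2 * ((f_y y m t + c y t) / (1 - f_m y m t))\<^sup>2 * f_mm y m t
        + (f_y y m t + c y t) / (1 - f_m y m t) * f_ym y m t
        + 1/2 * f_yy y m t = 0)"

lemma solves_reduced_problem_alt: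
  "solves_reduced_problem T c C f \<longleftrightarrow> jointly_continuous {0..T} f \<and> (\<forall>y m. f y m T = C m) \<and>
     (\<exists>f_t f_y f_m f_yy f_ym f_mm. reduced_derivs T c f f_t f_y f_m f_yy f_ym f_mm)"
  unfolding solves_reduced_problem_def reduced_derivs_def by (simp only: conj_ac)

lemma reduced_derivsD:
  assumes "reduced_derivs T c f f_t f_y f_m f_yy f_ym f_mm"
  shows "jointly_continuous {0..<T} f_t" "jointly_continuous {0..<T} f_y" "jointly_continuous {0..<T} f_m"
    "jointly_continuous {0..<T} f_yy" "jointly_continuous {0..<T} f_ym" "jointly_continuous {0..<T} f_mm"
    and "\<And>y m t. 0 \<le> t \<Longrightarrow> t < T \<Longrightarrow>
      ((\<lambda>s. f y m s) has_real_derivative f_t y m t) (at t within {0..T})"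
    "\<And>y m t. 0 \<le> t \<Longrightarrow> t < T \<Longrightarrow> ((\<lambda>x. f x m t) has_real_derivative f_y y m t) (at y)"
    "\<And>y m t. 0 \<le> t \<Longrightarrow> t < T \<Longrightarrow> ((\<lambda>x. f y x t) has_real_derivative f_m y m t) (at m)"
    "\<And>y m t. 0 \<le> t \<Longrightarrow> t < T \<Longrightarrow> ((\<lambda>x. f_y x m t) has_real_derivative f_yy y m t) (at y)"
    "\<And>y m t. 0 \<le> t \<Longrightarrow> t < T \<Longrightarrow> ((\<lambda>x. f_y y x t) has_real_derivative f_ym y m t) (at m)"
    "\<And>y m t. 0 \<le> t \<Longrightarrow> t < T \<Longrightarrow> ((\<lambda>x. f_m y x t) has_real_derivative f_mm y m t) (at m)"
    "\<And>y m t. 0 \<le> t \<Longrightarrow> t < T \<Longrightarrow> 1 - f_m y m t \<noteq> 0"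
    "\<And>y m t. 0 \<le> t \<Longrightarrow> t < T \<Longrightarrow> f_t y m t
      + 1/2 * ((f_y y m t + c y t) / (1 - f_m y m t))\<^sup>2 * f_mm y m t
      + (f_y y m t + c y t) / (1 - f_m y m t) * f_ym y m t + 1/2 * f_yy y m t = 0"
  using assms unfolding reduced_derivs_def by auto

text \<open>The derivatives of \<open>f y (mean m) t\<close> in \<open>m\<close> are constant in \<open>z\<close>, so the \<open>z\<close>-derivative is zero and all integrals
  over the probability measure \<open>m\<close> are trivial.\<close>

theorem solves_measure_problem_if_reduced:
  assumes "solves_reduced_problem T c C f"
  shows "solves_measure_problem T c (\<lambda>m. C (mean m)) (\<lambda>y m t. f y (mean m) t)"
proof -
  from assms obtain f_t f_y f_m f_yy f_ym f_mm where R: "reduced_derivs T c f f_t f_y f_m f_yy f_ym f_mm"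
    and cf: "jointly_continuous {0..T} f" and terminal: "\<forall>y m. f y m T = C m"
    unfolding solves_reduced_problem_alt by blast
  note cont = reduced_derivsD(1-6)[OF R]
  have z: "continuous_on (UNIV \<times> UNIV \<times> {0..<T}) (\<lambda>(y::real,r::real,t). 0::real)"
    by (simp add: split_def)
  have main: "\<forall>y. \<forall>m\<in>P2. \<forall>t\<in>{0..<T}.
           ((\<lambda>s. f y (mean m) s) has_real_derivative f_t y (mean m) t) (at t within {0..T}) \<and>
           ((\<lambda>x. f x (mean m) t) has_real_derivative f_y y (mean m) t) (at y) \<and>
           ((\<lambda>x. f_y x (mean m) t) has_real_derivative f_yy y (mean m) t) (at y) \<and>
           has_lions_derivative (\<lambda>m'. f y (mean m') t) (\<lambda>z. f_m y (mean m) t) m \<and>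
           (\<forall>z::real. ((\<lambda>x::real. f_m y (mean m) t) has_real_derivative 0) (at z)) \<and>
           (\<forall>z1::real. has_lions_derivative (\<lambda>m'. f_m y (mean m') t) (\<lambda>z2. f_mm y (mean m) t) m) \<and>
           has_lions_derivative (\<lambda>m'. f_y y (mean m') t) (\<lambda>z. f_ym y (mean m) t) m \<and>
           integrable m (\<lambda>z. 0::real) \<and>
           integrable (m \<Otimes>\<^sub>M m) (\<lambda>(z1,z2). f_mm y (mean m) t) \<and>
           1 - (\<integral>z. f_m y (mean m) t \<partial>m) \<noteq> 0 \<and>
           (let a = (f_y y (mean m) t + c y t) / (1 - (\<integral>z. f_m y (mean m) t \<partial>m)) in
              f_t y (mean m) t
              + 1/2 * a\<^sup>2 * ((\<integral>(z1,z2). f_mm y (mean m) t \<partial>(m \<Otimes>\<^sub>M m)) + (\<integral>z. 0 \<partial>m))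
              + a * (\<integral>z. f_ym y (mean m) t \<partial>m)
              + 1/2 * f_yy y (mean m) t = 0)"
    (is "\<forall>y. \<forall>m\<in>P2. \<forall>t\<in>_. ?P y m t")
  proof (intro allI ballI)
    fix y m t assume m: "m \<in> P2" and t: "t \<in> {0..<T}"
    interpret prob_space m using m by (simp add: P2_def)
    have one: "measure m (space m) = 1" by (rule prob_space)
    interpret pair_prob_space m m ..
    have t': "0 \<le> t" "t < T" using t by auto
    note D = reduced_derivsD(7-14)[OF R t', where y = y and m = "mean m"]
    have "has_lions_derivative (\<lambda>m'. f y (mean m') t) (\<lambda>z. f_m y (mean m) t) m"
      "has_lions_derivative (\<lambda>m'. f_m y (mean m') t) (\<lambda>z. f_mm y (mean m) t) m"
      "has_lions_derivative (\<lambda>m'. f_y y (mean m') t) (\<lambda>z. f_ym y (mean m) t) m"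
      by (rule has_lions_derivative_mean[OF m]; rule D)+
    with D show "?P y m t"
      by (simp add: Let_def one P.prob_space split_def)
  qed
  show ?thesis
    unfolding solves_measure_problem_def
  proof (intro conjI, goal_cases)
    case 1
    show ?case by (rule continuous_on_P2_meanI(1)[OF cf])
  next
    case 2
    show ?case
      apply (rule exI[of _ "\<lambda>y m t. f_t y (mean m) t"])
      apply (rule exI[of _ "\<lambda>y m t. f_y y (mean m) t"])
      apply (rule exI[of _ "\<lambda>y m t. f_yy y (mean m) t"])
      apply (rule exI[of _ "\<lambda>y m z t. f_m y (mean m) t"])
      apply (rule exI[of _ "\<lambda>y m z t. 0"])
      apply (rule exI[of _ "\<lambda>y m z1 z2 t. f_mm y (mean m) t"])
      apply (rule exI[of _ "\<lambda>y m z t. f_ym y (mean m) t"])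
      apply (intro conjI continuous_on_P2_meanI cont z)
      apply (rule main)
      done
  next
    case 3
    show ?case using terminal by simp
  qed
qed

text \<open>Evaluate the equation at Dirac measures. The one delicate point is that the second Lions derivative there
  is that of \<open>m \<mapsto> f_m y m z t\<close> with \<open>z\<close> fixed; since \<open>f_m y m z t\<close> at \<open>\<delta>\<^sub>r\<close> does not depend on \<open>z\<close>, its
  derivative along Dirac measures is the second derivative of \<open>f\<close> in the mean.\<close>

theorem solves_reduced_problem_if_measure:
  assumes "solves_measure_problem T c (\<lambda>m. C (mean m)) (\<lambda>y m t. f y (mean m) t)"
  shows "solves_reduced_problem T c C f"
proof -
  from assms obtain f_t f_y f_yy f_m f_mz f_mm f_ym where
    D: "\<forall>y. \<forall>m\<in>P2. \<forall>t\<in>{0..<T}.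
           ((\<lambda>s. f y (mean m) s) has_real_derivative f_t y m t) (at t within {0..T}) \<and>
           ((\<lambda>x. f x (mean m) t) has_real_derivative f_y y m t) (at y) \<and>
           ((\<lambda>x. f_y x m t) has_real_derivative f_yy y m t) (at y) \<and>
           has_lions_derivative (\<lambda>m'. f y (mean m') t) (\<lambda>z. f_m y m z t) m \<and>
           (\<forall>z. ((\<lambda>x. f_m y m x t) has_real_derivative f_mz y m z t) (at z)) \<and>
           (\<forall>z1. has_lions_derivative (\<lambda>m'. f_m y m' z1 t) (\<lambda>z2. f_mm y m z1 z2 t) m) \<and>
           has_lions_derivative (\<lambda>m'. f_y y m' t) (\<lambda>z. f_ym y m z t) m \<and>
           integrable m (\<lambda>z. f_mz y m z t) \<and>
           integrable (m \<Otimes>\<^sub>M m) (\<lambda>(z1,z2). f_mm y m z1 z2 t) \<and>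
           1 - (\<integral>z. f_m y m z t \<partial>m) \<noteq> 0 \<and>
           (let a = (f_y y m t + c y t) / (1 - (\<integral>z. f_m y m z t \<partial>m)) in
              f_t y m t
              + 1/2 * a\<^sup>2 * ((\<integral>(z1,z2). f_mm y m z1 z2 t \<partial>(m \<Otimes>\<^sub>M m)) + (\<integral>z. f_mz y m z t \<partial>m))
              + a * (\<integral>z. f_ym y m z t \<partial>m)
              + 1/2 * f_yy y m t = 0)" and
    cont: "continuous_on_P2 (UNIV \<times> {0..<T}) (\<lambda>(y,t) m. f_t y m t)"
        "continuous_on_P2 (UNIV \<times> {0..<T}) (\<lambda>(y,t) m. f_y y m t)"
        "continuous_on_P2 (UNIV \<times> {0..<T}) (\<lambda>(y,t) m. f_yy y m t)"
        "continuous_on_P2 (UNIV \<times> UNIV \<times> {0..<T}) (\<lambda>(y,z,t) m. f_m y m z t)"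
        "continuous_on_P2 (UNIV \<times> UNIV \<times> UNIV \<times> {0..<T}) (\<lambda>(y,z1,z2,t) m. f_mm y m z1 z2 t)"
        "continuous_on_P2 (UNIV \<times> UNIV \<times> {0..<T}) (\<lambda>(y,z,t) m. f_ym y m z t)"
    unfolding solves_measure_problem_def by (elim exE conjE) (rule that, assumption+)
  have cf: "continuous_on_P2 (UNIV \<times> {0..T}) (\<lambda>(y,t) m. f y (mean m) t)"
    and terminal: "\<forall>y. \<forall>m\<in>P2. f y (mean m) T = C (mean m)"
    using assms unfolding solves_measure_problem_def by blast+
  let ?d = "\<lambda>r::real. return borel r"
  note cf' = continuous_on_P2_diracD(1)[OF cf, unfolded mean_return]
  define Dm where "Dm = (\<lambda>y r t. f_m y (?d r) r t)"
  have cDm: "jointly_continuous {0..<T} Dm"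
    unfolding Dm_def by (rule continuous_on_P2_diracD(2)[OF cont(4)])
  have dm: "((\<lambda>x. f y x t) has_real_derivative Dm y r t) (at r)" if "t \<in> {0..<T}" for y r t
    using has_lions_derivative_dirac[of "\<lambda>m'. f y (mean m') t" "\<lambda>z. f_m y (?d r) z t" r]
      D[rule_format, OF return_in_P2[of r] that, of y] by (simp add: mean_return Dm_def)
  have f_m_dirac: "f_m y (?d r) z t = Dm y r t" if t: "t \<in> {0..<T}" for y r z t
  proof (rule lions_derivative_of_mean_at_dirac[where \<phi> = "\<lambda>x. f y x t" and x = "(y, z, t)"
        and D = "\<lambda>r. Dm y r t" and \<xi> = "\<lambda>m z. f_m y m z t", OF cont(4)])
    have "continuous_on UNIV (\<lambda>r. (y, r))" by (intro continuous_intros)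
    from continuous_on_compose2[OF continuous_on_slice_space[OF cDm t] this]
    show "isCont (\<lambda>r. Dm y r t) r" by (simp add: continuous_on_eq_continuous_at)
  qed (use t D dm in auto)
  have main: "\<forall>y r. \<forall>t\<in>{0..<T}.
           ((\<lambda>s. f y r s) has_real_derivative f_t y (?d r) t) (at t within {0..T}) \<and>
           ((\<lambda>x. f x r t) has_real_derivative f_y y (?d r) t) (at y) \<and>
           ((\<lambda>x. f y x t) has_real_derivative Dm y r t) (at r) \<and>
           ((\<lambda>x. f_y x (?d r) t) has_real_derivative f_yy y (?d r) t) (at y) \<and>
           ((\<lambda>x. f_y y (?d x) t) has_real_derivative f_ym y (?d r) r t) (at r) \<and>
           ((\<lambda>x. Dm y x t) has_real_derivative f_mm y (?d r) r r t) (at r) \<and>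
           1 - Dm y r t \<noteq> 0 \<and>
           f_t y (?d r) t
           + 1/2 * ((f_y y (?d r) t + c y t) / (1 - Dm y r t))\<^sup>2 * f_mm y (?d r) r r t
           + (f_y y (?d r) t + c y t) / (1 - Dm y r t) * f_ym y (?d r) r t
           + 1/2 * f_yy y (?d r) t = 0"
    (is "\<forall>y r. \<forall>t\<in>_. ?P y r t")
  proof (intro allI ballI)
    fix y r t assume t: "t \<in> {0..<T}"
    note D' = D[rule_format, OF return_in_P2[of r] t, of y]
    have meas: "(\<lambda>z. f_m y (?d r) z t) \<in> borel_measurable borel" "(\<lambda>z. f_ym y (?d r) z t) \<in> borel_measurable borel"
      using D' by (auto simp: has_lions_derivative_def)
    have measz: "(\<lambda>z. f_mz y (?d r) z t) \<in> borel_measurable borel"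
      using D' borel_measurable_integrable[of "?d r" "\<lambda>z. f_mz y (?d r) z t"] by simp
    have "((\<lambda>x. f_m y (?d r) x t) has_real_derivative f_mz y (?d r) r t) (at r)" using D' by blast
    then have "((\<lambda>x. Dm y r t) has_real_derivative f_mz y (?d r) r t) (at r)"
      by (simp add: f_m_dirac[OF t])
    then have mz: "f_mz y (?d r) r t = 0" by (rule DERIV_unique) simp
    have int: "(\<integral>z. f_m y (?d r) z t \<partial>?d r) = Dm y r t" "(\<integral>z. f_ym y (?d r) z t \<partial>?d r) = f_ym y (?d r) r t"
      "(\<integral>z. f_mz y (?d r) z t \<partial>?d r) = 0"
      using integral_return[of r borel, OF _ meas(1)] integral_return[of r borel, OF _ meas(2)]
        integral_return[of r borel, OF _ measz] by (simp_all add: Dm_def mz)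
    have int2: "(\<integral>(z1,z2). f_mm y (?d r) z1 z2 t \<partial>(?d r \<Otimes>\<^sub>M ?d r)) = f_mm y (?d r) r r t"
      using integral_product_dirac[of r "\<lambda>(z1,z2). f_mm y (?d r) z1 z2 t"] D' by simp
    from D' have Ly: "has_lions_derivative (\<lambda>m'. f_y y m' t) (\<lambda>z. f_ym y (?d r) z t) (?d r)"
      and Lm: "\<forall>z1. has_lions_derivative (\<lambda>m'. f_m y m' z1 t) (\<lambda>z2. f_mm y (?d r) z1 z2 t) (?d r)"
      by - (elim conjE, assumption)+
    have ym: "((\<lambda>x. f_y y (?d x) t) has_real_derivative f_ym y (?d r) r t) (at r)"
      by (rule has_lions_derivative_dirac[OF Ly])
    have "((\<lambda>x. f_m y (?d x) r t) has_real_derivative f_mm y (?d r) r r t) (at r)"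
      by (rule has_lions_derivative_dirac[OF Lm[THEN spec]])
    then have mm: "((\<lambda>x. Dm y x t) has_real_derivative f_mm y (?d r) r r t) (at r)"
      by (simp add: f_m_dirac[OF t])
    show "?P y r t"
      using D'[unfolded int int2 Let_def mean_return add_0_right] dm[OF t] ym mm by blast
  qed
  show ?thesis
    unfolding solves_reduced_problem_def
  proof (intro conjI, goal_cases)
    case 1
    show ?case by (rule cf')
  next
    case 2
    show ?case
      apply (rule exI[of _ "\<lambda>y r t. f_t y (?d r) t"])
      apply (rule exI[of _ "\<lambda>y r t. f_y y (?d r) t"])
      apply (rule exI[of _ Dm])
      apply (rule exI[of _ "\<lambda>y r t. f_yy y (?d r) t"])
      apply (rule exI[of _ "\<lambda>y r t. f_ym y (?d r) r t"])
      apply (rule exI[of _ "\<lambda>y r t. f_mm y (?d r) r r t"])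
      apply (intro conjI cDm continuous_on_P2_diracD(1)[OF cont(1)] continuous_on_P2_diracD(1)[OF cont(2)]
          continuous_on_P2_diracD(1)[OF cont(3)] continuous_on_P2_diracD(3)[OF cont(5)]
          continuous_on_P2_diracD(2)[OF cont(6)])
      apply (rule main)
      done
  next
    case 3
    show ?case using terminal return_in_P2 mean_return by metis
  qed
qed

section \<open>Heat kernel solutions as classical solutions\<close>

text \<open>With \<open>n i\<close> the normalised moment of order \<open>i\<close>, the solution is \<open>n 0\<close>.\<close>

lemma heat_kernel_solution_derivs:
  fixes m :: real
  assumes \<psi>: "tame \<psi>" and t: "0 \<le> t" "t < T"
  defines "n \<equiv> \<lambda>i y t. 1 / sqrt (2 * pi) * (1 / sqrt (T - t)) * gauss_moment T i \<psi> y m t"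
  shows "((\<lambda>s. heat_kernel_solution T (\<psi> m) y s) has_real_derivative
      n 0 y t / (2 * (T - t)) - n 2 y t / (2 * (T - t)\<^sup>2)) (at t within {0..T})"
    and "((\<lambda>x. heat_kernel_solution T (\<psi> m) x t) has_real_derivative n 1 y t / (T - t)) (at y)"
    and "((\<lambda>x. n 1 x t / (T - t)) has_real_derivative (- n 0 y t + n 2 y t / (T - t)) / (T - t)) (at y)"
proof -
  have sq: "sqrt (T - t) * sqrt (T - t) = T - t" "sqrt (T - t) > 0" using t by auto
  have ds: "((\<lambda>s. 1 / sqrt (2 * pi) * (1 / sqrt (T - s))) has_real_derivative
      1 / sqrt (2 * pi) * (1 / sqrt (T - t) / (2 * (T - t)))) (at t within {0..<T})"
    by (intro DERIV_cmult) (use t sq in \<open>auto intro!: derivative_eq_intros simp: divide_simps\<close>)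
  have dg: "((\<lambda>s. gauss_moment T 0 \<psi> y m s) has_real_derivative
      - gauss_moment T 2 \<psi> y m t / (2 * (T - t)\<^sup>2)) (at t within {0..<T})"
    using gauss_moment_deriv_t[OF \<psi> t, of 0, unfolded add_0_left] by (simp only: at_within_half_open[OF t(2)])
  have "((\<lambda>s. n 0 y s) has_real_derivative n 0 y t / (2 * (T - t)) - n 2 y t / (2 * (T - t)\<^sup>2)) (at t within {0..<T})"
    unfolding n_def by (rule DERIV_cong[OF DERIV_mult[OF ds dg]]) (simp add: mult_ac)
  then have "((\<lambda>s. heat_kernel_solution T (\<psi> m) y s) has_real_derivative
      n 0 y t / (2 * (T - t)) - n 2 y t / (2 * (T - t)\<^sup>2)) (at t within {0..<T})"
    by (rule has_real_derivative_transform) (use t in \<open>auto simp: n_def heat_kernel_solution_eq_moment\<close>)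
  then show "((\<lambda>s. heat_kernel_solution T (\<psi> m) y s) has_real_derivative
      n 0 y t / (2 * (T - t)) - n 2 y t / (2 * (T - t)\<^sup>2)) (at t within {0..T})"
    by (simp add: at_within_half_open[OF t(2)])
  have dn0: "((\<lambda>x. n 0 x t) has_real_derivative n 1 y t / (T - t)) (at y)"
    unfolding n_def by (rule DERIV_cong[OF DERIV_cmult[OF gauss_moment_deriv_y[OF \<psi> t]]]) simp
  then show "((\<lambda>x. heat_kernel_solution T (\<psi> m) x t) has_real_derivative n 1 y t / (T - t)) (at y)"
    using t by (simp add: n_def heat_kernel_solution_eq_moment)
  have "((\<lambda>x. n 1 x t) has_real_derivative - n 0 y t + n 2 y t / (T - t)) (at y)"
    unfolding n_def
    by (rule DERIV_cong[OF DERIV_cmult[OF gauss_moment_deriv_y[OF \<psi> t]]])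
      (simp add: numeral_2_eq_2 algebra_simps)
  then show "((\<lambda>x. n 1 x t / (T - t)) has_real_derivative (- n 0 y t + n 2 y t / (T - t)) / (T - t)) (at y)"
    by (rule DERIV_cdivide)
qed

lemma continuous_on_slice_parameter:
  assumes "jointly_continuous S f"
  shows "continuous_on (UNIV \<times> S) (\<lambda>(y,t). f y m t)"
proof -
  have "continuous_on (UNIV \<times> S) (\<lambda>p. (fst p, m, snd p))" by (intro continuous_intros)
  from continuous_on_compose2[OF assms this] show ?thesis by (simp add: split_def image_subset_iff)
qed

theorem heat_kernel_solution_backward_heat:
  assumes \<psi>: "tame \<psi>" and T: "0 < T"
  shows "backward_heat_solution T (\<lambda>y t. 0) (\<psi> m) (heat_kernel_solution T (\<psi> m))"
proof -
  define n where "n i y t = 1 / sqrt (2 * pi) * (1 / sqrt (T - t)) * gauss_moment T i \<psi> y m t" for i y t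
  have cn: "continuous_on (UNIV \<times> {0..<T}) (\<lambda>(y,t). n i y t)" for i
    unfolding n_def split_def
    by (intro continuous_intros continuous_on_slice_parameter[OF continuous_on_gauss_moment[OF \<psi> T], unfolded split_def]) auto
  note d = heat_kernel_solution_derivs[OF \<psi>, where m = m and T = T, folded n_def]
  let ?u_t = "\<lambda>y t. n 0 y t / (2 * (T - t)) - n 2 y t / (2 * (T - t)\<^sup>2)"
  let ?u_y = "\<lambda>y t. n 1 y t / (T - t)"
  let ?u_yy = "\<lambda>y t. (- n 0 y t + n 2 y t / (T - t)) / (T - t)"
  have pde: "?u_t y t + 1/2 * ?u_yy y t = 0" if "t < T" for y t
    using that by (simp add: divide_simps power2_eq_square) (simp add: algebra_simps)
  have main: "\<forall>y. \<forall>t\<in>{0..<T}. ((\<lambda>s. heat_kernel_solution T (\<psi> m) y s) has_real_derivative ?u_t y t) (at t within {0..T}) \<and>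
     ((\<lambda>x. heat_kernel_solution T (\<psi> m) x t) has_real_derivative ?u_y y t) (at y) \<and>
     ((\<lambda>x. ?u_y x t) has_real_derivative ?u_yy y t) (at y) \<and> ?u_t y t + 1/2 * ?u_yy y t = 0"
    (is "\<forall>y. \<forall>t\<in>_. ?P y t")
  proof (intro allI ballI)
    fix y t assume "t \<in> {0..<T}"
    then have t: "0 \<le> t" "t < T" by auto
    show "?P y t" by (intro conjI d(1)[OF t] d(2)[OF t] d(3)[OF t] pde[OF t(2)])
  qed
  have c: "continuous_on (UNIV \<times> {0..<T}) (\<lambda>(y,t). ?u_t y t)" "continuous_on (UNIV \<times> {0..<T}) (\<lambda>(y,t). ?u_y y t)"
    "continuous_on (UNIV \<times> {0..<T}) (\<lambda>(y,t). ?u_yy y t)"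
    unfolding split_def by (intro continuous_intros cn[unfolded split_def]; auto)+
  show ?thesis
    unfolding backward_heat_solution_def
  proof (intro conjI, goal_cases)
    case 1
    show ?case by (rule continuous_on_slice_parameter[OF continuous_on_heat_kernel_solution[OF \<psi>]])
  next
    case 2
    show ?case
      by (rule exI[of _ ?u_t], rule exI[of _ ?u_y], rule exI[of _ ?u_yy]) (intro conjI c main)
  next
    case 3
    show ?case by (simp add: heat_kernel_solution_def)
  qed
qed

lemma tame_no_parameter:
  assumes c: "continuous_on UNIV \<phi>" and b: "\<And>\<rho>. \<bar>\<phi> \<rho>\<bar> \<le> B * (1 + \<bar>\<rho>\<bar>)"
  shows "tame (\<lambda>m. \<phi>)"
proof -
  have B: "B \<ge> 0" using b[of 0] by simp
  have "\<bar>\<phi> \<rho>\<bar> \<le> B * exp \<bar>\<rho>\<bar>" for \<rho>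
    using b[of \<rho>] mult_left_mono[OF one_add_abs_le_exp[of \<rho>] B] by linarith
  moreover have "continuous_on UNIV (\<lambda>p::real\<times>real. \<phi> (snd p))"
    by (intro continuous_on_compose2[OF c] continuous_intros) auto
  ultimately show ?thesis unfolding tame_def by (auto simp: split_def)
qed

section \<open>Moments of a compactly supported exponential family\<close>

locale exponential_family = prob_space \<nu> for \<nu> :: "real measure" +
  fixes \<theta>1 \<theta>2 :: real
  assumes \<theta>: "0 < \<theta>1" "\<theta>1 < \<theta>2" and sets_\<nu> [measurable_cong]: "sets \<nu> = sets borel"
    and support: "AE \<theta> in \<nu>. \<theta> \<in> {\<theta>1..\<theta>2}"
begin

text \<open>The density, up to normalisation, of an exponential family of laws with parameter \<open>y\<close>, weighted by the \<open>j\<close>-th power.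
  Its integrals are the successive \<open>y\<close>-derivatives of \<open>F_of \<nu>\<close>.\<close>

definition tilted :: "nat \<Rightarrow> real \<Rightarrow> real \<Rightarrow> real \<Rightarrow> real" where
  "tilted j y t \<theta> = \<theta> ^ j * exp (y * \<theta> - 1/2 * \<theta>\<^sup>2 * t)"

definition F :: "nat \<Rightarrow> real \<Rightarrow> real \<Rightarrow> real" where
  "F j y t = (\<integral>\<theta>. tilted j y t \<theta> \<partial>\<nu>)"

lemma F_of_eq: "F_of \<nu> = F 0"
  by (simp add: F_of_def F_def tilted_def fun_eq_iff)

lemma measurable_tilted [measurable]: "tilted j y t \<in> borel_measurable \<nu>"
  unfolding tilted_def by measurable

lemma tilted_bounds:
  assumes "\<theta> \<in> {\<theta>1..\<theta>2}" "\<bar>y\<bar> \<le> Y" "\<bar>t\<bar> \<le> R"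
  shows "0 \<le> tilted j y t \<theta>" "\<bar>tilted j y t \<theta>\<bar> \<le> \<theta>2 ^ j * exp (Y * \<theta>2 + \<theta>2\<^sup>2 * R)"
    "exp (- (Y * \<theta>2 + \<theta>2\<^sup>2 * R)) \<le> tilted 0 y t \<theta>"
proof -
  have \<theta>': "0 \<le> \<theta>" "\<theta> \<le> \<theta>2" using assms(1) \<theta> by auto
  show pos: "0 \<le> tilted j y t \<theta>" using \<theta>' by (simp add: tilted_def)
  have "\<bar>y * \<theta>\<bar> \<le> Y * \<theta>2" unfolding abs_mult using assms \<theta>' by (intro mult_mono) auto
  moreover have "\<bar>\<theta>\<^sup>2 * t\<bar> \<le> \<theta>2\<^sup>2 * R"
    unfolding abs_mult using assms \<theta>' by (intro mult_mono) (auto intro: power_mono)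
  ultimately have e: "\<bar>y * \<theta> - 1/2 * \<theta>\<^sup>2 * t\<bar> \<le> Y * \<theta>2 + \<theta>2\<^sup>2 * R" by (simp add: abs_le_iff)
  then have "\<theta> ^ j * exp (y * \<theta> - 1/2 * \<theta>\<^sup>2 * t) \<le> \<theta>2 ^ j * exp (Y * \<theta>2 + \<theta>2\<^sup>2 * R)"
    using \<theta>' \<theta> by (intro mult_mono power_mono) auto
  then show "\<bar>tilted j y t \<theta>\<bar> \<le> \<theta>2 ^ j * exp (Y * \<theta>2 + \<theta>2\<^sup>2 * R)"
    using pos by (simp add: tilted_def)
  show "exp (- (Y * \<theta>2 + \<theta>2\<^sup>2 * R)) \<le> tilted 0 y t \<theta>"
    using e by (simp add: tilted_def)
qed

lemma integrable_tilted: "integrable \<nu> (tilted j y t)"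
proof (rule integrable_const_bound)
  show "AE \<theta> in \<nu>. norm (tilted j y t \<theta>) \<le> \<theta>2 ^ j * exp (\<bar>y\<bar> * \<theta>2 + \<theta>2\<^sup>2 * \<bar>t\<bar>)"
    using support by eventually_elim (use tilted_bounds(2)[OF _ order_refl order_refl] in auto)
qed simp

lemma F_deriv_y: "((\<lambda>y. F j y t) has_real_derivative F (Suc j) y t) (at y)"
proof -
  let ?w = "\<theta>2 ^ Suc j * exp ((\<bar>y\<bar> + 1) * \<theta>2 + \<theta>2\<^sup>2 * \<bar>t\<bar>)"
  have "((\<lambda>x. \<integral>\<theta>. tilted j x t \<theta> \<partial>\<nu>) has_real_derivative (\<integral>\<theta>. tilted (Suc j) y t \<theta> \<partial>\<nu>))
      (at y within {y-1..y+1})"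
  proof (rule has_real_derivative_integral_dominated)
    show "AE \<theta> in \<nu>. \<forall>x\<in>{y-1..y+1}. ((\<lambda>x. tilted j x t \<theta>) has_real_derivative tilted (Suc j) x t \<theta>)
        (at x within {y-1..y+1})"
      unfolding tilted_def by (intro AE_I2 ballI) (auto intro!: derivative_eq_intros)
    show "AE \<theta> in \<nu>. \<forall>x\<in>{y-1..y+1}. \<bar>tilted (Suc j) x t \<theta>\<bar> \<le> ?w"
      using support by eventually_elim (intro ballI tilted_bounds(2); auto)
  qed (auto intro: integrable_tilted)
  then show ?thesis by (simp add: F_def at_within_Icc_at)
qed

lemma F_deriv_t: "((\<lambda>t. F j y t) has_real_derivative - 1/2 * F (j + 2) y t) (at t)"
proof -
  let ?w = "1/2 * (\<theta>2 ^ (j + 2) * exp (\<bar>y\<bar> * \<theta>2 + \<theta>2\<^sup>2 * (\<bar>t\<bar> + 1)))"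
  have "((\<lambda>s. \<integral>\<theta>. tilted j y s \<theta> \<partial>\<nu>) has_real_derivative (\<integral>\<theta>. - 1/2 * tilted (j + 2) y t \<theta> \<partial>\<nu>))
      (at t within {t-1..t+1})"
  proof (rule has_real_derivative_integral_dominated)
    show "AE \<theta> in \<nu>. \<forall>s\<in>{t-1..t+1}. ((\<lambda>s. tilted j y s \<theta>) has_real_derivative - 1/2 * tilted (j + 2) y s \<theta>)
        (at s within {t-1..t+1})"
      unfolding tilted_def by (intro AE_I2 ballI) (auto intro!: derivative_eq_intros simp: power_add power2_eq_square)
    show "AE \<theta> in \<nu>. \<forall>s\<in>{t-1..t+1}. \<bar>- 1/2 * tilted (j + 2) y s \<theta>\<bar> \<le> ?w"
      using support
    proof eventually_elim
      case (elim \<theta>)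
      show ?case
      proof
        fix s assume "s \<in> {t-1..t+1}"
        then have "\<bar>s\<bar> \<le> \<bar>t\<bar> + 1" by auto
        from tilted_bounds(2)[OF elim order_refl this, of "j + 2" y]
        show "\<bar>- 1/2 * tilted (j + 2) y s \<theta>\<bar> \<le> ?w" unfolding abs_mult by simp
      qed
    qed
  qed (auto intro: integrable_tilted)
  then show ?thesis by (simp add: F_def at_within_Icc_at)
qed

lemma continuous_on_F: "continuous_on UNIV (\<lambda>(y,t). F j y t)"
  unfolding continuous_on_def
proof (rule ballI)
  fix p0 :: "real \<times> real"
  obtain y0 t0 where p0: "p0 = (y0, t0)" by (cases p0)
  let ?U = "ball y0 1 \<times> ball t0 1"
  have "((\<lambda>p. \<integral>\<theta>. tilted j (fst p) (snd p) \<theta> \<partial>\<nu>) \<longlongrightarrow> (\<integral>\<theta>. tilted j (fst p0) (snd p0) \<theta> \<partial>\<nu>)) (at p0 within ?U)"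
  proof (rule tendsto_integral_dominated)
    show "AE \<theta> in \<nu>. ((\<lambda>p. tilted j (fst p) (snd p) \<theta>) \<longlongrightarrow> tilted j (fst p0) (snd p0) \<theta>) (at p0 within ?U)"
      unfolding tilted_def by (intro AE_I2 tendsto_intros)
    show "AE \<theta> in \<nu>. \<forall>p\<in>?U. \<bar>tilted j (fst p) (snd p) \<theta>\<bar>
        \<le> \<theta>2 ^ j * exp ((\<bar>y0\<bar> + 1) * \<theta>2 + \<theta>2\<^sup>2 * (\<bar>t0\<bar> + 1))"
      using support by eventually_elim (intro ballI tilted_bounds(2); auto simp: dist_real_def)
  qed auto
  moreover have "at p0 within ?U = at p0" by (rule at_within_open) (auto simp: p0 open_Times)
  ultimately show "((\<lambda>(y,t). F j y t) \<longlongrightarrow> (\<lambda>(y,t). F j y t) p0) (at p0 within UNIV)"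
    by (simp add: F_def split_def)
qed

lemma F_0_bounds:
  assumes "\<bar>y\<bar> \<le> Y" "\<bar>t\<bar> \<le> R"
  shows "exp (- (Y * \<theta>2 + \<theta>2\<^sup>2 * R)) \<le> F 0 y t" "F 0 y t \<le> exp (Y * \<theta>2 + \<theta>2\<^sup>2 * R)"
proof -
  have "AE \<theta> in \<nu>. exp (- (Y * \<theta>2 + \<theta>2\<^sup>2 * R)) \<le> tilted 0 y t \<theta>"
    using support by eventually_elim (rule tilted_bounds(3)[OF _ assms])
  from integral_mono_AE[OF _ integrable_tilted this]
  show "exp (- (Y * \<theta>2 + \<theta>2\<^sup>2 * R)) \<le> F 0 y t" by (simp add: F_def prob_space)
  have "AE \<theta> in \<nu>. tilted 0 y t \<theta> \<le> exp (Y * \<theta>2 + \<theta>2\<^sup>2 * R)"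
    using support by eventually_elim (use tilted_bounds(2)[OF _ assms, of _ 0] in force)
  from integral_mono_AE[OF integrable_tilted _ this]
  show "F 0 y t \<le> exp (Y * \<theta>2 + \<theta>2\<^sup>2 * R)" by (simp add: F_def prob_space)
qed

lemma F_0_pos: "F 0 y t > 0"
  using F_0_bounds(1)[OF order_refl order_refl, of y t] by (rule less_le_trans[OF exp_gt_zero])

text \<open>The ratio is the \<open>j\<close>-th moment of a probability measure on \<open>[\<theta>1, \<theta>2]\<close>. In particular \<open>b_of \<nu>\<close>, the case \<open>j = 1\<close>, is
  bounded and bounded away from zero.\<close>

lemma F_ratio_bounds: "\<theta>1 ^ j \<le> F j y t / F 0 y t" "F j y t / F 0 y t \<le> \<theta>2 ^ j"
proof -
  have i: "integrable \<nu> (\<lambda>\<theta>. a * tilted 0 y t \<theta>)" for a by (simp add: integrable_tilted)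
  have "AE \<theta> in \<nu>. \<theta>1 ^ j * tilted 0 y t \<theta> \<le> tilted j y t \<theta>"
    using support by eventually_elim (use \<theta> in \<open>auto simp: tilted_def intro!: power_mono\<close>)
  from integral_mono_AE[OF i integrable_tilted this]
  have "\<theta>1 ^ j * F 0 y t \<le> F j y t" by (simp add: F_def)
  then show "\<theta>1 ^ j \<le> F j y t / F 0 y t" using F_0_pos[of y t] by (simp add: field_simps)
  have "AE \<theta> in \<nu>. tilted j y t \<theta> \<le> \<theta>2 ^ j * tilted 0 y t \<theta>"
    using support by eventually_elim (use \<theta> in \<open>auto simp: tilted_def intro!: power_mono\<close>)
  from integral_mono_AE[OF integrable_tilted i this]
  have "F j y t \<le> \<theta>2 ^ j * F 0 y t" by (simp add: F_def)
  then show "F j y t / F 0 y t \<le> \<theta>2 ^ j" using F_0_pos[of y t] by (simp add: field_simps)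
qed

lemma b_of_eq: "b_of \<nu> y t = F 1 y t / F 0 y t"
  unfolding b_of_def F_of_eq using DERIV_imp_deriv[OF F_deriv_y[of 0 t y]] by simp

lemma ln_F_deriv_y: "((\<lambda>y. ln (F 0 y t)) has_real_derivative F 1 y t / F 0 y t) (at y)"
  using F_0_pos[of y t] F_deriv_y[of 0 t y] by (auto intro!: derivative_eq_intros)

lemma ratio_deriv_y:
  "((\<lambda>y. F j y t / F 0 y t) has_real_derivative
    F (Suc j) y t / F 0 y t + (- 1) * (F j y t / F 0 y t * (F 1 y t / F 0 y t))) (at y)"
  by (rule DERIV_cong[OF DERIV_divide[OF F_deriv_y F_deriv_y]])
    (use F_0_pos[of y t] in \<open>auto simp: divide_simps\<close>)

lemma ln_F_deriv_t: "((\<lambda>t. ln (F 0 y t)) has_real_derivative - 1/2 * (F 2 y t / F 0 y t)) (at t)"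
  using F_0_pos[of y t] F_deriv_t[of 0 y t] by (auto intro!: derivative_eq_intros simp: numeral_2_eq_2)

lemma ln_F_bound:
  assumes "0 \<le> t" "t \<le> R"
  shows "\<bar>ln (F 0 y t)\<bar> \<le> \<theta>2\<^sup>2 * R + \<theta>2 * \<bar>y\<bar>"
proof -
  have t: "\<bar>t\<bar> \<le> R" using assms by simp
  have "ln (F 0 y t) \<le> \<bar>y\<bar> * \<theta>2 + \<theta>2\<^sup>2 * R"
    using F_0_bounds(2)[OF order_refl t, of y] F_0_pos[of y t] by (metis ln_exp ln_le_cancel_iff exp_gt_zero)
  moreover have "- (\<bar>y\<bar> * \<theta>2 + \<theta>2\<^sup>2 * R) \<le> ln (F 0 y t)"
    using F_0_bounds(1)[OF order_refl t, of y] F_0_pos[of y t] by (metis ln_exp ln_le_cancel_iff exp_gt_zero)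
  ultimately show ?thesis by (simp add: abs_le_iff algebra_simps)
qed

text \<open>The algebra generated by the normalised moments at a fixed time and the inverse of the first one.\<close>

inductive_set moment_algebra :: "real \<Rightarrow> (real \<Rightarrow> real) set" for t :: real where
  const: "(\<lambda>\<rho>. r) \<in> moment_algebra t"
| ratio: "(\<lambda>\<rho>. F j \<rho> t / F 0 \<rho> t) \<in> moment_algebra t"
| inverse_ratio: "(\<lambda>\<rho>. 1 / (F 1 \<rho> t / F 0 \<rho> t)) \<in> moment_algebra t"
| add: "A \<in> moment_algebra t \<Longrightarrow> B \<in> moment_algebra t \<Longrightarrow> (\<lambda>\<rho>. A \<rho> + B \<rho>) \<in> moment_algebra t"
| mult: "A \<in> moment_algebra t \<Longrightarrow> B \<in> moment_algebra t \<Longrightarrow> (\<lambda>\<rho>. A \<rho> * B \<rho>) \<in> moment_algebra t"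

lemma first_ratio_pos: "F 1 y t / F 0 y t > 0"
  using F_ratio_bounds(1)[of 1 y t] \<theta> by simp

lemma moment_algebra_bounded: "A \<in> moment_algebra t \<Longrightarrow> \<exists>B. \<forall>\<rho>. \<bar>A \<rho>\<bar> \<le> B"
proof (induction rule: moment_algebra.induct)
  case (ratio j)
  have "\<bar>F j \<rho> t / F 0 \<rho> t\<bar> \<le> \<theta>2 ^ j" for \<rho>
    by (rule abs_leI) (use F_ratio_bounds[of j \<rho> t] zero_le_power[of \<theta>1 j] zero_le_power[of \<theta>2 j] \<theta> in linarith)+
  then show ?case by blast
next
  case inverse_ratio
  have "\<bar>1 / (F 1 \<rho> t / F 0 \<rho> t)\<bar> \<le> 1 / \<theta>1" for \<rho>
    using frac_le[OF zero_le_one order_refl \<theta>(1), of "F 1 \<rho> t / F 0 \<rho> t"] F_ratio_bounds(1)[of 1 \<rho> t] first_ratio_pos[of \<rho> t]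
    by (simp only: abs_of_pos zero_less_divide_1_iff power_one_right)
  then show ?case by blast
next
  case (add A B)
  then obtain a b where "\<And>\<rho>. \<bar>A \<rho>\<bar> \<le> a" "\<And>\<rho>. \<bar>B \<rho>\<bar> \<le> b" by blast
  then have "\<bar>A \<rho> + B \<rho>\<bar> \<le> a + b" for \<rho> by (meson abs_triangle_ineq add_mono order_trans)
  then show ?case by blast
next
  case (mult A B)
  then obtain a b where ab: "\<And>\<rho>. \<bar>A \<rho>\<bar> \<le> a" "\<And>\<rho>. \<bar>B \<rho>\<bar> \<le> b" by blast
  have "0 \<le> a" using ab(1)[of 0] by simp
  with ab have "\<bar>A \<rho> * B \<rho>\<bar> \<le> a * b" for \<rho> unfolding abs_mult by (intro mult_mono) auto
  then show ?case by blast
qed auto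

lemma moment_algebra_deriv:
  "A \<in> moment_algebra t \<Longrightarrow> \<exists>A'\<in>moment_algebra t. \<forall>\<rho>. (A has_real_derivative A' \<rho>) (at \<rho>)"
proof (induction rule: moment_algebra.induct)
  case (const r)
  show ?case by (rule bexI[OF _ moment_algebra.const[of 0]]) auto
next
  case (ratio j)
  show ?case
    by (rule bexI[OF _ moment_algebra.add[OF moment_algebra.ratio moment_algebra.mult[OF moment_algebra.const
          moment_algebra.mult[OF moment_algebra.ratio moment_algebra.ratio]]]])
      (rule allI, rule ratio_deriv_y)
next
  case inverse_ratio
  let ?r = "\<lambda>j \<rho>. F j \<rho> t / F 0 \<rho> t"
  let ?A = "\<lambda>\<rho>. (- 1) * ((1 / ?r 1 \<rho>) * ((1 / ?r 1 \<rho>) * (?r 2 \<rho> + (- 1) * (?r 1 \<rho> * ?r 1 \<rho>))))"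
  have mem: "?A \<in> moment_algebra t"
    by (rule moment_algebra.mult[OF moment_algebra.const moment_algebra.mult[OF moment_algebra.inverse_ratio
          moment_algebra.mult[OF moment_algebra.inverse_ratio moment_algebra.add[OF moment_algebra.ratio
          moment_algebra.mult[OF moment_algebra.const moment_algebra.mult[OF moment_algebra.ratio moment_algebra.ratio]]]]]])
  have d: "((\<lambda>\<rho>. 1 / ?r 1 \<rho>) has_real_derivative ?A \<rho>) (at \<rho>)" for \<rho>
  proof -
    have "?r 1 \<rho> \<noteq> 0" by (rule not_sym[OF less_imp_neq[OF first_ratio_pos]])
    from DERIV_divide[OF DERIV_const ratio_deriv_y this, of 1]
    moreover have "(0 * x - 1 * d) / (x * x) = (- 1) * ((1 / x) * ((1 / x) * d))" for x d :: real by simp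
    ultimately show ?thesis by (simp only: Suc_1)
  qed
  show ?case by (rule bexI[OF allI mem], rule d)
next
  case (add A B)
  then obtain A' B' where "A' \<in> moment_algebra t" "\<And>\<rho>. (A has_real_derivative A' \<rho>) (at \<rho>)"
    "B' \<in> moment_algebra t" "\<And>\<rho>. (B has_real_derivative B' \<rho>) (at \<rho>)" by blast
  then show ?case
    by (intro bexI[of _ "\<lambda>\<rho>. A' \<rho> + B' \<rho>"] allI DERIV_add moment_algebra.add)
next
  case (mult A B)
  then obtain A' B' where *: "A' \<in> moment_algebra t" "\<And>\<rho>. (A has_real_derivative A' \<rho>) (at \<rho>)"
    "B' \<in> moment_algebra t" "\<And>\<rho>. (B has_real_derivative B' \<rho>) (at \<rho>)" by blast
  have "(\<lambda>\<rho>. A' \<rho> * B \<rho> + B' \<rho> * A \<rho>) \<in> moment_algebra t"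
    by (rule moment_algebra.add[OF moment_algebra.mult moment_algebra.mult]; fact)
  with *(2,4) show ?case
    by (intro bexI[of _ "\<lambda>\<rho>. A' \<rho> * B \<rho> + B' \<rho> * A \<rho>"] allI DERIV_mult)
qed

lemma gaussian_level_ln_F:
  assumes T: "0 < T" and Q: "\<And>\<rho>. Q \<rho> = ln (F 0 \<rho> T) - r"
  shows "gaussian_level T Q (\<lambda>\<rho>. F 1 \<rho> T / F 0 \<rho> T) (moment_algebra T)"
proof
  show "(Q has_real_derivative F 1 \<rho> T / F 0 \<rho> T) (at \<rho>)" for \<rho>
    unfolding Q[abs_def] by (rule DERIV_cong[OF DERIV_diff[OF ln_F_deriv_y DERIV_const]]) simp
  show "(\<lambda>\<rho>. A \<rho> / (F 1 \<rho> T / F 0 \<rho> T)) \<in> moment_algebra T" if "A \<in> moment_algebra T" for A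
    using moment_algebra.mult[OF that moment_algebra.inverse_ratio] by simp
qed (auto intro: T first_ratio_pos moment_algebra.const moment_algebra.ratio
      moment_algebra_bounded moment_algebra_deriv simp del: One_nat_def)

end

section \<open>The functions k, c and q\<close>

lemma abs_le_exp_square: "1 + \<bar>y\<bar> \<le> 2 * exp (y\<^sup>2)" for y :: real
proof -
  have "0 \<le> (\<bar>y\<bar> - 1)\<^sup>2" by simp
  then have "2 * \<bar>y\<bar> \<le> 1 + y\<^sup>2" by (simp add: power2_diff)
  moreover have "1 + y\<^sup>2 \<le> exp (y\<^sup>2)" by (rule exp_ge_add_one_self)
  ultimately show ?thesis by (smt (verit) zero_le_power2)
qed

context exponential_family
begin

definition log_heat :: "real \<Rightarrow> real \<Rightarrow> real \<Rightarrow> real" where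
  "log_heat T = heat_kernel_solution T (\<lambda>\<rho>. ln (F 0 \<rho> T))"

lemma continuous_on_F_ratio: "continuous_on UNIV (\<lambda>\<rho>. F j \<rho> t / F 0 \<rho> t)"
  by (rule DERIV_continuous_on) (rule ratio_deriv_y)

lemma continuous_on_ln_F: "continuous_on UNIV (\<lambda>\<rho>. ln (F 0 \<rho> t))"
  by (rule DERIV_continuous_on) (rule ln_F_deriv_y)

lemma ln_F_linear: "0 \<le> t \<Longrightarrow> \<bar>ln (F 0 \<rho> t)\<bar> \<le> (\<theta>2\<^sup>2 * t + \<theta>2) * (1 + \<bar>\<rho>\<bar>)"
proof -
  assume t: "0 \<le> t"
  have "\<bar>ln (F 0 \<rho> t)\<bar> \<le> \<theta>2\<^sup>2 * t + \<theta>2 * \<bar>\<rho>\<bar>" by (rule ln_F_bound[OF t order_refl])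
  also have "\<dots> \<le> (\<theta>2\<^sup>2 * t + \<theta>2) * (1 + \<bar>\<rho>\<bar>)" using \<theta> t by (simp add: algebra_simps)
  finally show ?thesis .
qed

lemma tame_ln_F: "0 \<le> t \<Longrightarrow> tame (\<lambda>m \<rho>. ln (F 0 \<rho> t))"
  by (rule tame_no_parameter[OF continuous_on_ln_F ln_F_linear])

lemma log_heat_linear:
  assumes "0 \<le> t" "t \<le> T"
  shows "\<bar>log_heat T y t\<bar> \<le> (\<theta>2\<^sup>2 * T + \<theta>2 * sqrt T + \<theta>2) * (1 + \<bar>y\<bar>)"
proof -
  have T: "0 \<le> T" using assms by simp
  have "\<bar>log_heat T y t\<bar> \<le> \<theta>2\<^sup>2 * T + \<theta>2 * \<bar>y\<bar> + \<theta>2 * sqrt T"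
    unfolding log_heat_def
    by (rule heat_kernel_solution_linear_growth[OF continuous_on_ln_F ln_F_bound[OF T order_refl] _ assms])
      (use \<theta> in simp)
  also have "\<dots> \<le> (\<theta>2\<^sup>2 * T + \<theta>2 * sqrt T + \<theta>2) * (1 + \<bar>y\<bar>)"
    using \<theta> T by (simp add: algebra_simps)
  finally show ?thesis .
qed

text \<open>By the Hopf-Cole transformation \<open>ln F\<close> solves the equation of \<open>k\<close> with the opposite sign of the
  source, so that \<open>k + ln F\<close> solves the heat equation.\<close>

lemma bounded_solution_eq:
  assumes T: "0 < T"
    and k: "backward_heat_solution T (\<lambda>y t. 1/2 * (b_of \<nu> y t)\<^sup>2) (\<lambda>y. 0) k"
    and bounded: "\<And>y t. 0 \<le> t \<Longrightarrow> t \<le> T \<Longrightarrow> \<bar>k y t\<bar> \<le> B"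
    and t: "0 \<le> t" "t \<le> T"
  shows "k y t = log_heat T y t - ln (F 0 y t)"
proof -
  have T0: "0 \<le> T" using T by simp
  from k obtain k_t k_y k_yy where
    k: "\<forall>y. \<forall>t\<in>{0..<T}. ((\<lambda>s. k y s) has_real_derivative k_t y t) (at t within {0..T}) \<and>
       ((\<lambda>x. k x t) has_real_derivative k_y y t) (at y) \<and>
       ((\<lambda>x. k_y x t) has_real_derivative k_yy y t) (at y) \<and>
       k_t y t + 1/2 * k_yy y t = 1/2 * (b_of \<nu> y t)\<^sup>2" and
    ck: "continuous_on (UNIV \<times> {0..T}) (\<lambda>(y,t). k y t)" and kT: "\<forall>y. k y T = 0"
    unfolding backward_heat_solution_def by blast
  from heat_kernel_solution_backward_heat[OF tame_ln_F[OF T0] T, folded log_heat_def] obtain u_t u_y u_yy where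
    u: "\<forall>y. \<forall>t\<in>{0..<T}. ((\<lambda>s. log_heat T y s) has_real_derivative u_t y t) (at t within {0..T}) \<and>
       ((\<lambda>x. log_heat T x t) has_real_derivative u_y y t) (at y) \<and>
       ((\<lambda>x. u_y x t) has_real_derivative u_yy y t) (at y) \<and> u_t y t + 1/2 * u_yy y t = 0" and
    cu: "continuous_on (UNIV \<times> {0..T}) (\<lambda>(y,t). log_heat T y t)" and
    uT: "\<forall>y. log_heat T y T = ln (F 0 y T)"
    unfolding backward_heat_solution_def by blast
  let ?r = "\<lambda>j y t. F j y t / F 0 y t"
  have "k y t - (log_heat T y t - ln (F 0 y t)) = 0"
  proof (rule backward_heat_unique[where T = T and w = "\<lambda>y t. k y t - (log_heat T y t - ln (F 0 y t))"
        and w_t = "\<lambda>y t. k_t y t - (u_t y t - (- 1/2 * ?r 2 y t))"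
        and w_y = "\<lambda>y t. k_y y t - (u_y y t - ?r 1 y t)"
        and w_yy = "\<lambda>y t. k_yy y t - (u_yy y t - (?r 2 y t + (- 1) * (?r 1 y t * ?r 1 y t)))"
        and K = "2 * (B + (\<theta>2\<^sup>2 * T + \<theta>2 * sqrt T + \<theta>2) + (\<theta>2\<^sup>2 * T + \<theta>2))" and L = 1])
    have "continuous_on (UNIV \<times> {0..T}) (\<lambda>p. ln (F 0 (fst p) (snd p)))"
      using continuous_on_subset[OF continuous_on_F[of 0], of "UNIV \<times> {0..T}"] F_0_pos
      unfolding split_def by (intro continuous_on_ln) (auto simp: less_imp_neq[OF F_0_pos, THEN not_sym])
    then show "continuous_on (UNIV \<times> {0..T}) (\<lambda>(y,t). k y t - (log_heat T y t - ln (F 0 y t)))"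
      using ck cu unfolding split_def by (intro continuous_on_diff)
    fix y t :: real
    show "k y T - (log_heat T y T - ln (F 0 y T)) = 0" using kT uT by simp
    {
      assume t: "0 \<le> t" "t < T"
      then have t': "t \<in> {0..<T}" by simp
      note kd = k[rule_format, OF t', of y] and ud = u[rule_format, OF t', of y]
      show "((\<lambda>t. k y t - (log_heat T y t - ln (F 0 y t))) has_real_derivative
          k_t y t - (u_t y t - (- 1/2 * ?r 2 y t))) (at t within {0..T})"
        by (intro DERIV_diff has_field_derivative_at_within[OF ln_F_deriv_t]) (use kd ud in blast)+
      show "((\<lambda>x. k x t - (log_heat T x t - ln (F 0 x t))) has_real_derivative
          k_y y t - (u_y y t - ?r 1 y t)) (at y)"
        by (intro DERIV_diff ln_F_deriv_y) (use kd ud in blast)+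
      have r: "((\<lambda>x. ?r 1 x t) has_real_derivative ?r 2 y t + (- 1) * (?r 1 y t * ?r 1 y t)) (at y)"
        using ratio_deriv_y[of 1 t y] by (simp only: Suc_1)
      show "((\<lambda>x. k_y x t - (u_y x t - ?r 1 x t)) has_real_derivative
          k_yy y t - (u_yy y t - (?r 2 y t + (- 1) * (?r 1 y t * ?r 1 y t)))) (at y)"
        by (intro DERIV_diff r) (use kd ud in blast)+
      show "k_t y t - (u_t y t - - 1 / 2 * ?r 2 y t)
          + 1 / 2 * (k_yy y t - (u_yy y t - (?r 2 y t + (- 1) * (?r 1 y t * ?r 1 y t)))) = 0"
        using kd ud b_of_eq[of y t] by (simp add: power2_eq_square algebra_simps)
    }
    {
      assume t: "0 \<le> t" "t \<le> T"
      have B: "B \<ge> 0" using bounded[OF t, of y] by simp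
      have ln: "\<bar>ln (F 0 y t)\<bar> \<le> (\<theta>2\<^sup>2 * T + \<theta>2) * (1 + \<bar>y\<bar>)"
      proof -
        have "\<theta>2\<^sup>2 * T + \<theta>2 * \<bar>y\<bar> \<le> (\<theta>2\<^sup>2 * T + \<theta>2) * (1 + \<bar>y\<bar>)" using \<theta> T by (simp add: algebra_simps)
        with ln_F_bound[OF t, of y] show ?thesis by linarith
      qed
      have "\<bar>k y t - (log_heat T y t - ln (F 0 y t))\<bar> \<le> \<bar>k y t\<bar> + \<bar>log_heat T y t\<bar> + \<bar>ln (F 0 y t)\<bar>" by linarith
      also have "\<dots> \<le> B * (1 + \<bar>y\<bar>) + (\<theta>2\<^sup>2 * T + \<theta>2 * sqrt T + \<theta>2) * (1 + \<bar>y\<bar>) + (\<theta>2\<^sup>2 * T + \<theta>2) * (1 + \<bar>y\<bar>)"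
        by (intro add_mono ln log_heat_linear t order_trans[OF bounded[OF t]])
          (use B in \<open>simp add: algebra_simps\<close>)
      also have "\<dots> = (B + (\<theta>2\<^sup>2 * T + \<theta>2 * sqrt T + \<theta>2) + (\<theta>2\<^sup>2 * T + \<theta>2)) * (1 + \<bar>y\<bar>)"
        by (simp add: algebra_simps)
      also have "\<dots> \<le> (B + (\<theta>2\<^sup>2 * T + \<theta>2 * sqrt T + \<theta>2) + (\<theta>2\<^sup>2 * T + \<theta>2)) * (2 * exp (y\<^sup>2))"
        using B \<theta> T by (intro mult_left_mono abs_le_exp_square) auto
      finally show "\<bar>k y t - (log_heat T y t - ln (F 0 y t))\<bar>
          \<le> 2 * (B + (\<theta>2\<^sup>2 * T + \<theta>2 * sqrt T + \<theta>2) + (\<theta>2\<^sup>2 * T + \<theta>2)) * exp (1 * y\<^sup>2)"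
        by (simp only: mult_1_left mult.assoc mult.left_commute[of _ "2::real"])
    }
  qed (use t in simp_all)
  then show ?thesis by simp
qed

lemma ratio_exp_bound:
  shows "\<bar>F j \<rho> t / F 0 \<rho> t\<bar> \<le> \<theta>2 ^ j"
    and "\<bar>F 2 \<rho> t / F 0 \<rho> t + (- 1) * (F 1 \<rho> t / F 0 \<rho> t * (F 1 \<rho> t / F 0 \<rho> t))\<bar> \<le> 2 * \<theta>2\<^sup>2"
proof -
  have a: "\<bar>F j \<rho> t / F 0 \<rho> t\<bar> \<le> \<theta>2 ^ j" for j
    by (rule abs_leI) (use F_ratio_bounds[of j \<rho> t] zero_le_power[of \<theta>1 j] zero_le_power[of \<theta>2 j] \<theta> in linarith)+
  show "\<bar>F j \<rho> t / F 0 \<rho> t\<bar> \<le> \<theta>2 ^ j" by (rule a)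
  have "\<bar>F 1 \<rho> t / F 0 \<rho> t * (F 1 \<rho> t / F 0 \<rho> t)\<bar> \<le> \<theta>2 * \<theta>2"
    unfolding abs_mult using a[of 1] \<theta> by (intro mult_mono) auto
  with a[of 2] show "\<bar>F 2 \<rho> t / F 0 \<rho> t + (- 1) * (F 1 \<rho> t / F 0 \<rho> t * (F 1 \<rho> t / F 0 \<rho> t))\<bar> \<le> 2 * \<theta>2\<^sup>2"
    unfolding power2_eq_square by linarith
qed

lemma log_heat_deriv_y:
  assumes "0 \<le> t" "t \<le> T"
  shows "((\<lambda>x. log_heat T x t) has_real_derivative
      heat_kernel_solution T (\<lambda>\<rho>. F 1 \<rho> T / F 0 \<rho> T) y t) (at y)"
    and "((\<lambda>x. heat_kernel_solution T (\<lambda>\<rho>. F 1 \<rho> T / F 0 \<rho> T) x t) has_real_derivative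
      heat_kernel_solution T (\<lambda>\<rho>. F 2 \<rho> T / F 0 \<rho> T + (- 1) * (F 1 \<rho> T / F 0 \<rho> T * (F 1 \<rho> T / F 0 \<rho> T))) y t) (at y)"
proof -
  have T: "0 \<le> T" using assms by simp
  have le: "x \<le> x * exp \<bar>\<rho>\<bar>" if "0 \<le> x" for x \<rho> :: real
    using mult_left_mono[OF one_le_exp_iff[THEN iffD2, OF abs_ge_zero] that, of \<rho>] by simp
  have lnb: "\<bar>ln (F 0 \<rho> T)\<bar> \<le> (\<theta>2\<^sup>2 * T + \<theta>2) * exp \<bar>\<rho>\<bar>" for \<rho>
    by (rule order_trans[OF ln_F_linear[OF T]]) (use \<theta> T one_add_abs_le_exp in \<open>intro mult_left_mono; simp\<close>)
  have b1: "\<bar>F 1 \<rho> T / F 0 \<rho> T\<bar> \<le> D * exp \<bar>\<rho>\<bar>" if "\<theta>2 \<le> D" for \<rho> D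
    by (rule order_trans[OF ratio_exp_bound(1)[of 1]], rule order_trans[OF _ le]) (use \<theta> that in auto)
  have c2: "continuous_on UNIV (\<lambda>\<rho>. F 2 \<rho> T / F 0 \<rho> T + (- 1) * (F 1 \<rho> T / F 0 \<rho> T * (F 1 \<rho> T / F 0 \<rho> T)))"
    by (intro continuous_on_add continuous_on_mult continuous_on_const continuous_on_F_ratio)
  have T2: "\<theta>2 \<le> \<theta>2\<^sup>2 * T + \<theta>2" using T by simp
  show "((\<lambda>x. log_heat T x t) has_real_derivative
      heat_kernel_solution T (\<lambda>\<rho>. F 1 \<rho> T / F 0 \<rho> T) y t) (at y)"
    unfolding log_heat_def
    by (rule heat_kernel_solution_deriv[OF ln_F_deriv_y continuous_on_F_ratio lnb b1[OF T2] assms(2)])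
  have b2: "\<bar>F 2 \<rho> T / F 0 \<rho> T + (- 1) * (F 1 \<rho> T / F 0 \<rho> T * (F 1 \<rho> T / F 0 \<rho> T))\<bar>
      \<le> (2 * \<theta>2\<^sup>2 + \<theta>2) * exp \<bar>\<rho>\<bar>" for \<rho>
    by (rule order_trans[OF ratio_exp_bound(2)], rule order_trans[OF _ le]) (use \<theta> in auto)
  have T3: "\<theta>2 \<le> 2 * \<theta>2\<^sup>2 + \<theta>2" by simp
  show "((\<lambda>x. heat_kernel_solution T (\<lambda>\<rho>. F 1 \<rho> T / F 0 \<rho> T) x t) has_real_derivative
      heat_kernel_solution T (\<lambda>\<rho>. F 2 \<rho> T / F 0 \<rho> T + (- 1) * (F 1 \<rho> T / F 0 \<rho> T * (F 1 \<rho> T / F 0 \<rho> T))) y t) (at y)"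
    by (rule heat_kernel_solution_deriv[OF ratio_deriv_y[of 1, unfolded Suc_1] c2 b1[OF T3] b2 assms(2)])
qed

text \<open>The \<open>y\<close>-derivatives of \<open>ln F\<close> in \<open>b_of\<close> and in \<open>k\<close> cancel.\<close>

lemma c_of_eq:
  assumes k: "\<And>y t. 0 \<le> t \<Longrightarrow> t \<le> T \<Longrightarrow> k y t = log_heat T y t - ln (F 0 y t)"
    and t: "0 \<le> t" "t \<le> T"
  shows "c_of \<nu> k y t = heat_kernel_solution T (\<lambda>\<rho>. F 1 \<rho> T / F 0 \<rho> T) y t"
proof -
  have "((\<lambda>x. k x t) has_real_derivative
      heat_kernel_solution T (\<lambda>\<rho>. F 1 \<rho> T / F 0 \<rho> T) y t - F 1 y t / F 0 y t) (at y)"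
    unfolding k[OF t] by (intro DERIV_diff log_heat_deriv_y ln_F_deriv_y t)
  then show ?thesis
    unfolding c_of_def b_of_eq by (simp add: DERIV_imp_deriv)
qed

text \<open>The space integral of \<open>c\<close>, a \<open>y\<close>-derivative of \<open>log_heat T\<close>, gives its increment from \<open>0\<close> to \<open>y\<close> at time \<open>t\<close>. By the heat
  equation the time integral gives the increment at \<open>y = 0\<close> from time \<open>0\<close> to \<open>t\<close>. So \<open>q_of\<close> is \<open>log_heat T\<close> up to a
  constant, and in particular solves the heat equation.\<close>

lemma q_of_eq:
  assumes T: "0 < T" and k: "\<And>y t. 0 \<le> t \<Longrightarrow> t \<le> T \<Longrightarrow> k y t = log_heat T y t - ln (F 0 y t)"
    and t: "0 \<le> t" "t \<le> T"
  shows "q_of \<nu> k y t = log_heat T y t - log_heat T 0 0"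
proof -
  have T0: "0 \<le> T" using T by simp
  let ?u = "log_heat T"
  let ?c = "heat_kernel_solution T (\<lambda>\<rho>. F 1 \<rho> T / F 0 \<rho> T)"
  let ?d = "\<lambda>\<rho>. F 2 \<rho> T / F 0 \<rho> T + (- 1) * (F 1 \<rho> T / F 0 \<rho> T * (F 1 \<rho> T / F 0 \<rho> T))"
  let ?c' = "heat_kernel_solution T ?d"
  have c: "c_of \<nu> k y s = ?c y s" if "0 \<le> s" "s \<le> T" for y s by (rule c_of_eq[OF k that])
  have "(LBINT \<rho>=ereal 0..ereal y. c_of \<nu> k \<rho> t) = ?u y t - ?u 0 t"
  proof (rule interval_integral_FTC_finite)
    have "continuous_on UNIV (\<lambda>\<rho>. ?c \<rho> t)"
      using log_heat_deriv_y(2)[OF t] by (meson DERIV_isCont continuous_at_imp_continuous_on)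
    then show "continuous_on {min 0 y..max 0 y} (\<lambda>\<rho>. c_of \<nu> k \<rho> t)"
      unfolding c[OF t] by (rule continuous_on_subset) simp
    show "((\<lambda>y. ?u y t) has_vector_derivative c_of \<nu> k x t) (at x within {min 0 y..max 0 y})" for x
      unfolding c[OF t] using log_heat_deriv_y(1)[OF t, of x]
      by (simp add: has_real_derivative_iff_has_vector_derivative has_vector_derivative_at_within)
  qed
  moreover have "(LBINT s=ereal 0..ereal t. deriv (\<lambda>x. c_of \<nu> k x s) 0) = - 2 * ?u 0 t - (- 2 * ?u 0 0)"
  proof (cases "t = 0")
    case False
    then have t0: "0 < t" using t by simp
    have "(LBINT s=ereal 0..ereal t. deriv (\<lambda>x. c_of \<nu> k x s) 0) = (LBINT s=ereal 0..ereal t. ?c' 0 s)"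
    proof (rule interval_integral_cong)
      fix s assume "s \<in> einterval (min (ereal 0) (ereal t)) (max (ereal 0) (ereal t))"
      then have s: "0 \<le> s" "s \<le> T" using t0 t by (auto simp: einterval_iff min_def max_def)
      show "deriv (\<lambda>x. c_of \<nu> k x s) 0 = ?c' 0 s"
        unfolding c[OF s] by (rule DERIV_imp_deriv[OF log_heat_deriv_y(2)[OF s]])
    qed
    also have "\<dots> = - 2 * ?u 0 t - (- 2 * ?u 0 0)"
    proof (rule interval_integral_FTC_integrable[where F = "\<lambda>s. - 2 * ?u 0 s"])
      have "tame (\<lambda>m. ?d)"
      proof (rule tame_no_parameter)
        show "continuous_on UNIV ?d"
          by (intro continuous_on_add continuous_on_mult continuous_on_const continuous_on_F_ratio)
        have "2 * \<theta>2\<^sup>2 \<le> 2 * \<theta>2\<^sup>2 * (1 + \<bar>\<rho>\<bar>)" for \<rho> by (simp add: algebra_simps)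
        then show "\<bar>?d \<rho>\<bar> \<le> 2 * \<theta>2\<^sup>2 * (1 + \<bar>\<rho>\<bar>)" for \<rho>
          using ratio_exp_bound(2)[of \<rho> T] by (rule_tac order_trans) auto
      qed
      from continuous_on_slice_time[OF continuous_on_heat_kernel_solution[OF this], where y = 0]
      have cc: "continuous_on ({0..T} \<times> UNIV) (\<lambda>(s,m::real). ?c' 0 s)" .
      have "continuous_on {0..T} (\<lambda>s. (s, 0::real))" by (intro continuous_intros)
      from continuous_on_compose2[OF cc this] have cc': "continuous_on {0..T} (?c' 0)" by auto
      have u: "continuous_on {0..T} (?u 0)"
      proof -
        have cu: "continuous_on ({0..T} \<times> UNIV) (\<lambda>(s,m::real). ?u 0 s)"
          using continuous_on_slice_time[OF continuous_on_heat_kernel_solution[OF tame_ln_F[OF T0]], where y = 0]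
          by (simp add: log_heat_def)
        have "continuous_on {0..T} (\<lambda>s. (s, 0::real))" by (intro continuous_intros)
        from continuous_on_compose2[OF cu this] show ?thesis by auto
      qed
      show "ereal 0 < ereal t" using t0 by simp
      show "((\<lambda>s. - 2 * ?u 0 s) has_vector_derivative ?c' 0 s) (at s)" if "ereal 0 < ereal s" "ereal s < ereal t" for s
      proof -
        have s: "0 < s" "s < T" using that t by auto
        from heat_kernel_solution_backward_heat[OF tame_ln_F[OF T0] T, folded log_heat_def] obtain u_t u_y u_yy where
          u: "\<forall>y. \<forall>t\<in>{0..<T}. ((\<lambda>s. ?u y s) has_real_derivative u_t y t) (at t within {0..T}) \<and>
             ((\<lambda>x. ?u x t) has_real_derivative u_y y t) (at y) \<and>
             ((\<lambda>x. u_y x t) has_real_derivative u_yy y t) (at y) \<and> u_t y t + 1/2 * u_yy y t = 0"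
          unfolding backward_heat_solution_def by blast
        have s': "s \<in> {0..<T}" "0 \<le> s" "s \<le> T" using s by auto
        have "u_y x s = ?c x s" for x
          using u[rule_format, OF s'(1), of x] log_heat_deriv_y(1)[OF s'(2,3), of x] by (blast intro: DERIV_unique)
        then have "u_yy 0 s = ?c' 0 s"
          using u[rule_format, OF s'(1), of 0] log_heat_deriv_y(2)[OF s'(2,3), of 0]
          by (auto intro: DERIV_unique)
        moreover have "at s within {0..T} = at s" using s by (simp add: at_within_Icc_at)
        ultimately have "(?u 0 has_real_derivative - 1/2 * ?c' 0 s) (at s)"
          using u[rule_format, OF s'(1), of 0] by (auto simp: eq_neg_iff_add_eq_0 elim!: DERIV_cong)
        from DERIV_cmult[OF this, of "- 2"]
        show ?thesis by (simp add: has_real_derivative_iff_has_vector_derivative)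
      qed
      show "isCont (?c' 0) s" if "ereal 0 < ereal s" "ereal s < ereal t" for s
        by (rule continuous_on_interior[OF cc']) (use that t in auto)
      have "set_integrable lborel {0..t} (?c' 0)"
        by (rule borel_integrable_atLeastAtMost') (rule continuous_on_subset[OF cc'], use t in auto)
      then show "set_integrable lborel (einterval (ereal 0) (ereal t)) (?c' 0)"
        by (rule set_integrable_subset) (auto simp: einterval_iff)
      have lim: "((\<lambda>s. - 2 * ?u 0 s) \<longlongrightarrow> - 2 * ?u 0 a) (at a within {0..T})" if "a \<in> {0..T}" for a
        using u that by (intro tendsto_intros) (auto simp: continuous_on_def)
      have "at_right 0 = at 0 within {0..t}" "at_left t = at t within {0..t}"
        using t0 by (simp_all add: at_within_Icc_at_right at_within_Icc_at_left)
      then have "((\<lambda>s. - 2 * ?u 0 s) \<longlongrightarrow> - 2 * ?u 0 0) (at_right 0)" "((\<lambda>s. - 2 * ?u 0 s) \<longlongrightarrow> - 2 * ?u 0 t) (at_left t)"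
        using tendsto_within_subset[OF lim, of 0 "{0..t}"] tendsto_within_subset[OF lim, of t "{0..t}"] t by auto
      then show "(((\<lambda>s. - 2 * ?u 0 s) \<circ> real_of_ereal) \<longlongrightarrow> - 2 * ?u 0 0) (at_right (ereal 0))"
        "(((\<lambda>s. - 2 * ?u 0 s) \<circ> real_of_ereal) \<longlongrightarrow> - 2 * ?u 0 t) (at_left (ereal t))"
        by (simp_all only: ereal_tendsto_simps)
    qed
    finally show ?thesis .
  qed simp
  ultimately show ?thesis unfolding q_of_def zero_ereal_def by linarith
qed

end

section \<open>Elementary facts on derivatives and increasing functions\<close>

lemma abs_derivative_le_Lipschitz:
  fixes W :: "real \<Rightarrow> real"
  assumes W: "(W has_real_derivative D) (at x)" and d: "0 < d"
    and lip: "\<And>r. \<bar>r - x\<bar> < d \<Longrightarrow> \<bar>W r - W x\<bar> \<le> K * \<bar>r - x\<bar>"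
  shows "\<bar>D\<bar> \<le> K"
proof -
  have "((\<lambda>r. (W r - W x) / (r - x)) \<longlongrightarrow> D) (at x)"
    using W by (simp add: has_field_derivative_iff)
  moreover have "\<forall>\<^sub>F r in at x. norm ((W r - W x) / (r - x)) \<le> K"
    unfolding eventually_at
    by (rule exI[of _ d]) (use d lip in \<open>auto simp: dist_real_def divide_le_eq\<close>)
  ultimately have "norm D \<le> K" by (intro Lim_norm_ubound) auto
  then show ?thesis by simp
qed

lemma derivative_ge_expansion:
  fixes h :: "real \<Rightarrow> real"
  assumes h: "(h has_real_derivative D) (at x)" and e: "\<And>x'. x \<le> x' \<Longrightarrow> \<kappa> * (x' - x) \<le> h x' - h x"
  shows "\<kappa> \<le> D"
proof (rule tendsto_lowerbound)
  show "((\<lambda>r. (h r - h x) / (r - x)) \<longlongrightarrow> D) (at_right x)"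
    using has_field_derivative_at_within[OF h] by (simp add: has_field_derivative_iff)
  show "\<forall>\<^sub>F r in at_right x. \<kappa> \<le> (h r - h x) / (r - x)"
    unfolding eventually_at_filter using e by (intro always_eventually) (auto simp: le_divide_eq)
qed simp

lemma expanding_bij:
  fixes h :: "real \<Rightarrow> real"
  assumes c: "continuous_on UNIV h" and \<kappa>: "0 < \<kappa>"
    and e: "\<And>x x'. x \<le> x' \<Longrightarrow> \<kappa> * (x' - x) \<le> h x' - h x"
  shows "bij h" "strict_mono h"
proof -
  show sm: "strict_mono h"
  proof (rule strict_monoI)
    fix x x' :: real assume "x < x'"
    then show "h x < h x'" using e[of x x'] mult_pos_pos[OF \<kappa>, of "x' - x"] by simp
  qed
  have "\<exists>x. h x = z" for z
  proof -
    define r where "r = \<bar>z - h 0\<bar> / \<kappa>"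
    have r: "0 \<le> r" "\<kappa> * r = \<bar>z - h 0\<bar>" using \<kappa> by (auto simp: r_def)
    have "h (- r) \<le> z" using e[of "-r" 0] r by simp
    moreover have "z \<le> h r" using e[of 0 r] r by simp
    ultimately show ?thesis
      using IVT'[of h "-r" z r] r continuous_on_subset[OF c, of "{-r..r}"] by auto
  qed
  then have "surj h" by (metis surjI)
  then show "bij h" using sm by (simp add: bij_def strict_mono_imp_inj_on)
qed

text \<open>Peano's form of Schwarz's theorem. The second difference of \<open>f - y x P\<close>, where \<open>P\<close> is the given
  mixed derivative, is small of second order; dividing it by the increment in \<open>x\<close> gives the claim.\<close>

lemma mixed_derivative:
  fixes f f_y f_x f_yx :: "real \<Rightarrow> real \<Rightarrow> real"
  assumes dy: "\<And>y x. ((\<lambda>y. f y x) has_real_derivative f_y y x) (at y)"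
    and dx: "\<And>y x. (f y has_real_derivative f_x y x) (at x)"
    and dyx: "\<And>y x. (f_y y has_real_derivative f_yx y x) (at x)"
    and c: "continuous_on UNIV (\<lambda>(y,x). f_yx y x)"
  shows "((\<lambda>y. f_x y x) has_real_derivative f_yx y x) (at y)"
  unfolding has_field_derivative_def has_derivative_at_alt
proof (intro conjI allI impI)
  fix e :: real assume e: "0 < e"
  let ?P = "f_yx y x"
  have "isCont (\<lambda>(y,x). f_yx y x) (y, x)" using c by (simp add: continuous_on_eq_continuous_at)
  with e obtain d where d: "d > 0" "\<And>p. dist p (y, x) < d \<Longrightarrow> dist ((\<lambda>(y,x). f_yx y x) p) ?P < e"
    unfolding continuous_at_eps_delta by (metis (no_types, lifting) case_prod_conv)
  have near: "\<bar>f_yx s r - ?P\<bar> \<le> e" if "s \<in> ball y (d/2)" "r \<in> ball x (d/2)" for s r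
  proof -
    have "dist (s, r) (y, x) \<le> dist s y + dist r x"
      unfolding dist_Pair_Pair using sqrt_sum_squares_le_sum[of "dist s y" "dist r x"] by simp
    also have "\<dots> < d" using that by (simp add: dist_commute)
    finally show ?thesis using d(2)[of "(s, r)"] by (simp add: dist_real_def)
  qed
  have V': "\<bar>f_y s r - f_y s x - (r - x) * ?P\<bar> \<le> e * \<bar>r - x\<bar>"
    if s: "s \<in> ball y (d/2)" and r: "r \<in> ball x (d/2)" for s r
  proof -
    have "norm ((\<lambda>\<rho>. f_y s \<rho> - \<rho> * ?P) r - (\<lambda>\<rho>. f_y s \<rho> - \<rho> * ?P) x) \<le> e * norm (r - x)"
    proof (rule field_differentiable_bound[of "ball x (d/2)" _ "\<lambda>\<rho>. f_yx s \<rho> - ?P"])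
      show "((\<lambda>\<rho>. f_y s \<rho> - \<rho> * ?P) has_field_derivative f_yx s \<rho> - ?P) (at \<rho> within ball x (d/2))" for \<rho>
        by (rule has_field_derivative_at_within) (auto intro!: derivative_eq_intros dyx)
    qed (use near s r d in auto)
    then show ?thesis by (simp add: algebra_simps)
  qed
  show "\<exists>d>0. \<forall>s. norm (s - y) < d \<longrightarrow> norm (f_x s x - f_x y x - ?P * (s - y)) \<le> e * norm (s - y)"
  proof (intro exI[of _ "d/2"] conjI allI impI)
    fix s assume "norm (s - y) < d / 2"
    then have s: "s \<in> ball y (d/2)" by (simp add: dist_real_def abs_minus_commute[of y])
    have "\<bar>f_x s x - f_x y x - (s - y) * ?P\<bar> \<le> e * \<bar>s - y\<bar>"
    proof (rule abs_derivative_le_Lipschitz)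
      show "((\<lambda>r. f s r - f y r - (s - y) * r * ?P) has_real_derivative f_x s x - f_x y x - (s - y) * ?P) (at x)"
        by (auto intro!: derivative_eq_intros dx)
      fix r assume "\<bar>r - x\<bar> < d / 2"
      then have r: "r \<in> ball x (d/2)" by (simp add: dist_real_def abs_minus_commute[of x])
      have "norm ((\<lambda>\<sigma>. f \<sigma> r - f \<sigma> x - \<sigma> * (r - x) * ?P) s - (\<lambda>\<sigma>. f \<sigma> r - f \<sigma> x - \<sigma> * (r - x) * ?P) y)
          \<le> e * \<bar>r - x\<bar> * norm (s - y)"
      proof (rule field_differentiable_bound[of "ball y (d/2)" _ "\<lambda>\<sigma>. f_y \<sigma> r - f_y \<sigma> x - (r - x) * ?P"])
        show "((\<lambda>\<sigma>. f \<sigma> r - f \<sigma> x - \<sigma> * (r - x) * ?P) has_field_derivative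
            f_y \<sigma> r - f_y \<sigma> x - (r - x) * ?P) (at \<sigma> within ball y (d/2))" for \<sigma>
          by (rule has_field_derivative_at_within) (auto intro!: derivative_eq_intros dy)
      qed (use V'[OF _ r] s d in auto)
      then show "\<bar>f s r - f y r - (s - y) * r * ?P - (f s x - f y x - (s - y) * x * ?P)\<bar> \<le> e * \<bar>s - y\<bar> * \<bar>r - x\<bar>"
        by (simp add: algebra_simps)
    qed (use d in simp)
    then show "norm (f_x s x - f_x y x - ?P * (s - y)) \<le> e * norm (s - y)"
      by (simp add: mult.commute)
  qed (use d in simp)
qed (auto intro: bounded_linear_mult_right)

section \<open>The solution of the reduced problem\<close>

text \<open>Here \<open>H\<close> is the inverse of \<open>m \<mapsto> m - C m\<close>, and \<open>q\<close> is the solution of the heat equation with terminal value \<open>Q\<close>.\<close>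

locale level_problem = gaussian_level +
  fixes H H' :: "real \<Rightarrow> real" and \<kappa> :: real and C :: "real \<Rightarrow> real" and q c :: "real \<Rightarrow> real \<Rightarrow> real"
  assumes H: "C1_Lipschitz H H'" and \<kappa>: "0 < \<kappa>"
    and H_expanding: "\<And>x x'. x \<le> x' \<Longrightarrow> \<kappa> * (x' - x) \<le> H x' - H x"
    and H_C: "\<And>m. H (m - C m) = m"
    and q: "\<And>y t. 0 \<le> t \<Longrightarrow> t \<le> T \<Longrightarrow> q y t = heat_kernel_solution T Q y t"
    and c: "\<And>y t. 0 \<le> t \<Longrightarrow> t < T \<Longrightarrow> ((\<lambda>x. q x t) has_real_derivative c y t) (at y)"
begin

definition g :: "real \<Rightarrow> real \<Rightarrow> real \<Rightarrow> real" where
  "g y x t = heat_kernel_solution T (\<lambda>\<rho>. H (x + Q \<rho>)) y t"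

definition G :: "real \<Rightarrow> real \<Rightarrow> real \<Rightarrow> real" where
  "G y m t = inv (\<lambda>x. g y x t) m"

definition f :: "real \<Rightarrow> real \<Rightarrow> real \<Rightarrow> real" where
  "f y m t = m - G y m t - q y t"

lemma tame_H: "tame (\<lambda>m \<rho>. H (m + Q \<rho>))"
  using tame_level_C1(1)[OF one_mem H] by simp

lemma H_continuous: "continuous_on UNIV H"
  using H unfolding C1_Lipschitz_def by (meson DERIV_isCont continuous_at_imp_continuous_on)

lemma H_bij: "bij H" "strict_mono H"
  using expanding_bij[OF H_continuous \<kappa> H_expanding] by auto

lemma Q_continuous: "continuous_on UNIV Q"
  by (rule DERIV_continuous_on) (rule Q)

lemma Q_linear: "\<exists>B\<ge>0. \<forall>\<rho>. \<bar>Q \<rho>\<bar> \<le> B * (1 + \<bar>\<rho>\<bar>)"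
  using C1_Lipschitz_linear_growth[OF C1_Lipschitz_Q] by blast

lemma tame_Q: "tame (\<lambda>m. Q)"
  using Q_linear tame_no_parameter[OF Q_continuous] by blast

lemma q_terminal: "q y T = Q y"
  using T by (simp add: q heat_kernel_solution_def)

lemma q_continuous: "continuous_on (UNIV \<times> UNIV \<times> {0..T}) (\<lambda>(y,m::real,t). q y t)"
  using continuous_on_heat_kernel_solution[OF tame_Q, of T]
  by (rule continuous_on_cong[THEN iffD1, OF refl, rotated]) (auto simp: q)

lemma g_continuous: "jointly_continuous {0..T} g"
  unfolding g_def by (rule continuous_on_heat_kernel_solution[OF tame_H])

lemma g_terminal: "g y x T = H (x + Q y)"
  by (simp add: g_def heat_kernel_solution_def)

lemma g_backward_heat: "backward_heat_solution T (\<lambda>y t. 0) (\<lambda>y. H (m + Q y)) (\<lambda>y t. g y m t)"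
  using heat_kernel_solution_backward_heat[OF tame_H T, of m] by (simp add: g_def)

text \<open>The heat kernel is a probability density, so averaging preserves the expansion of \<open>H\<close>.\<close>

lemma g_expanding:
  assumes t: "t \<le> T" and x: "x \<le> x'"
  shows "\<kappa> * (x' - x) \<le> g y x' t - g y x t"
proof -
  let ?\<sigma> = "sqrt (T - t)"
  have i: "integrable lborel (\<lambda>z. std_normal_density z * H (m + Q (y + ?\<sigma> * z)))" for m
  proof -
    obtain D where D: "\<And>\<rho>. \<bar>H (m + Q \<rho>)\<bar> \<le> D * exp \<bar>\<rho>\<bar>"
      using tameD[OF tame_H, of "\<bar>m\<bar>"] by blast
    show ?thesis
      by (rule integrable_std_normal[OF tame_continuous(1)[OF tame_H] D]) (use t in simp)
  qed
  have "\<kappa> * (x' - x) = (\<integral>z. std_normal_density z * (\<kappa> * (x' - x)) \<partial>lborel)" by simp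
  also have "\<dots> \<le> (\<integral>z. std_normal_density z * H (x' + Q (y + ?\<sigma> * z)) - std_normal_density z * H (x + Q (y + ?\<sigma> * z)) \<partial>lborel)"
  proof (rule integral_mono)
    show "integrable lborel (\<lambda>z. std_normal_density z * (\<kappa> * (x' - x)))"
      by (intro integrable_mult_left integrable_normal_density) simp
    show "integrable lborel (\<lambda>z. std_normal_density z * H (x' + Q (y + ?\<sigma> * z)) - std_normal_density z * H (x + Q (y + ?\<sigma> * z)))"
      by (intro Bochner_Integration.integrable_diff i)
    fix z
    have "\<kappa> * (x' - x) \<le> H (x' + Q (y + ?\<sigma> * z)) - H (x + Q (y + ?\<sigma> * z))"
      using H_expanding[of "x + Q (y + ?\<sigma> * z)" "x' + Q (y + ?\<sigma> * z)"] x by simp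
    from mult_left_mono[OF this normal_density_nonneg[of 0 1 z]]
    show "std_normal_density z * (\<kappa> * (x' - x))
        \<le> std_normal_density z * H (x' + Q (y + ?\<sigma> * z)) - std_normal_density z * H (x + Q (y + ?\<sigma> * z))"
      by (simp add: right_diff_distrib)
  qed
  also have "\<dots> = g y x' t - g y x t"
    using t i by (simp add: g_def heat_kernel_solution_standard)
  finally show ?thesis .
qed

lemma g_bij:
  assumes t: "0 \<le> t" "t \<le> T"
  shows "bij (\<lambda>x. g y x t)" "strict_mono (\<lambda>x. g y x t)"
proof -
  have "continuous_on UNIV (\<lambda>x. (y, x))" by (simp add: continuous_on_Pair continuous_on_const continuous_on_id)
  from continuous_on_compose2[OF continuous_on_slice_space[OF g_continuous, of t] this] t
  have "continuous_on UNIV (\<lambda>x. g y x t)" by simp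
  from expanding_bij[OF this \<kappa> g_expanding[OF t(2)]]
  show "bij (\<lambda>x. g y x t)" "strict_mono (\<lambda>x. g y x t)" by auto
qed

lemma g_G: "0 \<le> t \<Longrightarrow> t \<le> T \<Longrightarrow> g y (G y m t) t = m"
  unfolding G_def by (rule surj_f_inv_f[OF bij_is_surj[OF g_bij(1)]])

lemma G_g: "0 \<le> t \<Longrightarrow> t \<le> T \<Longrightarrow> G y (g y x t) t = x"
  unfolding G_def by (rule inv_f_f[OF bij_is_inj[OF g_bij(1)]])

lemma G_continuous: "jointly_continuous {0..T} G"
  by (rule jointly_continuous_inverse[OF g_continuous]) (use g_bij(2) g_G in auto)

lemma f_continuous: "jointly_continuous {0..T} f"
  unfolding f_def split_def
  by (intro continuous_intros G_continuous[unfolded split_def] q_continuous[unfolded split_def])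

lemma f_terminal: "f y m T = C m"
proof -
  have "g y (m - C m - Q y) T = m" by (simp add: g_terminal H_C)
  with G_g[of T y "m - C m - Q y"] T have "G y m T = m - C m - Q y" by simp
  then show ?thesis by (simp add: f_def q_terminal)
qed

lemma q_growth: "\<exists>A\<ge>0. \<forall>y t. 0 \<le> t \<longrightarrow> t \<le> T \<longrightarrow> \<bar>q y t\<bar> \<le> A * (1 + \<bar>y\<bar>)"
proof -
  obtain b where b: "b \<ge> 0" "\<And>\<rho>. \<bar>Q \<rho>\<bar> \<le> b * (1 + \<bar>\<rho>\<bar>)" using Q_linear by blast
  have "\<bar>q y t\<bar> \<le> (b + b * sqrt T) * (1 + \<bar>y\<bar>)" if "0 \<le> t" "t \<le> T" for y t
  proof -
    have "\<bar>q y t\<bar> \<le> b + b * \<bar>y\<bar> + b * sqrt T"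
      unfolding q[OF that] by (rule heat_kernel_solution_linear_growth[OF Q_continuous _ b(1) that])
        (use b(2) in \<open>simp add: distrib_left\<close>)
    also have "\<dots> \<le> (b + b * sqrt T) * (1 + \<bar>y\<bar>)" using b T by (simp add: algebra_simps)
    finally show ?thesis .
  qed
  then show ?thesis using b T by (intro exI[of _ "b + b * sqrt T"]) auto
qed

lemma g_growth: "\<exists>M\<ge>0. \<forall>y x t. 0 \<le> t \<longrightarrow> t \<le> T \<longrightarrow> \<bar>g y x t\<bar> \<le> M * ((1 + \<bar>x\<bar>) * (1 + \<bar>y\<bar>))"
proof -
  obtain B where B: "B \<ge> 0" "\<And>z. \<bar>H z\<bar> \<le> B * (1 + \<bar>z\<bar>)"
    using C1_Lipschitz_linear_growth[OF H] by blast
  obtain b where b: "b \<ge> 0" "\<And>\<rho>. \<bar>Q \<rho>\<bar> \<le> b * (1 + \<bar>\<rho>\<bar>)" using Q_linear by blast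
  define M where "M = B * (1 + b + b * sqrt T)"
  have M: "0 \<le> M" using B b T by (simp add: M_def)
  have "\<bar>g y x t\<bar> \<le> M * ((1 + \<bar>x\<bar>) * (1 + \<bar>y\<bar>))" if t: "0 \<le> t" "t \<le> T" for y x t
  proof -
    have "\<bar>H (x + Q \<rho>)\<bar> \<le> B * (1 + \<bar>x\<bar> + b) + B * b * \<bar>\<rho>\<bar>" for \<rho>
    proof -
      have "\<bar>H (x + Q \<rho>)\<bar> \<le> B * (1 + \<bar>x + Q \<rho>\<bar>)" by (rule B)
      also have "\<dots> \<le> B * (1 + (\<bar>x\<bar> + b * (1 + \<bar>\<rho>\<bar>)))"
        using b(2)[of \<rho>] B(1) by (intro mult_left_mono) auto
      finally show ?thesis by (simp add: algebra_simps)
    qed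
    from heat_kernel_solution_linear_growth[OF tame_continuous(1)[OF tame_H] this _ t, of y]
    have "\<bar>g y x t\<bar> \<le> B * (1 + \<bar>x\<bar> + b) + B * b * \<bar>y\<bar> + B * b * sqrt T"
      using B b by (simp add: g_def)
    also have "\<dots> = B * (1 + \<bar>x\<bar> + b + b * \<bar>y\<bar> + b * sqrt T)" by (simp add: algebra_simps)
    also have "\<dots> \<le> B * ((1 + b + b * sqrt T) * ((1 + \<bar>x\<bar>) * (1 + \<bar>y\<bar>)))"
      using B b T by (intro mult_left_mono) (auto simp: algebra_simps)
    finally show ?thesis by (simp add: M_def mult.assoc)
  qed
  with M show ?thesis by blast
qed

lemma f_growth: "gaussian_inverse_growth T f"
proof -
  obtain A where A: "A \<ge> 0" "\<And>y t. 0 \<le> t \<Longrightarrow> t \<le> T \<Longrightarrow> \<bar>q y t\<bar> \<le> A * (1 + \<bar>y\<bar>)" using q_growth by blast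
  obtain M where M: "M \<ge> 0" "\<And>y x t. 0 \<le> t \<Longrightarrow> t \<le> T \<Longrightarrow> \<bar>g y x t\<bar> \<le> M * ((1 + \<bar>x\<bar>) * (1 + \<bar>y\<bar>))"
    using g_growth by blast
  define K where "K = M * (1 + A)"
  have K: "K \<ge> 0" using M(1) A(1) by (simp add: K_def)
  have "\<bar>m\<bar> \<le> (8 * K) * exp (2 * (y\<^sup>2 + (m - f y m t)\<^sup>2))" if t: "t \<in> {0..T}" for y m t
  proof -
    have t': "0 \<le> t" "t \<le> T" using t by auto
    let ?u = "m - f y m t" and ?e = "\<lambda>x::real. 2 * exp (x\<^sup>2)"
    have "1 + \<bar>G y m t\<bar> \<le> (1 + A) * ((1 + \<bar>?u\<bar>) * (1 + \<bar>y\<bar>))"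
    proof -
      have "1 + \<bar>G y m t\<bar> \<le> 1 + \<bar>?u\<bar> + A * (1 + \<bar>y\<bar>)" using A(2)[OF t', of y] by (simp add: f_def)
      also have "\<dots> \<le> (1 + A) * ((1 + \<bar>?u\<bar>) * (1 + \<bar>y\<bar>))" using A(1) by (simp add: algebra_simps)
      finally show ?thesis .
    qed
    then have "M * ((1 + \<bar>G y m t\<bar>) * (1 + \<bar>y\<bar>)) \<le> M * ((1 + A) * ((1 + \<bar>?u\<bar>) * (1 + \<bar>y\<bar>)) * (1 + \<bar>y\<bar>))"
      using M(1) by (intro mult_left_mono mult_right_mono) auto
    with M(2)[OF t', of y "G y m t"] have "\<bar>m\<bar> \<le> M * ((1 + A) * ((1 + \<bar>?u\<bar>) * (1 + \<bar>y\<bar>)) * (1 + \<bar>y\<bar>))"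
      by (simp add: g_G[OF t'])
    also have "\<dots> = K * ((1 + \<bar>?u\<bar>) * (1 + \<bar>y\<bar>) * (1 + \<bar>y\<bar>))" by (simp only: K_def mult.assoc)
    also have "\<dots> \<le> K * (?e ?u * ?e y * ?e y)"
      by (intro mult_left_mono[OF _ K] mult_mono[OF mult_mono[OF abs_le_exp_square abs_le_exp_square] abs_le_exp_square]) auto
    also have "\<dots> = (8 * K) * exp (?u\<^sup>2 + 2 * y\<^sup>2)" by (simp add: mult_exp_exp)
    also have "\<dots> \<le> (8 * K) * exp (2 * (y\<^sup>2 + ?u\<^sup>2))" using K by (intro mult_left_mono) auto
    finally show ?thesis .
  qed
  then show ?thesis unfolding gaussian_inverse_growth_def by blast
qed

subsection \<open>Smoothness\<close>

text \<open>Before the terminal time \<open>g\<close> is \<open>n\<close> with \<open>H\<close>, and \<open>m + q\<close> is \<open>n\<close> with the identity.\<close>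

definition n :: "(real \<Rightarrow> real) \<Rightarrow> real \<Rightarrow> real \<Rightarrow> real \<Rightarrow> real" where
  "n \<phi> y m t = 1 / sqrt (2 * pi) * (1 / sqrt (T - t) * level_moment 0 (\<lambda>\<rho>. 1) \<phi> y m t)"

lemma smooth_alg_n:
  assumes "C1_Lipschitz \<phi> \<phi>'"
  shows "smooth_alg (n \<phi>)"
proof -
  have "smooth_alg (\<lambda>y m t. 1 / sqrt (2 * pi) * (1 / sqrt (T - t) * level_moment 0 (\<lambda>\<rho>. 1) \<phi> y m t))"
    by (rule mult[OF const mult[OF scale moment[OF one_mem assms]]])
  then show ?thesis by (simp add: n_def[abs_def])
qed

lemma n_eq: "t < T \<Longrightarrow> n \<phi> y m t = heat_kernel_solution T (\<lambda>\<rho>. \<phi> (m + Q \<rho>)) y t"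
  using heat_kernel_solution_eq_moment[of t T "\<lambda>m \<rho>. 1 * \<phi> (m + Q \<rho>)" m y] by (simp add: n_def)

lemma n_H: "t < T \<Longrightarrow> n H y m t = g y m t"
  by (simp add: n_eq g_def)

lemma C1_Lipschitz_id: "C1_Lipschitz (\<lambda>z. z) (\<lambda>z. 1)"
  unfolding C1_Lipschitz_def by auto

lemma n_id:
  assumes t: "0 \<le> t" "t < T"
  shows "n (\<lambda>z. z) y m t = m + q y t"
proof -
  obtain D where D: "\<And>\<rho>. \<bar>Q \<rho>\<bar> \<le> D * exp \<bar>\<rho>\<bar>"
    using tameD[OF tame_Q, of "\<bar>m\<bar>"] by blast
  have "integrable lborel (\<lambda>z. std_normal_density z * Q (y + sqrt (T - t) * z))"
    by (rule integrable_std_normal[OF Q_continuous D]) (use t in simp)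
  moreover have "integrable lborel (\<lambda>z. std_normal_density z * m)"
    by (intro integrable_mult_left integrable_normal_density) simp
  ultimately show ?thesis
    using t by (simp add: n_eq q heat_kernel_solution_standard distrib_left)
qed

lemma derivs_n_H:
  obtains g_y g_x g_t where "smooth_alg g_y" "smooth_alg g_x" "smooth_alg g_t" "derivs (n H) g_y g_x g_t"
  using smooth_alg_derivs[OF smooth_alg_n[OF H]] by (rule closed_under_derivsE)

lemma g_x_pos:
  assumes "derivs (n H) g_y g_x g_t" and t: "0 \<le> t" "t < T"
  shows "g_x y x t > 0"
proof -
  have "((\<lambda>x. g y x t) has_real_derivative g_x y x t) (at x)"
    using derivsD(2)[OF assms(1) t] by (simp add: n_H t)
  then have "\<kappa> \<le> g_x y x t"
    by (rule derivative_ge_expansion) (use g_expanding t in auto)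
  with \<kappa> show ?thesis by simp
qed

lemma G_continuous_before: "jointly_continuous {0..<T} G"
  by (rule continuous_on_subset[OF G_continuous]) auto

text \<open>Since \<open>m = g y (G y m t) t\<close>, the function \<open>f y m t\<close> is the value of \<open>g y x t - (x + q y t)\<close> at \<open>x = G y m t\<close>.\<close>

theorem f_smooth: "smooth_before T f"
proof -
  obtain g_y g_x g_t where d: "smooth_alg g_y" "smooth_alg g_x" "smooth_alg g_t" "derivs (n H) g_y g_x g_t"
    by (rule derivs_n_H)
  show ?thesis
  proof (rule smooth_before_level_inverse[OF d(4,1,2,3) g_x_pos[OF d(4)] _ G_continuous_before])
    show "n H y (G y z t) t = z" if "0 \<le> t" "t < T" for y z t
      using that by (simp add: n_H g_G)
    show "smooth_alg (\<lambda>y x t. n H y x t - n (\<lambda>z. z) y x t)"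
      by (rule smooth_alg_diff[OF smooth_alg_n[OF H] smooth_alg_n[OF C1_Lipschitz_id]])
    show "f y m t = n H y (G y m t) t - n (\<lambda>z. z) y (G y m t) t" if "0 \<le> t" "t < T" for y m t
      using that by (simp add: n_H n_id g_G f_def)
  qed
qed

end

lemma DERIV_unique_within:
  fixes h :: "real \<Rightarrow> real"
  assumes "(h has_real_derivative D) (at t within {0..T})" "(h has_real_derivative E) (at t within {0..T})"
    and t: "0 \<le> t" "t < T"
  shows "D = E"
proof (rule has_field_derivative_unique[OF assms(1,2)])
  have "t islimpt {0..T}"
    using t by (intro connected_imp_perfect) (auto simp: atLeastAtMost_singleton_iff)
  then show "at t within {0..T} \<noteq> bot" by (simp add: trivial_limit_within)
qed

context level_problem
begin

lemma q_derivs: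
  obtains q_t q_yy where
    "\<And>y t. 0 \<le> t \<Longrightarrow> t < T \<Longrightarrow> ((\<lambda>s. q y s) has_real_derivative q_t y t) (at t within {0..T})"
    "\<And>y t. 0 \<le> t \<Longrightarrow> t < T \<Longrightarrow> ((\<lambda>x. c x t) has_real_derivative q_yy y t) (at y)"
    "\<And>y t. 0 \<le> t \<Longrightarrow> t < T \<Longrightarrow> q_t y t + 1/2 * q_yy y t = 0"
proof -
  from heat_kernel_solution_backward_heat[OF tame_Q T] obtain q_t q_y q_yy where
    d: "\<forall>y. \<forall>t\<in>{0..<T}. ((\<lambda>s. heat_kernel_solution T Q y s) has_real_derivative q_t y t) (at t within {0..T}) \<and>
     ((\<lambda>x. heat_kernel_solution T Q x t) has_real_derivative q_y y t) (at y) \<and>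
     ((\<lambda>x. q_y x t) has_real_derivative q_yy y t) (at y) \<and> q_t y t + 1/2 * q_yy y t = 0"
    unfolding backward_heat_solution_def by blast
  show ?thesis
  proof (rule that)
    fix y t assume t: "0 \<le> t" "t < T"
    then have t': "t \<in> {0..<T}" by simp
    note d' = d[rule_format, OF t']
    have "((\<lambda>s. heat_kernel_solution T Q y s) has_real_derivative q_t y t) (at t within {0..T})" using d' by blast
    then show "((\<lambda>s. q y s) has_real_derivative q_t y t) (at t within {0..T})"
      by (rule has_real_derivative_transform) (use t q in auto)
    have "q_y x t = c x t" for x
    proof (rule DERIV_unique)
      show "((\<lambda>x. q x t) has_real_derivative q_y x t) (at x)" using d'[of x] t by (simp add: q)
    qed (rule c[OF t])
    then show "((\<lambda>x. c x t) has_real_derivative q_yy y t) (at y)" using d'[of y] by simp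
    show "q_t y t + 1/2 * q_yy y t = 0" using d'[of y] by simp
  qed
qed

text \<open>The nonlinear equation for the inverse family is the heat equation for \<open>g\<close>, divided by \<open>g\<^sub>x\<close>.\<close>

lemma inverse_equation:
  fixes x R :: real
  assumes x: "x \<noteq> 0" and heat: "gt + 1/2 * gyy = 0" "qt + 1/2 * qyy = 0"
  shows "(gt / x - qt) + 1/2 * (R / (1 / x))\<^sup>2 * (gxx / x ^ 3) + R / (1 / x) * ((gyx - R * gxx) / x\<^sup>2)
      + 1/2 * ((gyy - R * (gyx + gyx) + R\<^sup>2 * gxx) / x - qyy) = 0"
proof -
  have gt: "gt = - 1/2 * gyy" and qt: "qt = - 1/2 * qyy" using heat by auto
  show ?thesis
    unfolding gt qt using x by (simp add: field_simps power2_eq_square power3_eq_cube)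
qed

text \<open>All derivatives of \<open>f\<close> are expressed by those of \<open>g\<close> at \<open>(y, G y m t, t)\<close> and those of \<open>q\<close>. With
  \<open>R = g\<^sub>y / g\<^sub>x\<close> one finds \<open>f\<^sub>y + c = R\<close> and \<open>1 - f\<^sub>m = 1 / g\<^sub>x > 0\<close>.\<close>

lemma f_derivs:
  assumes t: "0 \<le> t" "t < T"
  shows "((\<lambda>x. f y x t) has_real_derivative f_m) (at m) \<Longrightarrow> f_m < 1"
    and "\<lbrakk>((\<lambda>s. f y m s) has_real_derivative f_t y m t) (at t within {0..T});
      \<And>y m. ((\<lambda>x. f x m t) has_real_derivative f_y y m t) (at y);
      \<And>y m. ((\<lambda>x. f y x t) has_real_derivative f_m' y m t) (at m);
      ((\<lambda>x. f_y x m t) has_real_derivative f_yy y m t) (at y);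
      ((\<lambda>x. f_y y x t) has_real_derivative f_ym y m t) (at m);
      ((\<lambda>x. f_m' y x t) has_real_derivative f_mm y m t) (at m)\<rbrakk> \<Longrightarrow>
      f_t y m t + 1/2 * ((f_y y m t + c y t) / (1 - f_m' y m t))\<^sup>2 * f_mm y m t
           + (f_y y m t + c y t) / (1 - f_m' y m t) * f_ym y m t + 1/2 * f_yy y m t = 0"
proof -
  obtain g_y g_x g_t where s: "smooth_alg g_y" "smooth_alg g_x" "smooth_alg g_t" and d: "derivs (n H) g_y g_x g_t"
    by (rule derivs_n_H)
  from smooth_alg_derivs[OF s(1)] obtain g_yy g_yx g_yt where
    sy: "smooth_alg g_yy" "smooth_alg g_yx" "smooth_alg g_yt" and dy: "derivs g_y g_yy g_yx g_yt"
    by (rule closed_under_derivsE)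
  from smooth_alg_derivs[OF s(2)] obtain g_xy g_xx g_xt where
    sx: "smooth_alg g_xy" "smooth_alg g_xx" "smooth_alg g_xt" and dx: "derivs g_x g_xy g_xx g_xt"
    by (rule closed_under_derivsE)
  obtain q_t q_yy where q': "((\<lambda>s. q y s) has_real_derivative q_t y t) (at t within {0..T})"
    "\<And>y. ((\<lambda>x. c x t) has_real_derivative q_yy y t) (at y)" "\<And>y. q_t y t + 1/2 * q_yy y t = 0"
    using q_derivs t by metis
  note pos = g_x_pos[OF d t]
  have ne: "g_x y x t \<noteq> 0" for y x using pos[of y x] by simp
  have t': "0 \<le> t" "t \<le> T" using t by auto
  have cont: "continuous_on UNIV (\<lambda>(y,x). h y x t)" if "smooth_alg h" for h
    using smooth_alg_derivs[OF that] continuous_on_slice_space[of "{0..<T}" h t] t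
    by (simp add: closed_under_derivs_def)
  have cG: "continuous_on UNIV (\<lambda>(y,m). G y m t)"
    using continuous_on_slice_space[OF G_continuous, of t] t by simp
  have gy: "((\<lambda>y. g y x t) has_real_derivative g_y y x t) (at y)"
    and gx: "((\<lambda>x. g y x t) has_real_derivative g_x y x t) (at x)" for y x
    using derivsD(1,2)[OF d t] by (simp_all add: n_H t)
  have gxy: "g_xy y x t = g_yx y x t" for y x
  proof (rule DERIV_unique)
    show "((\<lambda>y. g_x y x t) has_real_derivative g_xy y x t) (at y)" by (rule derivsD(1)[OF dx t])
    show "((\<lambda>y. g_x y x t) has_real_derivative g_yx y x t) (at y)"
      by (rule mixed_derivative[where f = "\<lambda>y x. g y x t", OF gy gx derivsD(2)[OF dy t] cont[OF sy(2)]])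
  qed
  have heat: "g_t y x t + 1/2 * g_yy y x t = 0" for y x
  proof -
    from g_backward_heat[of x] obtain u_t u_y u_yy where
      u: "\<forall>y. \<forall>t\<in>{0..<T}. ((\<lambda>s. g y x s) has_real_derivative u_t y t) (at t within {0..T}) \<and>
       ((\<lambda>y. g y x t) has_real_derivative u_y y t) (at y) \<and>
       ((\<lambda>y. u_y y t) has_real_derivative u_yy y t) (at y) \<and> u_t y t + 1/2 * u_yy y t = 0"
      unfolding backward_heat_solution_def by blast
    have t0: "t \<in> {0..<T}" using t by simp
    note u = u[rule_format, OF t0]
    have "u_y y t = g_y y x t" for y using u[of y] gy[of x y] by (blast intro: DERIV_unique)
    then have "u_yy y t = g_yy y x t" using u[of y] derivsD(1)[OF dy t, of x y] by (auto intro: DERIV_unique)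
    moreover have "u_t y t = g_t y x t"
    proof (rule DERIV_unique_within)
      have "(g y x has_real_derivative g_t y x t) (at t within {0..<T})"
        by (rule has_real_derivative_transform[OF derivsD(3)[OF d t, of y x, unfolded at_within_half_open[OF t(2)]]])
          (use t n_H in auto)
      then show "(g y x has_real_derivative g_t y x t) (at t within {0..T})"
        by (simp add: at_within_half_open[OF t(2)])
      show "(g y x has_real_derivative u_t y t) (at t within {0..T})" using u[of y] by simp
    qed (use t in simp_all)
    ultimately show ?thesis using u[of y] by simp
  qed
  define R where "R y x = g_y y x t / g_x y x t" for y x
  note G1 = inverse_family_derivatives[where h = "\<lambda>y x. g y x t", OF gy gx cont[OF s(2)] pos g_G[OF t'] cG]
  note G2 = inverse_family_second_derivatives[where h = "\<lambda>y x. g y x t", OF gy gx derivsD(1,2)[OF dy t]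
      derivsD(1,2)[OF dx t] cont[OF s(1)] cont[OF s(2)] cont[OF sy(2)] cont[OF sx(2)] pos g_G[OF t'] cG,
      folded R_def]
  have fy: "((\<lambda>x. f x m t) has_real_derivative R y (G y m t) - c y t) (at y)" for y m
    unfolding f_def
    by (rule DERIV_cong[OF DERIV_diff[OF DERIV_diff[OF DERIV_const G1(1)] c[OF t]]]) (simp add: R_def)
  have fm: "((\<lambda>x. f y x t) has_real_derivative 1 - 1 / g_x y (G y m t) t) (at m)" for y m
    unfolding f_def
    by (rule DERIV_cong[OF DERIV_diff[OF DERIV_diff[OF DERIV_ident G1(2)] DERIV_const]]) simp
  show "f_m < 1" if "((\<lambda>x. f y x t) has_real_derivative f_m) (at m)" for f_m
    using DERIV_unique[OF that fm] pos[of y "G y m t"] by simp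
  assume ft': "((\<lambda>s. f y m s) has_real_derivative f_t y m t) (at t within {0..T})"
    and fy': "\<And>y m. ((\<lambda>x. f x m t) has_real_derivative f_y y m t) (at y)"
    and fm': "\<And>y m. ((\<lambda>x. f y x t) has_real_derivative f_m' y m t) (at m)"
    and fyy': "((\<lambda>x. f_y x m t) has_real_derivative f_yy y m t) (at y)"
    and fym': "((\<lambda>x. f_y y x t) has_real_derivative f_ym y m t) (at m)"
    and fmm': "((\<lambda>x. f_m' y x t) has_real_derivative f_mm y m t) (at m)"
  have vy: "f_y y m t = R y (G y m t) - c y t" for y m by (rule DERIV_unique[OF fy' fy])
  have vm: "f_m' y m t = 1 - 1 / g_x y (G y m t) t" for y m by (rule DERIV_unique[OF fm' fm])
  let ?x = "G y m t"
  have "((\<lambda>x. R x (G x m t) - c x t) has_real_derivative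
      (g_yy y ?x t - R y ?x * (g_xy y ?x t + g_yx y ?x t) + (R y ?x)\<^sup>2 * g_xx y ?x t) / g_x y ?x t - q_yy y t) (at y)"
    using DERIV_diff[OF DERIV_minus[OF G2(1)[where y = y and z = m]] q'(2)[of y]]
    by (simp only: minus_minus minus_divide_left)
  from DERIV_unique[OF fyy'[unfolded vy] this]
  have vyy: "f_yy y m t = (g_yy y ?x t - R y ?x * (g_yx y ?x t + g_yx y ?x t) + (R y ?x)\<^sup>2 * g_xx y ?x t) / g_x y ?x t - q_yy y t"
    by (simp add: gxy)
  have "((\<lambda>m. R y (G y m t) - c y t) has_real_derivative
      (g_yx y ?x t - R y ?x * g_xx y ?x t) / (g_x y ?x t)\<^sup>2) (at m)"
    using DERIV_diff[OF DERIV_minus[OF G2(2)[where y = y and z = m]] DERIV_const[of "c y t"]]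
    by (simp only: minus_minus minus_divide_left diff_0_right)
  from DERIV_unique[OF fym'[unfolded vy] this]
  have vym: "f_ym y m t = (g_yx y ?x t - R y ?x * g_xx y ?x t) / (g_x y ?x t)\<^sup>2" .
  have "((\<lambda>m. 1 - 1 / g_x y (G y m t) t) has_real_derivative g_xx y ?x t / (g_x y ?x t) ^ 3) (at m)"
    using DERIV_diff[OF DERIV_const[of 1] G2(3)[where y = y and z = m]]
    by (simp only: minus_minus minus_divide_left diff_0)
  from DERIV_unique[OF fmm'[unfolded vm] this]
  have vmm: "f_mm y m t = g_xx y ?x t / (g_x y ?x t) ^ 3" .
  have "((\<lambda>s. f y m s) has_real_derivative g_t y ?x t / g_x y ?x t - q_t y t) (at t within {0..T})"
  proof -
    have cGt: "continuous_on {0..<T} (G y m)"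
    proof -
      have "continuous_on {0..<T} (\<lambda>s. (s, m))" by (intro continuous_intros)
      from continuous_on_compose2[OF continuous_on_slice_time[OF G_continuous_before] this] show ?thesis by auto
    qed
    have cgx: "jointly_continuous {0..<T} g_x"
      using smooth_alg_derivs[OF s(2)] by (simp add: closed_under_derivs_def)
    have Gt: "(G y m has_real_derivative - g_t y ?x t / g_x y ?x t) (at t within {0..<T})"
    proof (rule has_real_derivative_implicit[where h = "\<lambda>s x. n H y x s" and hx = "\<lambda>s x. g_x y x s" and z = m])
      show "((\<lambda>s. n H y ?x s) has_real_derivative g_t y ?x t) (at t within {0..<T})"
        using derivsD(3)[OF d t] by (simp add: at_within_half_open[OF t(2)])
      show "((\<lambda>x. n H y x s) has_real_derivative g_x y x s) (at x)" if "s \<in> {0..<T}" for s x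
        using derivsD(2)[OF d] that by simp
      show "g_x y x s > 0" if "s \<in> {0..<T}" for s x using g_x_pos[OF d] that by simp
      show "n H y (G y m s) s = m" if "s \<in> {0..<T}" for s using that by (simp add: n_H g_G)
    qed (use t continuous_on_slice_time[OF cgx] cGt in auto)
    have "((\<lambda>s. m - G y m s - q y s) has_real_derivative 0 - (- g_t y ?x t / g_x y ?x t) - q_t y t) (at t within {0..<T})"
      by (intro DERIV_diff DERIV_const Gt q'(1)[unfolded at_within_half_open[OF t(2)]])
    then show ?thesis by (simp add: f_def[abs_def] at_within_half_open[OF t(2)])
  qed
  then have vt: "f_t y m t = g_t y ?x t / g_x y ?x t - q_t y t"
    by (rule DERIV_unique_within[OF ft' _ t])
  have a: "f_y y m t + c y t = R y ?x" "1 - f_m' y m t = 1 / g_x y ?x t" by (simp_all add: vy vm)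
  show "f_t y m t + 1/2 * ((f_y y m t + c y t) / (1 - f_m' y m t))\<^sup>2 * f_mm y m t
           + (f_y y m t + c y t) / (1 - f_m' y m t) * f_ym y m t + 1/2 * f_yy y m t = 0"
    unfolding a vt vyy vym vmm by (rule inverse_equation[OF ne heat q'(3)])
qed

theorem f_solves: "solves_reduced_problem T c C f"
proof -
  from smooth_beforeD(2)[OF f_smooth] obtain f_y f_m f_t where
    sf: "smooth_before T f_y" "smooth_before T f_m" "smooth_before T f_t" and
    d: "\<forall>y m. \<forall>t\<in>{0..<T}. ((\<lambda>x. f x m t) has_real_derivative f_y y m t) (at y) \<and>
      ((\<lambda>x. f y x t) has_real_derivative f_m y m t) (at m) \<and>
      ((\<lambda>s. f y m s) has_real_derivative f_t y m t) (at t within {0..T})" by blast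
  from smooth_beforeD(2)[OF sf(1)] obtain f_yy f_ym where
    sy: "smooth_before T f_yy" "smooth_before T f_ym" and
    dy: "\<forall>y m. \<forall>t\<in>{0..<T}. ((\<lambda>x. f_y x m t) has_real_derivative f_yy y m t) (at y) \<and>
      ((\<lambda>x. f_y y x t) has_real_derivative f_ym y m t) (at m)" by blast
  from smooth_beforeD(2)[OF sf(2)] obtain f_mm where
    sm: "smooth_before T f_mm" and
    dm: "\<forall>y m. \<forall>t\<in>{0..<T}. ((\<lambda>x. f_m y x t) has_real_derivative f_mm y m t) (at m)" by blast
  have main: "\<forall>y m. \<forall>t\<in>{0..<T}.
           ((\<lambda>s. f y m s) has_real_derivative f_t y m t) (at t within {0..T}) \<and>
           ((\<lambda>x. f x m t) has_real_derivative f_y y m t) (at y) \<and>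
           ((\<lambda>x. f y x t) has_real_derivative f_m y m t) (at m) \<and>
           ((\<lambda>x. f_y x m t) has_real_derivative f_yy y m t) (at y) \<and>
           ((\<lambda>x. f_y y x t) has_real_derivative f_ym y m t) (at m) \<and>
           ((\<lambda>x. f_m y x t) has_real_derivative f_mm y m t) (at m) \<and>
           1 - f_m y m t \<noteq> 0 \<and>
           f_t y m t
           + 1/2 * ((f_y y m t + c y t) / (1 - f_m y m t))\<^sup>2 * f_mm y m t
           + (f_y y m t + c y t) / (1 - f_m y m t) * f_ym y m t
           + 1/2 * f_yy y m t = 0"
    (is "\<forall>y m. \<forall>t\<in>_. ?P y m t")
  proof (intro allI ballI)
    fix y m t assume t: "t \<in> {0..<T}"
    then have t': "0 \<le> t" "t < T" by auto
    note D = d[rule_format, OF t] dy[rule_format, OF t] dm[rule_format, OF t]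
    have "1 - f_m y m t \<noteq> 0" using f_derivs(1)[OF t'] D(1)[of m y] by fastforce
    moreover have "f_t y m t + 1/2 * ((f_y y m t + c y t) / (1 - f_m y m t))\<^sup>2 * f_mm y m t
           + (f_y y m t + c y t) / (1 - f_m y m t) * f_ym y m t + 1/2 * f_yy y m t = 0"
      by (rule f_derivs(2)[OF t', where f_y = f_y and f_m' = f_m]) (use D in blast)+
    ultimately show "?P y m t"
      using D by blast
  qed
  have "reduced_derivs T c f f_t f_y f_m f_yy f_ym f_mm"
    unfolding reduced_derivs_def by (intro conjI smooth_beforeD(1) sf sy sm main)
  then show ?thesis
    using f_continuous f_terminal unfolding solves_reduced_problem_alt by blast
qed

end

section \<open>Uniqueness\<close>

text \<open>The converse of \<open>inverse_equation\<close>: with \<open>h = x - f - q\<close>, so that \<open>h\<^sub>y = - (f\<^sub>y + c)\<close> and \<open>h\<^sub>x = 1 - f\<^sub>m\<close>, the inverse of \<open>h\<close> in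
  \<open>x\<close> satisfies the heat equation.\<close>

lemma reduced_equation_linearised:
  fixes x R :: real
  assumes x: "x \<noteq> 0" and q: "qt + 1/2 * qyy = 0"
    and pde: "ft + 1/2 * (((- hy) / x))\<^sup>2 * (- hxx) + ((- hy) / x) * (- hyx) + 1/2 * (- hyy - qyy) = 0"
    and ht: "ht = - ft - qt"
  shows "- ht / x + 1/2 * (- (hyy - hy / x * (hyx + hyx) + (hy / x)\<^sup>2 * hxx) / x) = 0"
proof -
  have "ht + 1/2 * (hyy - hy / x * (hyx + hyx) + (hy / x)\<^sup>2 * hxx)
      = - (ft + 1/2 * (((- hy) / x))\<^sup>2 * (- hxx) + ((- hy) / x) * (- hyx) + 1/2 * (- hyy - qyy)) - (qt + 1/2 * qyy)"
    by (simp add: ht algebra_simps power2_eq_square diff_divide_distrib)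
  then have "ht + 1/2 * (hyy - hy / x * (hyx + hyx) + (hy / x)\<^sup>2 * hxx) = 0" unfolding pde q by simp
  then have "- (ht + 1/2 * (hyy - hy / x * (hyx + hyx) + (hy / x)\<^sup>2 * hxx)) / x = 0" by simp
  then show ?thesis by (simp add: diff_divide_distrib add_divide_distrib algebra_simps)
qed

lemma (in level_problem) C_increasing: "m < m' \<Longrightarrow> m - C m < m' - C m'"
  using H_C[of m] H_C[of m'] H_bij(2) by (metis strict_mono_less)

text \<open>A nonvanishing continuous function on a connected set has constant sign, and the sign of \<open>1 - f\<^sub>m\<close>
  is decided by the terminal values.\<close>

lemma (in level_problem) reduced_solution_increasing:
  fixes u u_m :: "real \<Rightarrow> real \<Rightarrow> real \<Rightarrow> real"
  assumes cu: "jointly_continuous {0..T} u" and uT: "\<And>y m. u y m T = C m"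
    and cm: "jointly_continuous {0..<T} u_m"
    and dm: "\<And>y m t. 0 \<le> t \<Longrightarrow> t < T \<Longrightarrow> ((\<lambda>x. u y x t) has_real_derivative u_m y m t) (at m)"
    and ne: "\<And>y m t. 0 \<le> t \<Longrightarrow> t < T \<Longrightarrow> 1 - u_m y m t \<noteq> 0"
    and t: "0 \<le> t" "t < T"
  shows "u_m y m t < 1"
proof (rule ccontr)
  assume "\<not> u_m y m t < 1"
  with ne[OF t, of y m] have gt: "1 - u_m y m t < 0" by simp
  let ?D = "UNIV \<times> UNIV \<times> {0..<T} :: (real \<times> real \<times> real) set"
  let ?p = "\<lambda>(y,m,t). 1 - u_m y m t"
  have "connected (?p ` ?D)"
  proof (rule connected_continuous_image)
    show "continuous_on ?D ?p" using cm unfolding split_def by (intro continuous_intros)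
    show "connected ?D" by (intro convex_connected convex_Times) auto
  qed
  then have iv: "is_interval (?p ` ?D)" by (simp add: is_interval_connected_1)
  have neg: "1 - u_m y' m' t' < 0" if t': "0 \<le> t'" "t' < T" for y' m' t'
  proof (rule ccontr)
    assume "\<not> 1 - u_m y' m' t' < 0"
    moreover have "1 - u_m y m t \<in> ?p ` ?D" "1 - u_m y' m' t' \<in> ?p ` ?D"
      using t t' by (force intro: image_eqI[of _ _ "(y, m, t)"] image_eqI[of _ _ "(y', m', t')"])+
    ultimately have "0 \<in> ?p ` ?D"
      using iv gt unfolding is_interval_1 by (meson less_imp_le not_le)
    then show False using ne by auto
  qed
  have dec: "1 - u 0 1 s \<le> 0 - u 0 0 s" if s: "0 \<le> s" "s < T" for s
  proof -
    have "(\<lambda>x. x - u 0 x s) 1 \<le> (\<lambda>x. x - u 0 x s) 0"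
    proof (rule DERIV_nonpos_imp_nonincreasing[where f = "\<lambda>x. x - u 0 x s"])
      show "\<exists>D. ((\<lambda>x. x - u 0 x s) has_real_derivative D) (at x) \<and> D \<le> 0" for x
        by (rule exI[of _ "1 - u_m 0 x s"]) (use neg[OF s, of 0 x] dm[OF s, of 0 x] in
          \<open>auto intro!: derivative_eq_intros\<close>)
    qed simp
    then show ?thesis by simp
  qed
  have lim: "((\<lambda>s. u 0 x s) \<longlongrightarrow> C x) (at_left T)" for x
  proof -
    have "continuous_on {0..T} (\<lambda>s. (s, x))" by (intro continuous_intros)
    from continuous_on_compose2[OF continuous_on_slice_time[OF cu] this]
    have "continuous_on {0..T} (\<lambda>s. u 0 x s)" by auto
    then have "((\<lambda>s. u 0 x s) \<longlongrightarrow> u 0 x T) (at T within {0..T})"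
      using T by (auto simp: continuous_on_def)
    then show ?thesis using T by (simp add: uT at_within_Icc_at_left)
  qed
  have "1 - C 1 \<le> 0 - C 0"
  proof (rule tendsto_le[where F = "at_left T"])
    show "((\<lambda>s. 0 - u 0 0 s) \<longlongrightarrow> 0 - C 0) (at_left T)" "((\<lambda>s. 1 - u 0 1 s) \<longlongrightarrow> 1 - C 1) (at_left T)"
      by (intro tendsto_intros lim)+
    have "\<forall>\<^sub>F s in at_left T. s \<in> {0<..<T}"
      using T by (rule eventually_at_left_real)
    then show "\<forall>\<^sub>F s in at_left T. 1 - u 0 1 s \<le> 0 - u 0 0 s"
      by eventually_elim (rule dec, auto)
  qed simp
  with C_increasing[of 0 1] show False by simp
qed

text \<open>For a solution \<open>u\<close>, the functions \<open>h y x t = x - u y x t - q y t\<close> are increasing in \<open>x\<close>, and the growth condition makes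
  them bijective with inverses \<open>\<gamma> y z t\<close> of Gaussian growth in \<open>y\<close>. For fixed \<open>z\<close> both \<open>\<gamma>\<close> and \<open>g\<close> solve the
  backward heat equation with terminal value \<open>H (z + Q y)\<close>, hence they agree by \<open>backward_heat_unique\<close>; so \<open>h = G\<close>.\<close>

theorem (in level_problem) reduced_solution_unique:
  assumes sol: "solves_reduced_problem T c C u" and growth: "gaussian_inverse_growth T u"
    and t: "0 \<le> t" "t \<le> T"
  shows "u y m t = f y m t"
proof -
  from sol obtain u_t u_y u_m u_yy u_ym u_mm where R: "reduced_derivs T c u u_t u_y u_m u_yy u_ym u_mm"
    and cu: "jointly_continuous {0..T} u" and "\<forall>y m. u y m T = C m"
    unfolding solves_reduced_problem_alt by blast
  then have uT: "u y m T = C m" for y m by simp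
  note cont = reduced_derivsD(1-6)[OF R]
  note D' = reduced_derivsD(7-14)[OF R]
  have um: "u_m y m t < 1" if "0 \<le> t" "t < T" for y m t
    by (rule reduced_solution_increasing[OF cu uT cont(3) D'(3,7) that])
  obtain K L where KL: "\<And>y m t. t \<in> {0..T} \<Longrightarrow> \<bar>m\<bar> \<le> K * exp (L * (y\<^sup>2 + (m - u y m t)\<^sup>2))"
    using growth unfolding gaussian_inverse_growth_def by blast
  define h where "h y x t = x - u y x t - q y t" for y x t
  have ch: "jointly_continuous {0..T} h"
    unfolding h_def split_def
    by (intro continuous_intros cu[unfolded split_def] q_continuous[unfolded split_def])
  have hx: "((\<lambda>x. h y x t) has_real_derivative 1 - u_m y x t) (at x)" if "0 \<le> t" "t < T" for y x t
    unfolding h_def using D'(3)[OF that] by (auto intro!: derivative_eq_intros)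
  have mono: "strict_mono (\<lambda>x. h y x t)" if t: "0 \<le> t" "t \<le> T" for y t
  proof (cases "t = T")
    case True
    then show ?thesis
      using C_increasing by (auto simp: strict_mono_def h_def uT)
  next
    case False
    then have t': "0 \<le> t" "t < T" using t by auto
    show ?thesis
    proof (rule strict_monoI)
      fix a b :: real assume "a < b"
      then show "h y a t < h y b t"
        by (rule DERIV_pos_imp_increasing) (use hx[OF t'] um[OF t'] in force)
    qed
  qed
  have chx: "continuous_on UNIV (\<lambda>x. h y x t)" if "0 \<le> t" "t \<le> T" for y t
  proof -
    have "continuous_on UNIV (\<lambda>x. (y, x))" by (simp add: continuous_on_Pair continuous_on_const continuous_on_id)
    from continuous_on_compose2[OF continuous_on_slice_space[OF ch, of t] this] that show ?thesis by simp
  qed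
  (* The growth condition makes the increasing functions h y _ t surjective. *)
  have bound: "\<bar>x\<bar> \<le> \<bar>K\<bar> * exp (\<bar>L\<bar> * (y\<^sup>2 + (h y x t + q y t)\<^sup>2))" if t: "0 \<le> t" "t \<le> T" for y x t
  proof -
    have "\<bar>x\<bar> \<le> K * exp (L * (y\<^sup>2 + (x - u y x t)\<^sup>2))" using KL t by simp
    also have "\<dots> \<le> \<bar>K\<bar> * exp (\<bar>L\<bar> * (y\<^sup>2 + (x - u y x t)\<^sup>2))"
      by (intro mult_mono) (auto intro!: mult_right_mono)
    finally show ?thesis by (simp add: h_def)
  qed
  have surj: "\<exists>x. h y x t = z" if t: "0 \<le> t" "t \<le> T" for y z t
  proof -
    (* At x = B and x = - B the growth condition forces h + q beyond the values of h + q at 0 and of z + q. *)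
    define B where "B = \<bar>K\<bar> * exp (\<bar>L\<bar> * (y\<^sup>2 + (\<bar>h y 0 t + q y t\<bar> + \<bar>z + q y t\<bar>)\<^sup>2)) + 1"
    have B: "B > 0" unfolding B_def by (intro add_nonneg_pos) auto
    have far: "\<not> \<bar>h y x t + q y t\<bar> \<le> \<bar>h y 0 t + q y t\<bar> + \<bar>z + q y t\<bar>" if x: "\<bar>x\<bar> = B" for x
    proof
      assume "\<bar>h y x t + q y t\<bar> \<le> \<bar>h y 0 t + q y t\<bar> + \<bar>z + q y t\<bar>"
      then have "(h y x t + q y t)\<^sup>2 \<le> (\<bar>h y 0 t + q y t\<bar> + \<bar>z + q y t\<bar>)\<^sup>2"
        by (intro abs_le_square_iff[THEN iffD1]) simp
      then have "\<bar>K\<bar> * exp (\<bar>L\<bar> * (y\<^sup>2 + (h y x t + q y t)\<^sup>2)) \<le> B - 1"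
        unfolding B_def by (simp add: mult_left_mono)
      with bound[OF t, of x y] x show False by simp
    qed
    have "h y 0 t < h y B t" "h y (- B) t < h y 0 t"
      using strict_monoD[OF mono[OF t], of 0 B y] strict_monoD[OF mono[OF t], of "- B" 0 y] B by auto
    with far[of B] far[of "- B"] B have "z \<le> h y B t" "h y (- B) t \<le> z"
      by (auto simp: abs_if split: if_splits)
    then show ?thesis
      using IVT'[of "\<lambda>x. h y x t" "- B" z B] B continuous_on_subset[OF chx[OF t], of "{- B..B}"] by auto
  qed
  define \<gamma> where "\<gamma> y z t = (SOME x. h y x t = z)" for y z t
  have \<gamma>: "h y (\<gamma> y z t) t = z" if "0 \<le> t" "t \<le> T" for y z t
    unfolding \<gamma>_def by (rule someI_ex) (rule surj[OF that])
  have c\<gamma>: "jointly_continuous {0..T} \<gamma>"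
    by (rule jointly_continuous_inverse[OF ch]) (use mono \<gamma> in auto)
  have \<gamma>T: "\<gamma> y z T = H (z + Q y)" for y z
  proof -
    have "\<gamma> y z T - C (\<gamma> y z T) = z + Q y"
      using \<gamma>[of T y z] T by (simp add: h_def uT q_terminal)
    then show ?thesis using H_C[of "\<gamma> y z T"] by simp
  qed
  obtain q_t q_yy where q':
    "\<And>y t. 0 \<le> t \<Longrightarrow> t < T \<Longrightarrow> ((\<lambda>s. q y s) has_real_derivative q_t y t) (at t within {0..T})"
    "\<And>y t. 0 \<le> t \<Longrightarrow> t < T \<Longrightarrow> ((\<lambda>x. c x t) has_real_derivative q_yy y t) (at y)"
    "\<And>y t. 0 \<le> t \<Longrightarrow> t < T \<Longrightarrow> q_t y t + 1/2 * q_yy y t = 0"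
    by (rule q_derivs) blast
  have slice: "continuous_on UNIV (\<lambda>(y,x). v y x t)"
    if "jointly_continuous {0..<T} v" "0 \<le> t" "t < T" for v t
    using continuous_on_slice_space[OF that(1), of t] that by simp
  define h_y where "h_y y x t = - u_y y x t - c y t" for y x t
  define h_x where "h_x y x t = 1 - u_m y x t" for y x t
  define R where "R y x t = h_y y x t / h_x y x t" for y x t
  define \<gamma>_t where "\<gamma>_t y z t = - (- u_t y (\<gamma> y z t) t - q_t y t) / h_x y (\<gamma> y z t) t" for y z t
  define \<gamma>_yy where "\<gamma>_yy y z t = - ((- u_yy y (\<gamma> y z t) t - q_yy y t)
      - R y (\<gamma> y z t) t * (- u_ym y (\<gamma> y z t) t + - u_ym y (\<gamma> y z t) t)
      + (R y (\<gamma> y z t) t)\<^sup>2 * (- u_mm y (\<gamma> y z t) t)) / h_x y (\<gamma> y z t) t" for y z t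
  have d\<gamma>: "((\<lambda>y. \<gamma> y z t) has_real_derivative - R y (\<gamma> y z t) t) (at y)"
      "((\<lambda>y. - R y (\<gamma> y z t) t) has_real_derivative \<gamma>_yy y z t) (at y)"
    if t: "0 \<le> t" "t < T" for y z t
  proof -
    have t': "0 \<le> t" "t \<le> T" using t by auto
    have dhy: "((\<lambda>y. h y x t) has_real_derivative h_y y x t) (at y)" for y x
      unfolding h_def h_y_def
      by (rule DERIV_cong[OF DERIV_diff[OF DERIV_diff[OF DERIV_const D'(2)[OF t]] c[OF t]]]) simp
    have dhx: "((\<lambda>x. h y x t) has_real_derivative h_x y x t) (at x)" for y x
      unfolding h_x_def by (rule hx[OF t])
    have dhyy: "((\<lambda>y. h_y y x t) has_real_derivative - u_yy y x t - q_yy y t) (at y)" for y x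
      unfolding h_y_def by (intro DERIV_diff DERIV_minus D'(4)[OF t] q'(2)[OF t])
    have dhyx: "((\<lambda>x. h_y y x t) has_real_derivative - u_ym y x t) (at x)" for y x
      unfolding h_y_def
      by (rule DERIV_cong[OF DERIV_diff[OF DERIV_minus[OF D'(5)[OF t]] DERIV_const]]) simp
    have cyx: "continuous_on UNIV (\<lambda>(y,x). - u_ym y x t)"
      using slice[OF cont(5) t] unfolding split_def by (rule continuous_on_minus)
    have dhxy: "((\<lambda>y. h_x y x t) has_real_derivative - u_ym y x t) (at y)" for y x
      by (rule mixed_derivative[where f = "\<lambda>y x. h y x t", OF dhy dhx dhyx cyx])
    have dhxx: "((\<lambda>x. h_x y x t) has_real_derivative - u_mm y x t) (at x)" for y x
      unfolding h_x_def by (rule DERIV_cong[OF DERIV_diff[OF DERIV_const D'(6)[OF t]]]) simp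
    have "continuous_on UNIV (\<lambda>x. c x t)"
      by (rule DERIV_continuous_on) (rule q'(2)[OF t])
    then have "continuous_on UNIV (\<lambda>p::real\<times>real. c (fst p) t)"
      by (rule continuous_on_compose2) (auto intro: continuous_intros)
    then have cy: "continuous_on UNIV (\<lambda>(y,x). h_y y x t)"
      using slice[OF cont(2) t] unfolding split_def h_y_def by (intro continuous_intros)
    have cx: "continuous_on UNIV (\<lambda>(y,x). h_x y x t)"
      using slice[OF cont(3) t] unfolding split_def h_x_def by (intro continuous_intros)
    have cxx: "continuous_on UNIV (\<lambda>(y,x). - u_mm y x t)"
      using slice[OF cont(6) t] unfolding split_def by (rule continuous_on_minus)
    have pos: "h_x y x t > 0" for y x using um[OF t, of y x] by (simp add: h_x_def)
    have cg: "continuous_on UNIV (\<lambda>(y,z). \<gamma> y z t)"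
      using continuous_on_slice_space[OF c\<gamma>, of t] t by simp
    show "((\<lambda>y. \<gamma> y z t) has_real_derivative - R y (\<gamma> y z t) t) (at y)"
      using inverse_family_derivatives(1)[where h = "\<lambda>y x. h y x t", OF dhy dhx cx pos \<gamma>[OF t'] cg]
      by (simp add: R_def)
    show "((\<lambda>y. - R y (\<gamma> y z t) t) has_real_derivative \<gamma>_yy y z t) (at y)"
      unfolding \<gamma>_yy_def R_def
      by (rule inverse_family_second_derivatives(1)[where h = "\<lambda>y x. h y x t",
            OF dhy dhx dhyy dhyx dhxy dhxx cy cx cyx cxx pos \<gamma>[OF t'] cg])
  qed
  have dt\<gamma>: "(\<gamma> y z has_real_derivative \<gamma>_t y z t) (at t within {0..T})" if t: "0 \<le> t" "t < T" for y z t
  proof -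
    have c\<gamma>': "jointly_continuous {0..<T} \<gamma>"
      by (rule continuous_on_subset[OF c\<gamma>]) auto
    have "continuous_on {0..<T} (\<lambda>s. (s, z))" by (intro continuous_intros)
    from continuous_on_compose2[OF continuous_on_slice_time[OF c\<gamma>'] this]
    have c\<gamma>t: "continuous_on {0..<T} (\<gamma> y z)" by auto
    have chx: "jointly_continuous {0..<T} h_x"
      using cont(3) unfolding h_x_def split_def by (intro continuous_intros)
    have "(\<gamma> y z has_real_derivative \<gamma>_t y z t) (at t within {0..<T})"
      unfolding \<gamma>_t_def
    proof (rule has_real_derivative_implicit[where h = "\<lambda>s x. h y x s" and hx = "\<lambda>s x. h_x y x s" and z = z])
      show "((\<lambda>s. h y (\<gamma> y z t) s) has_real_derivative - u_t y (\<gamma> y z t) t - q_t y t) (at t within {0..<T})"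
        unfolding h_def
        by (rule DERIV_cong[OF DERIV_diff[OF DERIV_diff[OF DERIV_const D'(1)[OF t, unfolded at_within_half_open[OF t(2)]]]
              q'(1)[OF t, unfolded at_within_half_open[OF t(2)]]]]) simp
      show "((\<lambda>x. h y x s) has_real_derivative h_x y x s) (at x)" if "s \<in> {0..<T}" for s x
        unfolding h_x_def using hx that by simp
      show "h_x y x s > 0" if "s \<in> {0..<T}" for s x using um[of s y x] that by (simp add: h_x_def)
    qed (use t \<gamma> continuous_on_slice_time[OF chx] c\<gamma>t in auto)
    then show ?thesis by (simp add: at_within_half_open[OF t(2)])
  qed
  have heat: "\<gamma>_t y z t + 1/2 * \<gamma>_yy y z t = 0" if t: "0 \<le> t" "t < T" for y z t
    unfolding \<gamma>_t_def \<gamma>_yy_def R_def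
  proof (rule reduced_equation_linearised[where ft = "u_t y (\<gamma> y z t) t"])
    show "h_x y (\<gamma> y z t) t \<noteq> 0" using D'(7)[OF t] by (simp add: h_x_def)
    show "q_t y t + 1/2 * q_yy y t = 0" by (rule q'(3)[OF t])
    show "u_t y (\<gamma> y z t) t + 1/2 * ((- h_y y (\<gamma> y z t) t) / h_x y (\<gamma> y z t) t)\<^sup>2 * (- (- u_mm y (\<gamma> y z t) t))
        + (- h_y y (\<gamma> y z t) t) / h_x y (\<gamma> y z t) t * (- (- u_ym y (\<gamma> y z t) t))
        + 1/2 * (- (- u_yy y (\<gamma> y z t) t - q_yy y t) - q_yy y t) = 0"
      using D'(8)[OF t, of y "\<gamma> y z t"] by (simp add: h_y_def h_x_def add.commute[of "c y t"])
  qed simp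
  have \<gamma>_eq: "\<gamma> y z t = g y z t" if t: "0 \<le> t" "t \<le> T" for y z t
  proof -
    obtain A where A: "A \<ge> 0" "\<And>y t. 0 \<le> t \<Longrightarrow> t \<le> T \<Longrightarrow> \<bar>q y t\<bar> \<le> A * (1 + \<bar>y\<bar>)" using q_growth by blast
    obtain M where M: "M \<ge> 0" "\<And>y x t. 0 \<le> t \<Longrightarrow> t \<le> T \<Longrightarrow> \<bar>g y x t\<bar> \<le> M * ((1 + \<bar>x\<bar>) * (1 + \<bar>y\<bar>))"
      using g_growth by blast
    define K1 where "K1 = \<bar>K\<bar> * exp (\<bar>L\<bar> * (2 * z\<^sup>2 + 4 * A\<^sup>2))"
    define K2 where "K2 = 2 * M * (1 + \<bar>z\<bar>)"
    define L1 where "L1 = \<bar>L\<bar> * (1 + 4 * A\<^sup>2) + 1"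
    have K1: "K1 \<ge> 0" by (simp add: K1_def)
    have L1: "1 \<le> L1" by (simp add: L1_def)
    have dbl: "(r + s)\<^sup>2 \<le> 2 * r\<^sup>2 + 2 * s\<^sup>2" for r s :: real
      using sum_squares_bound[of r s] by (simp add: power2_sum)
    have \<gamma>_bound: "\<bar>\<gamma> y z t\<bar> \<le> K1 * exp (L1 * y\<^sup>2)" if "0 \<le> t" "t \<le> T" for y t
    proof -
      have "(q y t)\<^sup>2 \<le> (A * (1 + \<bar>y\<bar>))\<^sup>2"
        using A(2)[OF that, of y] by (intro abs_le_square_iff[THEN iffD1]) linarith
      also have "\<dots> \<le> A\<^sup>2 * (2 + 2 * y\<^sup>2)"
        unfolding power_mult_distrib using dbl[of 1 "\<bar>y\<bar>"] by (intro mult_left_mono) auto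
      finally have "y\<^sup>2 + (z + q y t)\<^sup>2 \<le> y\<^sup>2 + (2 * z\<^sup>2 + 2 * (A\<^sup>2 * (2 + 2 * y\<^sup>2)))"
        using dbl[of z "q y t"] by linarith
      then have "\<bar>L\<bar> * (y\<^sup>2 + (z + q y t)\<^sup>2) \<le> \<bar>L\<bar> * (y\<^sup>2 + (2 * z\<^sup>2 + 2 * (A\<^sup>2 * (2 + 2 * y\<^sup>2))))"
        by (rule mult_left_mono) simp
      also have "\<dots> \<le> \<bar>L\<bar> * (2 * z\<^sup>2 + 4 * A\<^sup>2) + L1 * y\<^sup>2"
        by (simp add: L1_def algebra_simps)
      finally have "\<bar>K\<bar> * exp (\<bar>L\<bar> * (y\<^sup>2 + (z + q y t)\<^sup>2)) \<le> \<bar>K\<bar> * exp (\<bar>L\<bar> * (2 * z\<^sup>2 + 4 * A\<^sup>2) + L1 * y\<^sup>2)"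
        by (intro mult_left_mono) auto
      with bound[OF that, of "\<gamma> y z t" y] show ?thesis by (simp add: \<gamma>[OF that] K1_def exp_add)
    qed
    have g_bound: "\<bar>g y z t\<bar> \<le> K2 * exp (L1 * y\<^sup>2)" if "0 \<le> t" "t \<le> T" for y t
    proof -
      have "1 * y\<^sup>2 \<le> L1 * y\<^sup>2" using L1 by (intro mult_right_mono) auto
      then have "1 + \<bar>y\<bar> \<le> 2 * exp (L1 * y\<^sup>2)" using abs_le_exp_square[of y] by (simp add: order_trans)
      then have "M * ((1 + \<bar>z\<bar>) * (1 + \<bar>y\<bar>)) \<le> M * ((1 + \<bar>z\<bar>) * (2 * exp (L1 * y\<^sup>2)))"
        using M(1) by (intro mult_left_mono) auto
      with M(2)[OF that, of y z] show ?thesis by (simp add: K2_def)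
    qed
    from g_backward_heat[of z] obtain v_t v_y v_yy where
      v: "\<forall>y. \<forall>t\<in>{0..<T}. ((\<lambda>s. g y z s) has_real_derivative v_t y t) (at t within {0..T}) \<and>
       ((\<lambda>y. g y z t) has_real_derivative v_y y t) (at y) \<and>
       ((\<lambda>y. v_y y t) has_real_derivative v_yy y t) (at y) \<and> v_t y t + 1/2 * v_yy y t = 0"
      unfolding backward_heat_solution_def by blast
    have "\<gamma> y z t - g y z t = 0"
    proof (rule backward_heat_unique[where w = "\<lambda>y t. \<gamma> y z t - g y z t" and T = T
          and w_t = "\<lambda>y t. \<gamma>_t y z t - v_t y t" and w_y = "\<lambda>y t. - R y (\<gamma> y z t) t - v_y y t"
          and w_yy = "\<lambda>y t. \<gamma>_yy y z t - v_yy y t" and K = "K1 + K2" and L = L1])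
      show "continuous_on (UNIV \<times> {0..T}) (\<lambda>(y,t). \<gamma> y z t - g y z t)"
        using continuous_on_slice_parameter[OF c\<gamma>, of z] continuous_on_slice_parameter[OF g_continuous, of z]
        unfolding split_def by (rule continuous_on_diff)
      fix y t :: real
      show "\<gamma> y z T - g y z T = 0" by (simp add: \<gamma>T g_terminal)
      show "\<bar>\<gamma> y z t - g y z t\<bar> \<le> (K1 + K2) * exp (L1 * y\<^sup>2)" if "0 \<le> t" "t \<le> T"
        using \<gamma>_bound[OF that, of y] g_bound[OF that, of y] by (simp add: distrib_right)
      {
        assume t: "0 \<le> t" "t < T"
        then have t': "t \<in> {0..<T}" by simp
        note v = v[rule_format, OF t', of y]
        show "((\<lambda>t. \<gamma> y z t - g y z t) has_real_derivative \<gamma>_t y z t - v_t y t) (at t within {0..T})"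
          by (rule DERIV_diff[OF dt\<gamma>[OF t]]) (use v in blast)
        show "((\<lambda>x. \<gamma> x z t - g x z t) has_real_derivative - R y (\<gamma> y z t) t - v_y y t) (at y)"
          by (rule DERIV_diff[OF d\<gamma>(1)[OF t]]) (use v in blast)
        show "((\<lambda>x. - R x (\<gamma> x z t) t - v_y x t) has_real_derivative \<gamma>_yy y z t - v_yy y t) (at y)"
          by (rule DERIV_diff[OF d\<gamma>(2)[OF t]]) (use v in blast)
        show "\<gamma>_t y z t - v_t y t + 1/2 * (\<gamma>_yy y z t - v_yy y t) = 0"
          using heat[OF t, of y z] v by (simp add: algebra_simps)
      }
    qed (use t L1 in auto)
    then show ?thesis by simp
  qed
  have "h y m t = h y (g y (G y m t) t) t" using t by (simp add: g_G)
  also have "\<dots> = G y m t" using \<gamma>[OF t] \<gamma>_eq[OF t] by simp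
  finally show ?thesis by (simp add: h_def f_def)
qed

section \<open>The inverse of the identity minus C, and the main result\<close>

lemma expanding_if_derivative_ge:
  fixes h h' :: "real \<Rightarrow> real"
  assumes d: "\<And>x. (h has_real_derivative h' x) (at x)" and "\<And>x. \<kappa> \<le> h' x" and x: "x \<le> x'"
  shows "\<kappa> * (x' - x) \<le> h x' - h x"
proof (cases "x = x'")
  case False
  with x have "x < x'" by simp
  from MVT2[OF this, of h h'] d obtain z where "h x' - h x = (x' - x) * h' z" by blast
  with mult_left_mono[OF assms(2)[of z], of "x' - x"] x show ?thesis by (simp add: mult.commute)
qed simp

text \<open>The bounds on the derivative of \<open>id - C\<close> are inherited, inverted, by the inverse function.\<close>

lemma inverse_of_expanding:
  fixes h h' :: "real \<Rightarrow> real"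
  assumes d: "\<And>x. (h has_real_derivative h' x) (at x)" and c: "continuous_on UNIV h'"
    and lo: "0 < k1" "\<And>x. k1 \<le> h' x" and up: "\<And>x. h' x \<le> k2"
  shows "C1_Lipschitz (inv h) (\<lambda>z. 1 / h' (inv h z))"
    and "z \<le> z' \<Longrightarrow> 1 / k2 * (z' - z) \<le> inv h z' - inv h z"
proof -
  have ch: "continuous_on UNIV h" by (rule DERIV_continuous_on) (rule d)
  have e: "k1 * (x' - x) \<le> h x' - h x" if "x \<le> x'" for x x'
    by (rule expanding_if_derivative_ge[OF d lo(2) that])
  note b = expanding_bij[OF ch lo(1) e]
  have h_inv: "h (inv h z) = z" for z using b(1) by (simp add: surj_f_inv_f[OF bij_is_surj])
  have mono: "inv h z \<le> inv h z'" if "z \<le> z'" for z z'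
    using that b(2) by (metis h_inv strict_mono_less_eq)
  have lip: "\<bar>inv h z - inv h z'\<bar> \<le> \<bar>z - z'\<bar> / k1" for z z'
  proof (cases "z \<le> z'")
    case True
    with e[OF mono[OF True]] mono[OF True] lo(1) show ?thesis by (simp add: h_inv field_simps abs_if)
  next
    case False
    then have "z' \<le> z" by simp
    with e[OF mono[OF this]] mono[OF this] lo(1) show ?thesis by (simp add: h_inv field_simps abs_if)
  qed
  have c_inv: "continuous_on UNIV (inv h)"
  proof -
    have "(1 / k1)-lipschitz_on UNIV (inv h)"
      using lip lo(1) by (intro lipschitz_onI) (auto simp: dist_real_def)
    then show ?thesis by (rule lipschitz_on_continuous_on)
  qed
  have pos: "h' x > 0" for x using lo(1) lo(2)[of x] by simp
  have "(inv h has_real_derivative 1 / h' (inv h z)) (at z)" for z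
  proof -
    have "(inv h has_real_derivative inverse (h' (inv h z))) (at z)"
      by (rule DERIV_inverse_function[where f = h and a = "z - 1" and b = "z + 1"])
        (use d pos[of "inv h z"] h_inv c_inv in \<open>auto simp: continuous_on_eq_continuous_at\<close>)
    then show ?thesis by (simp add: inverse_eq_divide)
  qed
  moreover have "continuous_on UNIV (\<lambda>z. 1 / h' (inv h z))"
    using pos by (intro continuous_on_divide continuous_on_const continuous_on_compose2[OF c c_inv])
      (auto simp: less_imp_neq[THEN not_sym])
  moreover have "\<bar>1 / h' (inv h z)\<bar> \<le> 1 / k1" for z
    using lo(1) lo(2)[of "inv h z"] pos[of "inv h z"] by (simp add: frac_le)
  ultimately show "C1_Lipschitz (inv h) (\<lambda>z. 1 / h' (inv h z))"
    unfolding C1_Lipschitz_def by blast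
  assume zz: "z \<le> z'"
  have k2: "k2 > 0" using pos[of 0] up[of 0] by simp
  have "- k2 * (inv h z' - inv h z) \<le> - h (inv h z') - - h (inv h z)"
    by (rule expanding_if_derivative_ge[where h' = "\<lambda>x. - h' x"]) (use d up mono[OF zz] in \<open>auto intro: DERIV_minus\<close>)
  then show "1 / k2 * (z' - z) \<le> inv h z' - inv h z"
    using k2 by (simp add: h_inv field_simps)
qed

lemma heat_kernel_solution_diff_const:
  assumes \<psi>: "tame (\<lambda>m. \<phi>)" and t: "t \<le> T"
  shows "heat_kernel_solution T (\<lambda>\<rho>. \<phi> \<rho> - r) y t = heat_kernel_solution T \<phi> y t - r"
proof -
  obtain D where D: "\<And>\<rho>. \<bar>\<phi> \<rho>\<bar> \<le> D * exp \<bar>\<rho>\<bar>"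
    using tameD[OF \<psi>, of "1"] by (metis abs_1 order_refl)
  have "integrable lborel (\<lambda>z. std_normal_density z * \<phi> (y + sqrt (T - t) * z))"
    by (rule integrable_std_normal[OF tame_continuous(1)[OF \<psi>] D]) (use t in simp)
  moreover have "integrable lborel (\<lambda>z. std_normal_density z * r)"
    by (intro integrable_mult_left integrable_normal_density) simp
  ultimately show ?thesis
    using t by (simp add: heat_kernel_solution_standard right_diff_distrib)
qed

theorem proposition12:
  fixes T \<theta>1 \<theta>2 k1 k2 K L :: real
    and \<nu> :: "real measure"
    and k :: "real \<Rightarrow> real \<Rightarrow> real"
    and C :: "real \<Rightarrow> real"
  assumes T: "0 < T"
    and \<theta>: "0 < \<theta>1" "\<theta>1 < \<theta>2"
    and \<nu>: "prob_space \<nu>" "sets \<nu> = sets borel" "AE \<theta> in \<nu>. \<theta> \<in> {\<theta>1..\<theta>2}"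
    and k_solves: "backward_heat_solution T (\<lambda>y t. 1/2 * (b_of \<nu> y t)\<^sup>2) (\<lambda>y. 0) k"
    and k_bounded: "\<exists>B. \<forall>y. \<forall>t\<in>{0..T}. \<bar>k y t\<bar> \<le> B"
    and C_C2: "C2 C"
    and C_0: "C 0 = 0"
    and pos: "0 < k1" "0 < k2" "0 < K" "0 < L"
    and C_deriv: "\<forall>z. k1 < 1 - deriv C z \<and> 1 - deriv C z < k2"
    and C_growth: "\<forall>z. inv (\<lambda>x. x - C x) z \<le> K * exp (L * z\<^sup>2)"
  shows
    "(\<forall>f. solves_measure_problem T (c_of \<nu> k) (\<lambda>m. C (mean m)) (\<lambda>y m t. f y (mean m) t)
          \<longleftrightarrow> solves_reduced_problem T (c_of \<nu> k) C f)
     \<and> (\<forall>y. bij (\<lambda>\<zeta>. \<zeta> - C \<zeta> - q_of \<nu> k y T))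
     \<and> (\<forall>m. backward_heat_solution T (\<lambda>y t. 0) (\<lambda>y. g_terminal T \<nu> k C y m)
              (\<lambda>y t. g_of T \<nu> k C y m t))
     \<and> (\<forall>y. \<forall>t\<in>{0..T}. bij (\<lambda>m. g_of T \<nu> k C y m t))
     \<and> solves_reduced_problem T (c_of \<nu> k) C (f_of T \<nu> k C)
     \<and> smooth_before T (f_of T \<nu> k C)
     \<and> gaussian_inverse_growth T (f_of T \<nu> k C)
     \<and> (\<forall>f. solves_reduced_problem T (c_of \<nu> k) C f \<and> gaussian_inverse_growth T f
            \<longrightarrow> (\<forall>y m. \<forall>t\<in>{0..T}. f y m t = f_of T \<nu> k C y m t))
     \<and> (\<forall>y m. \<forall>t\<in>{0..T}. \<exists>f_m.
            ((\<lambda>x. f_of T \<nu> k C y x t) has_real_derivative f_m) (at m) \<and> 1 - f_m > 0)"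
proof -
  interpret exponential_family \<nu> \<theta>1 \<theta>2
    by (intro exponential_family.intro exponential_family_axioms.intro \<nu> \<theta>)
  have T0: "0 \<le> T" using T by simp
  from k_bounded obtain B where "\<forall>y. \<forall>t\<in>{0..T}. \<bar>k y t\<bar> \<le> B" by blast
  then have B: "\<bar>k y t\<bar> \<le> B" if "0 \<le> t" "t \<le> T" for y t using that by simp
  have k: "k y t = log_heat T y t - ln (F 0 y t)" if "0 \<le> t" "t \<le> T" for y t
    by (rule bounded_solution_eq[OF T k_solves B that])
  have qe: "q_of \<nu> k y t = log_heat T y t - log_heat T 0 0"
    and ce: "c_of \<nu> k y t = heat_kernel_solution T (\<lambda>\<rho>. F 1 \<rho> T / F 0 \<rho> T) y t" if "0 \<le> t" "t \<le> T" for y t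
    by (rule q_of_eq[OF T _ that] c_of_eq[OF _ that]; rule k; assumption)+
  let ?Q = "\<lambda>\<rho>. q_of \<nu> k \<rho> T"
  have Q: "?Q \<rho> = ln (F 0 \<rho> T) - log_heat T 0 0" for \<rho>
    using qe[OF T0 order_refl, of \<rho>] by (simp add: log_heat_def heat_kernel_solution_def)
  have q: "q_of \<nu> k y t = heat_kernel_solution T ?Q y t" if "0 \<le> t" "t \<le> T" for y t
    unfolding Q qe[OF that] heat_kernel_solution_diff_const[OF tame_ln_F[OF T0] that(2)]
    by (simp add: log_heat_def)
  have c: "((\<lambda>x. q_of \<nu> k x t) has_real_derivative c_of \<nu> k y t) (at y)" if "0 \<le> t" "t < T" for y t
  proof -
    have t: "0 \<le> t" "t \<le> T" using that by auto
    show ?thesis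
      unfolding qe[OF t] ce[OF t]
      by (rule DERIV_cong[OF DERIV_diff[OF log_heat_deriv_y(1)[OF t] DERIV_const]]) simp
  qed
  obtain C' C'' where C': "\<And>z. (C has_real_derivative C' z) (at z)" "\<And>z. (C' has_real_derivative C'' z) (at z)"
    using C_C2 unfolding C2_def by blast
  have C'_bounds: "k1 < 1 - C' z" "1 - C' z < k2" for z
    using C_deriv[rule_format, of z] DERIV_imp_deriv[OF C'(1)[of z]] by auto
  let ?h = "\<lambda>x. x - C x"
  let ?H = "inv ?h"
  have dh: "(?h has_real_derivative 1 - C' x) (at x)" for x
    by (intro DERIV_diff DERIV_ident C')
  have cC': "continuous_on UNIV C'" by (rule DERIV_continuous_on) (rule C'(2))
  have ch: "continuous_on UNIV ?h" by (rule DERIV_continuous_on) (rule dh)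
  have h_expanding: "k1 * (x' - x) \<le> ?h x' - ?h x" if "x \<le> x'" for x x'
    by (rule expanding_if_derivative_ge[OF dh less_imp_le[OF C'_bounds(1)] that])
  note h_bij = expanding_bij(1)[OF ch pos(1) h_expanding]
  have cd: "continuous_on UNIV (\<lambda>x. 1 - C' x)" by (intro continuous_intros cC')
  note H = inverse_of_expanding[OF dh cd pos(1) less_imp_le[OF C'_bounds(1)] less_imp_le[OF C'_bounds(2)]]
  interpret LP: level_problem T ?Q "\<lambda>\<rho>. F 1 \<rho> T / F 0 \<rho> T" "moment_algebra T" ?H
    "\<lambda>z. 1 / (1 - C' (?H z))" "1 / k2" C "q_of \<nu> k" "c_of \<nu> k"
  proof (intro level_problem.intro level_problem_axioms.intro)
    show "gaussian_level T ?Q (\<lambda>\<rho>. F 1 \<rho> T / F 0 \<rho> T) (moment_algebra T)"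
      by (rule gaussian_level_ln_F[OF T Q])
    show "C1_Lipschitz ?H (\<lambda>z. 1 / (1 - C' (?H z)))" by (rule H(1))
    show "0 < 1 / k2" using pos by simp
    show "1 / k2 * (z' - z) \<le> ?H z' - ?H z" if "z \<le> z'" for z z' by (rule H(2)[OF that])
    show "?H (m - C m) = m" for m by (rule inv_f_f[OF bij_is_inj[OF h_bij]])
  qed (rule q c; assumption)+
  have bij_q: "bij (\<lambda>\<zeta>. \<zeta> - C \<zeta> - q_of \<nu> k y T)" for y
  proof (rule expanding_bij(1)[OF _ pos(1)])
    show "continuous_on UNIV (\<lambda>\<zeta>. \<zeta> - C \<zeta> - q_of \<nu> k y T)"
      by (rule continuous_on_diff[OF ch continuous_on_const])
    show "k1 * (x' - x) \<le> x' - C x' - q_of \<nu> k y T - (x - C x - q_of \<nu> k y T)" if "x \<le> x'" for x x'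
      using h_expanding[OF that] by linarith
  qed
  have g_terminal: "g_terminal T \<nu> k C y m = ?H (m + ?Q y)" for y m
  proof -
    have "?h (?H (m + ?Q y)) = m + ?Q y" by (rule surj_f_inv_f[OF bij_is_surj[OF h_bij]])
    then have eq: "?H (m + ?Q y) - C (?H (m + ?Q y)) - ?Q y = m" by simp
    have inj: "inj (\<lambda>\<zeta>. \<zeta> - C \<zeta> - ?Q y)"
      by (rule bij_is_inj[OF bij_q])
    show ?thesis
      unfolding g_terminal_def by (rule inv_f_eq[OF inj eq])
  qed
  have g: "g_of T \<nu> k C = LP.g"
    by (intro ext) (simp add: g_of_def LP.g_def g_terminal)
  have f: "f_of T \<nu> k C = LP.f"
    by (intro ext) (simp add: f_of_def LP.f_def LP.G_def g)
  have positive: "\<exists>f_m. ((\<lambda>x. LP.f y x t) has_real_derivative f_m) (at m) \<and> 1 - f_m > 0" if t: "t \<in> {0..T}" for y m t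
  proof (cases "t = T")
    case True
    have "1 - C' m > 0" using C'_bounds(1)[of m] pos(1) by simp
    with C'(1)[of m] show ?thesis by (auto simp: True LP.f_terminal)
  next
    case False
    with t have t': "0 \<le> t" "t < T" by auto
    from smooth_beforeD(2)[OF LP.f_smooth] t' obtain f_m where
      d: "((\<lambda>x. LP.f y x t) has_real_derivative f_m y m t) (at m)" by fastforce
    with LP.f_derivs(1)[OF t' d] show ?thesis by (intro exI[of _ "f_m y m t"]) simp
  qed
  show ?thesis
    unfolding f g g_terminal
  proof (intro conjI, goal_cases)
    case 1
    show ?case by (intro allI iffI) (erule solves_measure_problem_if_reduced solves_reduced_problem_if_measure)+
  next
    case 2
    show ?case by (intro allI bij_q)
  next
    case 3
    show ?case by (intro allI LP.g_backward_heat)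
  next
    case 4
    show ?case by (intro allI ballI LP.g_bij(1)) auto
  next
    case 5
    show ?case by (rule LP.f_solves)
  next
    case 6
    show ?case by (rule LP.f_smooth)
  next
    case 7
    show ?case by (rule LP.f_growth)
  next
    case 8
    show ?case by (intro allI impI ballI) (rule LP.reduced_solution_unique; simp)
  next
    case 9
    show ?case by (intro allI ballI) (rule positive)
  qed
qed

end
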